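(* Let $\mathbf E$, $b$, $\chi$ satisfy the assumptions listed in the context. Consider a time step $\Delta t>0$, a final time $T>0$, $N_T=[T/\Delta t]$ (integer part), $t^n=n\Delta t$, $\gamma=1-1/\sqrt2$, and for each $\varepsilon>0$ the sequence $(\mathbf x^n_\varepsilon,\mathbf v^n_\varepsilon,e^n_{\perp,\varepsilon})_{0\le n\le N_T}$ given by the two-stage semi-implicit scheme (S) written in the context, where the initial data $(\mathbf x^0_\varepsilon,\mathbf v^0_\varepsilon,e^0_{\perp,\varepsilon})$ is uniformly bounded with respect to $\varepsilon>0$. Then: 1. For all $0\le n\le N_T$, $(\mathbf x^n_\varepsilon,\mathbf v^n_\varepsilon,e^n_{\perp,\varepsilon})_{\varepsilon>0}$ is uniformly bounded with respect to $\varepsilon>0$ and $\Delta t>0$. 2. For a fixed $\Delta t>0$, the sequence $(\mathbf x^n_\varepsilon,e^n_{\perp,\varepsilon},v^n_{\parallel,\varepsilon})_{1\le n\le N_T}$ is a second order consistent approximation with respect to $\varepsilon$ to the drift-kinetic equation provided by the following scheme (L): with $\hat t^{(1)}=t^n+\Delta t/(2\gamma)$, first stage $$\frac{v_\parallel^{(1)}-v_\parallel^n}{\Delta t}=\gamma E_\parallel(t^n,\mathbf x^n),\qquad \frac{\hat{\mathbf x}^{(1)}-\mathbf x^n}{\Delta t}=\frac1{2\gamma}\mathbf U^{\rm gc}(t^n,\mathbf x^n,e_\perp^n,v_\parallel^{(1)}),\qquad \frac{\hat e_\perp^{(1)}-e_\perp^n}{\Delta t}=\frac{\varepsilon}{2\gamma}e_\perp^n\,\mathrm{div}_{\mathbf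 x_\perp}\mathbf F_\perp^\perp(t^n,\mathbf x^n),$$ and second stage $$\begin{aligned} \frac{v_\parallel^{n+1}-v_\parallel^n}{\Delta t}&=(1-\gamma)E_\parallel(t^n,\mathbf x^n)+\gamma E_\parallel(\hat t^{(1)},\hat{\mathbf x}^{(1)}),\\ \frac{\mathbf x^{n+1}-\mathbf x^n}{\Delta t}&=(1-\gamma)\mathbf U^{\rm gc}(t^n,\mathbf x^n,e_\perp^n,v_\parallel^{(1)})+\gamma\,\mathbf U^{\rm gc}(\hat t^{(1)},\hat{\mathbf x}^{(1)},\hat e_\perp^{(1)},v_\parallel^{n+1}),\\ \frac{e_\perp^{n+1}-e_\perp^n}{\Delta t}&=\varepsilon\left[(1-\gamma)e_\perp^n\,\mathrm{div}_{\mathbf x_\perp}\mathbf F_\perp^\perp(t^n,\mathbf x^n)+\gamma\,\hat e_\perp^{(1)}\,\mathrm{div}_{\mathbf x_\perp}\mathbf F_\perp^\perp(\hat t^{(1)},\hat{\mathbf x}^{(1)})\right]. \end{aligned}$$ 3. The scheme (L) is a second order approximation in $\Delta t$ of the characteristic curves of the drift-kinetic equation, $$\frac{d\mathbf x}{dt}=\mathbf U^{\rm gc}(t,\mathbf x,e_\perp,v_\parallel),\qquad \frac{de_\perp}{dt}=\varepsilon\,\mathrm{div}_{\mathbf x_\perp}\mathbf F_\perp^\perp(t,\mathbf x)\,e_\perp,\qquad \frac{dv_\parallel}{dt}=E_\parallel(t,\mathbf x).$$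
   Context: Notation. For $\mathbf w=(w_x,w_y,w_z)\in\mathbb R^3$: $w_\parallel=w_z$, $\mathbf w_\perp=(w_x,w_y,0)$, $\mathbf w_\perp^\perp=(-w_y,w_x,0)$, and $\mathbf w^\perp$ also denotes $(-w_y,w_x,0)$; $\mathbf e_z=(0,0,1)$; $\langle\cdot,\cdot\rangle$ is the Euclidean scalar product; $\nabla_{\mathbf x_\perp}=(\partial_x,\partial_y,0)$ and $\mathrm{div}_{\mathbf x_\perp}$ is the divergence in $(x,y)$. Assumptions. The given electric field satisfies $\mathbf E=-\nabla_{\mathbf x}\phi\in W^{1,\infty}((0,T)\times\mathbb R^3)$. The given magnetic intensity $b=b(t,\mathbf x_\perp)$ satisfies $b(t,\mathbf x_\perp)>b_0>0$ and $b\in W^{2,\infty}((0,T)\times\mathbb R^3)$ (the external magnetic field is $\varepsilon^{-1}b\,\mathbf e_z$). The function $\chi\in W^{1,\infty}_{loc}(\mathbb R^4)$ is such that, for any $e_\perp\in\mathbb R$ and $\mathbf v_\perp=(v_x,v_y,0)\in\mathbb R^3$: $\chi(\|\mathbf v_\perp\|^2/2,\mathbf v_\perp)=0$; $\chi(e_\perp,0)=e_\perp$; $0\le\chi(e_\perp,\mathbf v_\perp)\le e_\perp$. (The concrete choice made in the paper is $\chi(e_\perp,\mathbf v_\perp)=\frac{e_\perp}{e_\perp+\|\mathbf v_\perp\|^2/2}\left(e_\perp-\|\mathbf v_\perp\|^2/2\right)^+$, with $s^+=\max(0,s)$.) Definitions. $\mathbf H(t,\mathbf x,\mathbf v_\perp,e_\perp)=\mathbf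 E(t,\mathbf x)-\chi(e_\perp,\mathbf v_\perp)\nabla_{\mathbf x_\perp}\ln b(t,\mathbf x_\perp)$; $\mathbf F(t,\mathbf x)=\mathbf E(t,\mathbf x)/b(t,\mathbf x_\perp)$ (not to be confused with the stage forces $\mathbf F^{(1)},\mathbf F^{(2)}$ below); $$\mathbf U^{\rm gc}(t,\mathbf x,e_\perp,v_\parallel)=v_\parallel\mathbf e_z-\varepsilon\left(\mathbf F_\perp(t,\mathbf x)-\frac{e_\perp}{b^2(t,\mathbf x_\perp)}\nabla_{\mathbf x_\perp}b(t,\mathbf x_\perp)\right)^\perp .$$ The drift-kinetic equation, for an unknown density $f(t,\mathbf x,e_\perp,v_\parallel)$, is $$\partial_t f+\mathbf U^{\rm gc}\cdot\nabla_{\mathbf x}f+\varepsilon\,\mathrm{div}_{\mathbf x_\perp}\mathbf F_\perp^\perp(t,\mathbf x)\,e_\perp\,\partial_{e_\perp}f+E_\parallel\,\partial_{v_\parallel}f=0.$$ Scheme (S) ($\gamma=1-1/\sqrt2$ is the smallest root of $\gamma^2-2\gamma+1/2=0$; index $\varepsilon$ dropped). First stage: $$\frac{\mathbf v^{(1)}-\mathbf v^n}{\Delta t}=\gamma\,\mathbf F^{(1)},\qquad \mathbf F^{(1)}:=\mathbf H(t^n,\mathbf x^n,\mathbf v_\perp^n,e_\perp^n)-b(t^n,\mathbf x_\perp^n)\frac{(\mathbf v^{(1)})^\perp}{\varepsilon}.$$ Then, with $\hat t^{(1)}=t^n+\Delta t/(2\gamma)$, $$\frac{\hat{\mathbf x}^{(1)}-\mathbf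 x^n}{\Delta t}=\frac1{2\gamma}\mathbf v^{(1)},\qquad \frac{\hat e_\perp^{(1)}-e_\perp^n}{\Delta t}=\frac1{2\gamma}\langle\mathbf E_\perp(t^n,\mathbf x^n),\mathbf v_\perp^{(1)}\rangle,\qquad \frac{\hat{\mathbf v}^{(1)}-\mathbf v^n}{\Delta t}=\frac1{2\gamma}\mathbf F^{(1)}.$$ Second stage: $$\frac{\mathbf v^{n+1}-\mathbf v^n}{\Delta t}=(1-\gamma)\mathbf F^{(1)}+\gamma\mathbf F^{(2)},\qquad \mathbf F^{(2)}:=\mathbf H(\hat t^{(1)},\hat{\mathbf x}^{(1)},\hat{\mathbf v}_\perp^{(1)},\hat e_\perp^{(1)})-b(\hat t^{(1)},\hat{\mathbf x}_\perp^{(1)})\frac{(\mathbf v^{n+1})^\perp}{\varepsilon}.$$ Update: $$\frac{\mathbf x^{n+1}-\mathbf x^n}{\Delta t}=(1-\gamma)\mathbf v^{(1)}+\gamma\mathbf v^{n+1},\qquad \frac{e_\perp^{n+1}-e_\perp^n}{\Delta t}=(1-\gamma)\langle\mathbf E_\perp(t^n,\mathbf x^n),\mathbf v_\perp^{(1)}\rangle+\gamma\langle\mathbf E_\perp(\hat t^{(1)},\hat{\mathbf x}^{(1)}),\mathbf v_\perp^{n+1}\rangle.$$ "Second order consistent with respect to $\varepsilon$" means that, from $n\ge1$ on, the values produced by (S) satisfy the equations of (L) up to additive residuals of norm at most $C(\Delta t)\,\varepsilon^2$, with $C(\Delta t)$ independent of $\varepsilon$.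
   Formalization: χ(e,0)=e and 0≤χ≤e are read for e≥0, with |χ|≤|e| for e<0, and either χ(e,0)=e also for e<0 or initial energies are ≥0; fields are given on (0,T/(2γ)), covering all stage times; part 3 (global error at most C Δt²) assumes E in W^{2,∞}, b in W^{3,∞}. *)

theory Defs
  imports "HOL-Analysis.Analysis"
begin

section \<open>Sobolev spaces of bounded functions\<close>

definition dpartial :: "'a::euclidean_space \<Rightarrow> ('a \<Rightarrow> real) \<Rightarrow> 'a \<Rightarrow> real" where
  "dpartial i f x = frechet_derivative f (at x) i"

definition C1_compact_support :: "'a::euclidean_space set \<Rightarrow> ('a \<Rightarrow> real) \<Rightarrow> bool" where
  "C1_compact_support \<Omega> \<psi> \<longleftrightarrow>
     (\<forall>x. \<psi> differentiable (at x)) \<and>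
     (\<forall>i\<in>Basis. continuous_on UNIV (dpartial i \<psi>)) \<and>
     (\<exists>K. compact K \<and> K \<subseteq> \<Omega> \<and> (\<forall>x. x \<notin> K \<longrightarrow> \<psi> x = 0))"

text \<open>Testing against compactly supported functions that are only continuously differentiable,
  rather than smooth, gives the same weak derivatives (by mollification).\<close>

definition weak_partial ::
  "'a::euclidean_space set \<Rightarrow> 'a \<Rightarrow> ('a \<Rightarrow> real) \<Rightarrow> ('a \<Rightarrow> real) \<Rightarrow> bool" where
  "weak_partial \<Omega> i f g \<longleftrightarrow>
     (\<forall>\<psi>. C1_compact_support \<Omega> \<psi> \<longrightarrow>
        (LINT x:\<Omega>|lebesgue. f x * dpartial i \<psi> x) = - (LINT x:\<Omega>|lebesgue. g x * \<psi> x))"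

text \<open>\<open>W_inf k \<Omega> f\<close>: membership of \<open>f\<close> in the Sobolev space of order \<open>k\<close> and exponent infinity, for
  a convex open set \<open>\<Omega>\<close>. A class of order at least one then has exactly one representative that is
  continuous up to the boundary, and \<open>f\<close> has to be this representative, since the numerical
  schemes evaluate the fields pointwise.\<close>

primrec W_inf :: "nat \<Rightarrow> 'a::euclidean_space set \<Rightarrow> ('a \<Rightarrow> real) \<Rightarrow> bool" where
  "W_inf 0 \<Omega> f \<longleftrightarrow>
     f \<in> borel_measurable (lebesgue_on \<Omega>) \<and> (\<exists>C. AE x in lebesgue_on \<Omega>. \<bar>f x\<bar> \<le> C)"
| "W_inf (Suc k) \<Omega> f \<longleftrightarrow>
     continuous_on (closure \<Omega>) f \<and> bounded (f ` \<Omega>) \<and>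
     (\<forall>i\<in>Basis. \<exists>g. weak_partial \<Omega> i f g \<and> W_inf k \<Omega> g)"

definition W_inf_loc :: "nat \<Rightarrow> ('a::euclidean_space \<Rightarrow> real) \<Rightarrow> bool" where
  "W_inf_loc k f \<longleftrightarrow> (\<forall>r>0. W_inf k (ball 0 r) f)"

section \<open>Vector notation\<close>

definition perp :: "real^3 \<Rightarrow> real^3" where
  "perp w = vector [w $ 1, w $ 2, 0]"

definition rot :: "real^3 \<Rightarrow> real^3" where
  "rot w = vector [- (w $ 2), w $ 1, 0]"

definition ez :: "real^3" where
  "ez = axis 3 1"

definition grad_perp :: "(real^3 \<Rightarrow> real) \<Rightarrow> real^3 \<Rightarrow> real^3" where
  "grad_perp f x = vector [dpartial (axis 1 1) f x, dpartial (axis 2 1) f x, 0]"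

text \<open>The electric field is only Lipschitz, so the divergence in \<open>(x, y)\<close> is taken in the weak sense;
  its pointwise values are those of the unique continuous representative. For a continuously
  differentiable field this is the classical divergence.\<close>

definition weak_div_perp :: "(real^3 \<Rightarrow> real^3) \<Rightarrow> (real^3 \<Rightarrow> real) \<Rightarrow> bool" where
  "weak_div_perp G D \<longleftrightarrow>
     (\<forall>\<psi>. C1_compact_support UNIV \<psi> \<longrightarrow>
        (LINT x|lebesgue. G x \<bullet> grad_perp \<psi> x) = - (LINT x|lebesgue. D x * \<psi> x))"

definition div_perp :: "(real^3 \<Rightarrow> real^3) \<Rightarrow> real^3 \<Rightarrow> real" where
  "div_perp G = (THE D. continuous_on UNIV D \<and> weak_div_perp G D)"

section \<open>Forces, guiding centre velocity and characteristic curves\<close>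

definition Hforce ::
  "(real \<Rightarrow> real^3 \<Rightarrow> real^3) \<Rightarrow> (real \<Rightarrow> real^3 \<Rightarrow> real) \<Rightarrow> (real \<Rightarrow> real^3 \<Rightarrow> real) \<Rightarrow>
   real \<Rightarrow> real^3 \<Rightarrow> real^3 \<Rightarrow> real \<Rightarrow> real^3" where
  "Hforce E b chi t x w e = E t x - chi e w *\<^sub>R grad_perp (\<lambda>y. ln (b t y)) x"

definition Fdrift ::
  "(real \<Rightarrow> real^3 \<Rightarrow> real^3) \<Rightarrow> (real \<Rightarrow> real^3 \<Rightarrow> real) \<Rightarrow> real \<Rightarrow> real^3 \<Rightarrow> real^3" where
  "Fdrift E b t x = E t x /\<^sub>R b t x"

definition divF ::
  "(real \<Rightarrow> real^3 \<Rightarrow> real^3) \<Rightarrow> (real \<Rightarrow> real^3 \<Rightarrow> real) \<Rightarrow> real \<Rightarrow> real^3 \<Rightarrow> real" where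
  "divF E b t x = div_perp (\<lambda>y. rot (perp (Fdrift E b t y))) x"

definition Ugc ::
  "(real \<Rightarrow> real^3 \<Rightarrow> real^3) \<Rightarrow> (real \<Rightarrow> real^3 \<Rightarrow> real) \<Rightarrow> real \<Rightarrow>
   real \<Rightarrow> real^3 \<Rightarrow> real \<Rightarrow> real \<Rightarrow> real^3" where
  "Ugc E b \<epsilon> t x e vpar =
     vpar *\<^sub>R ez - \<epsilon> *\<^sub>R rot (perp (Fdrift E b t x) - (e / (b t x)\<^sup>2) *\<^sub>R grad_perp (b t) x)"

definition characteristic_curve ::
  "(real \<Rightarrow> real^3 \<Rightarrow> real^3) \<Rightarrow> (real \<Rightarrow> real^3 \<Rightarrow> real) \<Rightarrow> real \<Rightarrow> real \<Rightarrow>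
   (real \<Rightarrow> real^3) \<Rightarrow> (real \<Rightarrow> real) \<Rightarrow> (real \<Rightarrow> real) \<Rightarrow> bool" where
  "characteristic_curve E b \<epsilon> T X En Vpar \<longleftrightarrow>
     (\<forall>t\<in>{0..T}.
        (X has_vector_derivative Ugc E b \<epsilon> t (X t) (En t) (Vpar t)) (at t within {0..T}) \<and>
        (En has_real_derivative \<epsilon> * divF E b t (X t) * En t) (at t within {0..T}) \<and>
        (Vpar has_real_derivative E t (X t) $ 3) (at t within {0..T}))"

section \<open>The two schemes\<close>

definition \<gamma> :: real where
  "\<gamma> = 1 - 1 / sqrt 2"

definition num_steps :: "real \<Rightarrow> real \<Rightarrow> nat" where
  "num_steps T \<Delta>t = nat \<lfloor>T / \<Delta>t\<rfloor>"

text \<open>One step of the semi-implicit scheme from \<open>(x, v, e)\<close> at time \<open>t\<close> to \<open>(x', v', e')\<close>, with stage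
  values \<open>v1\<close>, \<open>xh\<close>, \<open>eh\<close>, \<open>vh\<close>. It is a relation because the velocity equations are implicit; they
  are linear and uniquely solvable.\<close>

definition schemeS_step ::
  "(real \<Rightarrow> real^3 \<Rightarrow> real^3) \<Rightarrow> (real \<Rightarrow> real^3 \<Rightarrow> real) \<Rightarrow> (real \<Rightarrow> real^3 \<Rightarrow> real) \<Rightarrow>
   real \<Rightarrow> real \<Rightarrow> real \<Rightarrow>
   real^3 \<Rightarrow> real^3 \<Rightarrow> real \<Rightarrow>
   real^3 \<Rightarrow> real^3 \<Rightarrow> real \<Rightarrow> real^3 \<Rightarrow>
   real^3 \<Rightarrow> real^3 \<Rightarrow> real \<Rightarrow> bool" where
  "schemeS_step E b chi \<epsilon> \<Delta>t t x v e v1 xh eh vh x' v' e' \<longleftrightarrow>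
     (let th = t + \<Delta>t / (2 * \<gamma>);
          F1 = Hforce E b chi t x (perp v) e - b t x *\<^sub>R (rot v1 /\<^sub>R \<epsilon>);
          F2 = Hforce E b chi th xh (perp vh) eh - b th xh *\<^sub>R (rot v' /\<^sub>R \<epsilon>)
      in (v1 - v) /\<^sub>R \<Delta>t = \<gamma> *\<^sub>R F1 \<and>
         (xh - x) /\<^sub>R \<Delta>t = (1 / (2 * \<gamma>)) *\<^sub>R v1 \<and>
         (eh - e) / \<Delta>t = (1 / (2 * \<gamma>)) * (perp (E t x) \<bullet> perp v1) \<and>
         (vh - v) /\<^sub>R \<Delta>t = (1 / (2 * \<gamma>)) *\<^sub>R F1 \<and>
         (v' - v) /\<^sub>R \<Delta>t = (1 - \<gamma>) *\<^sub>R F1 + \<gamma> *\<^sub>R F2 \<and>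
         (x' - x) /\<^sub>R \<Delta>t = (1 - \<gamma>) *\<^sub>R v1 + \<gamma> *\<^sub>R v' \<and>
         (e' - e) / \<Delta>t = (1 - \<gamma>) * (perp (E t x) \<bullet> perp v1)
                          + \<gamma> * (perp (E th xh) \<bullet> perp v'))"

text \<open>One step of the drift-kinetic scheme, each equation being satisfied up to an additive residual
  of norm at most \<open>\<delta>\<close>; \<open>\<delta> = 0\<close> is the scheme itself.\<close>

definition schemeL_step_upto ::
  "real \<Rightarrow> (real \<Rightarrow> real^3 \<Rightarrow> real^3) \<Rightarrow> (real \<Rightarrow> real^3 \<Rightarrow> real) \<Rightarrow>
   real \<Rightarrow> real \<Rightarrow> real \<Rightarrow>
   real^3 \<Rightarrow> real \<Rightarrow> real \<Rightarrow>
   real \<Rightarrow> real^3 \<Rightarrow> real \<Rightarrow>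
   real^3 \<Rightarrow> real \<Rightarrow> real \<Rightarrow> bool" where
  "schemeL_step_upto \<delta> E b \<epsilon> \<Delta>t t x e vpar vpar1 xh eh x' e' vpar' \<longleftrightarrow>
     (let th = t + \<Delta>t / (2 * \<gamma>)
      in \<bar>(vpar1 - vpar) / \<Delta>t - \<gamma> * E t x $ 3\<bar> \<le> \<delta> \<and>
         norm ((xh - x) /\<^sub>R \<Delta>t - (1 / (2 * \<gamma>)) *\<^sub>R Ugc E b \<epsilon> t x e vpar1) \<le> \<delta> \<and>
         \<bar>(eh - e) / \<Delta>t - \<epsilon> / (2 * \<gamma>) * e * divF E b t x\<bar> \<le> \<delta> \<and>
         \<bar>(vpar' - vpar) / \<Delta>t - ((1 - \<gamma>) * E t x $ 3 + \<gamma> * E th xh $ 3)\<bar> \<le> \<delta> \<and>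
         norm ((x' - x) /\<^sub>R \<Delta>t - ((1 - \<gamma>) *\<^sub>R Ugc E b \<epsilon> t x e vpar1
                                  + \<gamma> *\<^sub>R Ugc E b \<epsilon> th xh eh vpar')) \<le> \<delta> \<and>
         \<bar>(e' - e) / \<Delta>t - \<epsilon> * ((1 - \<gamma>) * e * divF E b t x
                                + \<gamma> * eh * divF E b th xh)\<bar> \<le> \<delta>)"

text \<open>The stage time \<open>t + \<Delta>t / (2 * \<gamma>)\<close> exceeds \<open>t + \<Delta>t\<close>, because \<open>2 * \<gamma> < 1\<close>. Up to the final time
  \<open>T\<close> the schemes evaluate the fields at times up to \<open>T / (2 * \<gamma>)\<close>, so this is the time horizon on
  which the fields have to be given.\<close>

definition field_domain :: "real \<Rightarrow> (real \<times> (real^3)) set" where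
  "field_domain T = {0<..<T / (2 * \<gamma>)} \<times> UNIV"

end

theory Submission
  imports Defs
begin

text \<open>
  Everything rests on pointwise regularity of the fields, which are only given through weak
  derivatives. A mean value theorem for weak derivatives (\<open>weak_partial_increment\<close>) turns them into
  Lipschitz bounds and into Taylor expansions with a quadratic remainder that hold uniformly up to
  the two end times. With this the divergence of the drift, which is defined weakly, becomes the
  explicit first order expression \<open>divF_eq\<close>: as the electric field is a gradient, the derivatives of
  the electric field cancel and only those of the magnetic intensity remain.

  \<^bold>\<open>Boundedness.\<close> Over one step the velocity across the magnetic field is multiplied by
  \<open>(1 - \<i> sqrt 2 \<mu>\<^sub>1) / ((1 + \<i> \<mu>\<^sub>1) (1 + \<i> \<mu>\<^sub>2))\<close>, where the two \<open>\<mu>\<close> are multiples of the magnetic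
  intensities \<open>b\<^sub>1\<close>, \<open>b\<^sub>2\<close> that the two stages see and contain the unbounded factor \<open>1 / \<epsilon>\<close>. If
  \<open>b\<^sub>1 = b\<^sub>2\<close> the modulus is at most 1. In general it exceeds 1 by at most \<open>O(\<bar>b\<^sub>1 - b\<^sub>2\<bar>\<^sup>2)\<close>, uniformly in \<open>\<epsilon>\<close>
  (\<open>amplification_le\<close>), and the two intensities are taken at points whose distance is of the order of
  the time step times the velocity. The excess is therefore of second order in the time step,
  although quadratic in the velocity: for small time steps it is harmless on a bounded time
  interval, and for large ones there are only finitely many steps (\<open>discrete_growth_bound\<close>).

  \<^bold>\<open>Consistency.\<close> For a fixed time step bounded velocities force the stiff term to be bounded, so the
  velocity across the field is \<open>O(\<epsilon>)\<close> after one step. Then all its increments are \<open>O(\<epsilon>)\<close> as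
  well, and dividing the velocity equation by \<open>b / \<epsilon>\<close> identifies the velocity with the guiding centre
  velocity up to \<open>O(\<epsilon>\<^sup>2)\<close> (\<open>slaving_identity\<close>); here the interpolation function \<open>\<chi>\<close> returns the
  energy up to \<open>O(\<epsilon>)\<close> because it is evaluated at a velocity of this size.

  \<^bold>\<open>Order in time.\<close> Over one step both the characteristic flow and the drift-kinetic scheme differ
  from the explicit midpoint step by \<open>O(\<Delta>t\<^sup>3)\<close> (\<open>exact_flow_midpoint\<close>,
  \<open>two_stage_midpoint\<close>). For the scheme this rests on the order condition \<open>\<gamma>\<^sup>2 - 2 \<gamma> + 1/2 = 0\<close>. A discrete
  Gronwall argument for the midpoint step finishes the proof.
\<close>

section \<open>Continuously differentiable functions\<close>

text \<open>The regularity required of test functions, separated from their support, so that test functions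
  can be multiplied and divided by coefficients such as the magnetic intensity.\<close>
definition C1 :: "('a::euclidean_space \<Rightarrow> real) \<Rightarrow> bool" where
  "C1 f \<longleftrightarrow> (\<forall>x. f differentiable (at x)) \<and> (\<forall>i\<in>Basis. continuous_on UNIV (dpartial i f))"

lemma C1I:
  assumes "\<And>x. (f has_derivative D x) (at x)" "\<And>i. i \<in> Basis \<Longrightarrow> continuous_on UNIV (\<lambda>x. D x i)"
  shows "C1 f" "dpartial i f x = D x i"
proof -
  show eq: "dpartial i f x = D x i" for i x
    unfolding dpartial_def using frechet_derivative_at[OF assms(1)[of x]] by simp
  show "C1 f"
    unfolding C1_def using assms eq by (auto simp: differentiable_def cong: continuous_on_cong)
qed

lemma C1_has_derivative:
  assumes "C1 f"
  shows "(f has_derivative (\<lambda>h. \<Sum>i\<in>Basis. (h \<bullet> i) * dpartial i f x)) (at x)"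
proof -
  have d: "(f has_derivative frechet_derivative f (at x)) (at x)"
    using assms frechet_derivative_works by (auto simp: C1_def)
  then interpret linear "frechet_derivative f (at x)"
    using has_derivative_linear by blast
  have "frechet_derivative f (at x) h = (\<Sum>i\<in>Basis. (h \<bullet> i) * dpartial i f x)" for h
  proof -
    have "frechet_derivative f (at x) h = frechet_derivative f (at x) (\<Sum>i\<in>Basis. (h \<bullet> i) *\<^sub>R i)"
      by (simp add: euclidean_representation)
    then show ?thesis by (simp add: sum scale dpartial_def)
  qed
  then have "frechet_derivative f (at x) = (\<lambda>h. \<Sum>i\<in>Basis. (h \<bullet> i) * dpartial i f x)" by auto
  then show ?thesis using d by metis
qed

lemma C1_continuous: "C1 f \<Longrightarrow> continuous_on UNIV f"
  by (meson C1_has_derivative continuous_at_imp_continuous_on has_derivative_continuous)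

lemma C1_times:
  assumes "C1 f" "C1 g"
  shows "C1 (\<lambda>x. f x * g x)"
    and "i \<in> Basis \<Longrightarrow> dpartial i (\<lambda>x. f x * g x) x = f x * dpartial i g x + dpartial i f x * g x"
proof -
  let ?D = "\<lambda>x h. f x * (\<Sum>i\<in>Basis. (h \<bullet> i) * dpartial i g x) + (\<Sum>i\<in>Basis. (h \<bullet> i) * dpartial i f x) * g x"
  have 1: "((\<lambda>x. f x * g x) has_derivative ?D x) (at x)" for x
    by (intro has_derivative_mult C1_has_derivative assms)
  have 2: "continuous_on UNIV (\<lambda>x. ?D x i)" if "i \<in> Basis" for i
    using assms C1_continuous[OF assms(1)] C1_continuous[OF assms(2)]
    by (auto simp: C1_def intro!: continuous_intros)
  note * = C1I[OF 1 2]
  show "C1 (\<lambda>x. f x * g x)" by (rule *(1))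
  show "dpartial i (\<lambda>x. f x * g x) x = f x * dpartial i g x + dpartial i f x * g x" if "i \<in> Basis"
    using *(2)[of i x] that by (simp add: inner_Basis if_distrib if_distribR cong: if_cong)
qed

lemma C1_shift:
  assumes "C1 f"
  shows "C1 (\<lambda>x. f (x + w))" "i \<in> Basis \<Longrightarrow> dpartial i (\<lambda>x. f (x + w)) x = dpartial i f (x + w)"
proof -
  let ?D = "\<lambda>x h. (\<Sum>i\<in>Basis. (h \<bullet> i) * dpartial i f (x + w))"
  have "((\<lambda>x. x + w) has_derivative (\<lambda>h. h)) (at x)" for x :: 'a
    by (auto intro!: derivative_eq_intros)
  then have 1: "((\<lambda>x. f (x + w)) has_derivative ?D x) (at x)" for x
    using has_derivative_compose[OF _ C1_has_derivative[OF assms]] by blast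
  have 2: "continuous_on UNIV (\<lambda>x. ?D x i)" if "i \<in> Basis" for i
  proof -
    have "continuous_on UNIV (\<lambda>x. dpartial j f (x + w))" if "j \<in> Basis" for j
      using assms that
      by (intro continuous_on_compose2[of UNIV "dpartial j f" UNIV "\<lambda>x. x + w"] continuous_intros) (auto simp: C1_def)
    then show ?thesis
      by (intro continuous_intros) auto
  qed
  note * = C1I[OF 1 2]
  show "C1 (\<lambda>x. f (x + w))" by (rule *(1))
  show "dpartial i (\<lambda>x. f (x + w)) x = dpartial i f (x + w)" if "i \<in> Basis"
    using *(2)[of i x] that by (simp add: inner_Basis if_distrib if_distribR cong: if_cong)
qed

lemma dpartial_0_outside:
  assumes "closed K" "\<And>x. x \<notin> K \<Longrightarrow> f x = 0" "x \<notin> K"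
  shows "dpartial i f x = 0"
proof -
  have "(f has_derivative (\<lambda>h. 0)) (at x)"
    by (rule has_derivative_transform_within_open[of "\<lambda>_. 0" _ _ _ "- K"]) (use assms in auto)
  then show ?thesis unfolding dpartial_def using frechet_derivative_at by metis
qed

lemma C1_compact_supportI:
  assumes "C1 f" "compact K" "K \<subseteq> \<Omega>" "\<And>x. x \<notin> K \<Longrightarrow> f x = 0"
  shows "C1_compact_support \<Omega> f"
  using assms unfolding C1_def C1_compact_support_def by blast

section \<open>Bump functions\<close>

lemma DERIV_pos_part_square: "((\<lambda>t. (max 0 t)\<^sup>2) has_real_derivative 2 * max 0 t) (at (t::real))"
proof -
  consider "t < 0" | "t = 0" | "t > 0" by linarith
  then show ?thesis
  proof cases
    case 1
    then have "((\<lambda>t::real. 0) has_real_derivative 2 * max 0 t) (at t)" by simp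
    then show ?thesis
      by (rule has_field_derivative_transform_within_open[of _ _ _ "{..<0}"]) (use 1 in auto)
  next
    case 3
    have "((\<lambda>t::real. t\<^sup>2) has_real_derivative 2 * max 0 t) (at t)"
      using 3 by (auto intro!: derivative_eq_intros)
    then show ?thesis
      by (rule has_field_derivative_transform_within_open[of _ _ _ "{0<..}"]) (use 3 in auto)
  next
    case 2
    have "((\<lambda>h::real. (max 0 h)\<^sup>2 / h) \<longlongrightarrow> 0) (at 0)"
    proof (rule Lim_null_comparison[where g="\<lambda>h. \<bar>h\<bar>"])
      have "norm ((max 0 h)\<^sup>2 / h) \<le> \<bar>h\<bar>" for h :: real
        by (cases "h \<le> 0") (auto simp: max_def power2_eq_square)
      then show "eventually (\<lambda>h::real. norm ((max 0 h)\<^sup>2 / h) \<le> \<bar>h\<bar>) (at 0)" by simp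
    qed (auto intro!: tendsto_eq_intros)
    then show ?thesis using 2 by (simp add: DERIV_def)
  qed
qed

text \<open>The square of the positive part is continuously differentiable across the sphere of radius \<open>d\<close>;
  this is all the regularity that a test function has to have.\<close>
definition bump :: "real \<Rightarrow> 'a::euclidean_space \<Rightarrow> 'a \<Rightarrow> real" where
  "bump d c z = (max 0 (d\<^sup>2 - (z - c) \<bullet> (z - c)))\<^sup>2"

lemma C1_bump: "C1 (bump d c)"
proof -
  let ?D = "\<lambda>z h. (2 * max 0 (d\<^sup>2 - (z - c) \<bullet> (z - c))) * (- (2 * ((z - c) \<bullet> h)))"
  have "(bump d c has_derivative ?D z) (at z)" for z
  proof -
    have "((\<lambda>z. d\<^sup>2 - (z - c) \<bullet> (z - c)) has_derivative (\<lambda>h. - (2 * ((z - c) \<bullet> h)))) (at z)"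
      by (auto intro!: derivative_eq_intros simp: inner_commute)
    from has_derivative_compose[OF this DERIV_pos_part_square[unfolded has_field_derivative_def]]
    show ?thesis by (simp add: bump_def[abs_def])
  qed
  then show ?thesis
    by (rule C1I(1)) (intro continuous_intros)
qed

lemma bump_nonneg: "bump d c z \<ge> 0"
  by (simp add: bump_def)

lemma bump_eq_0: "d > 0 \<Longrightarrow> z \<notin> cball c d \<Longrightarrow> bump d c z = 0"
  by (auto simp: bump_def dist_norm norm_minus_commute power2_norm_eq_inner[symmetric] max_def power_mono)

lemma bump_center: "d > 0 \<Longrightarrow> bump d c c > 0"
  by (simp add: bump_def)

lemma bump_shift: "bump d c (z + w) = bump d (c - w) z"
  by (simp add: bump_def algebra_simps)

section \<open>Integrals of compactly supported functions along translations\<close>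

lemma integral_compact_support:
  fixes f :: "'a::euclidean_space \<Rightarrow> real"
  assumes "continuous_on UNIV f" "\<And>z. z \<notin> cbox a b \<Longrightarrow> f z = 0"
  shows "integrable lebesgue f" "(LINT z|lebesgue. f z) = integral (cbox a b) f"
proof -
  have "integrable lborel (\<lambda>z. indicator (cbox a b) z *\<^sub>R f z)"
    by (rule borel_integrable_compact) (use assms continuous_on_subset[OF assms(1)] in auto)
  also have "(\<lambda>z. indicator (cbox a b) z *\<^sub>R f z) = f"
    using assms(2) by (auto simp: indicator_def fun_eq_iff)
  finally have i: "integrable lborel f" .
  have m: "f \<in> borel_measurable lborel"
    using assms(1) by (simp add: borel_measurable_continuous_onI)
  show "integrable lebesgue f"
    using i m integrable_completion by blast
  have "(LINT z|lebesgue. f z) = (LINT z|lborel. f z)"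
    by (rule integral_completion) (rule m)
  also have "\<dots> = integral UNIV f" using integral_lborel[OF i] by simp
  also have "\<dots> = integral (cbox a b) f"
  proof -
    have "f = (\<lambda>z. if z \<in> cbox a b then f z else 0)" using assms(2) by auto
    then have "integral UNIV f = integral UNIV (\<lambda>z. if z \<in> cbox a b then f z else 0)" by (rule arg_cong)
    also have "\<dots> = integral (cbox a b) f" by (rule integral_restrict_UNIV)
    finally show ?thesis .
  qed
  finally show "(LINT z|lebesgue. f z) = integral (cbox a b) f" .
qed

lemma integral_translate:
  fixes f :: "'a::euclidean_space \<Rightarrow> real"
  assumes "continuous_on UNIV f"
  shows "(LINT z|lebesgue. f (z + w)) = (LINT z|lebesgue. f z)"
proof -
  have m: "f \<in> borel_measurable borel"
    using assms by (simp add: borel_measurable_continuous_onI)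
  have "(\<lambda>z. f (z + w)) \<in> borel_measurable borel"
    by (intro borel_measurable_continuous_onI continuous_on_compose2[OF assms] continuous_intros) auto
  then have "(LINT z|lebesgue. f (z + w)) = (LINT z|lborel. f (z + w))"
    by (intro integral_completion) simp
  also have "\<dots> = (LINT z|distr lborel borel (\<lambda>z. w + z). f z)"
    by (subst integral_distr) (use m in \<open>auto simp: add.commute\<close>)
  also have "\<dots> = (LINT z|lborel. f z)" by (simp add: lborel_distr_plus)
  also have "\<dots> = (LINT z|lebesgue. f z)"
    by (rule integral_completion[symmetric]) (use m in auto)
  finally show ?thesis .
qed

lemma continuous_dpartial_transport:
  assumes "C1 q" shows "continuous_on UNIV (\<lambda>z. \<Sum>i\<in>Basis. (w \<bullet> i) * dpartial i q (z + v))"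
proof -
  have "continuous_on UNIV (\<lambda>z. dpartial j q (z + v))" if "j \<in> Basis" for j
    using assms that
    by (intro continuous_on_compose2[of UNIV "dpartial j q" UNIV "\<lambda>x. x + v"] continuous_intros) (auto simp: C1_def)
  then show ?thesis
    by (intro continuous_intros) auto
qed

text \<open>Translations are what turns weak derivatives into increments and, later, moves derivatives
  from one factor to the other. The factor \<open>p\<close> is merely continuous; the derivative falls on \<open>q\<close>. The
  box dominates all supports, which reduces the claim to Leibniz' rule for integrals over a box.\<close>
lemma DERIV_integral_transport:
  fixes p q :: "'a::euclidean_space \<Rightarrow> real"
  assumes p: "continuous_on UNIV p" and q: "C1 q"
    and supp: "\<And>z r. z \<notin> cbox a b \<Longrightarrow> \<bar>r\<bar> \<le> 1 \<Longrightarrow> p z * q (z + r *\<^sub>R w) = 0"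
    and s: "\<bar>s\<bar> \<le> 1"
  shows "((\<lambda>r. LINT z|lebesgue. p z * q (z + r *\<^sub>R w)) has_real_derivative
           (LINT z|lebesgue. p z * (\<Sum>i\<in>Basis. (w \<bullet> i) * dpartial i q (z + s *\<^sub>R w)))) (at s within {-1..1})"
proof -
  let ?d = "\<lambda>r z. p z * (\<Sum>i\<in>Basis. (w \<bullet> i) * dpartial i q (z + r *\<^sub>R w))"
  have der: "((\<lambda>r. p z * q (z + r *\<^sub>R w)) has_real_derivative ?d r z) (at r within S)" for r z S
  proof -
    have 1: "((\<lambda>r. z + r *\<^sub>R w) has_derivative (\<lambda>h. h *\<^sub>R w)) (at r within S)"
      by (auto intro!: derivative_eq_intros)
    have "((\<lambda>r. q (z + r *\<^sub>R w)) has_derivative (\<lambda>h. \<Sum>i\<in>Basis. (h *\<^sub>R w \<bullet> i) * dpartial i q (z + r *\<^sub>R w))) (at r within S)"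
      by (rule has_derivative_compose[OF 1 C1_has_derivative[OF q]])
    then have "((\<lambda>r. q (z + r *\<^sub>R w)) has_real_derivative (\<Sum>i\<in>Basis. (w \<bullet> i) * dpartial i q (z + r *\<^sub>R w))) (at r within S)"
      unfolding has_field_derivative_def
      by (rule has_derivative_eq_rhs) (auto simp: sum_distrib_left algebra_simps)
    then show ?thesis by (rule DERIV_cmult)
  qed
  have qc: "continuous_on UNIV q" by (rule C1_continuous[OF q])
  have cont: "continuous_on UNIV (\<lambda>z. p z * q (z + r *\<^sub>R w))" for r
    by (intro continuous_intros p continuous_on_compose2[OF qc]) auto
  have dq: "continuous_on UNIV (dpartial j q)" if "j \<in> Basis" for j using q that by (simp add: C1_def)
  have eq: "(LINT z|lebesgue. p z * q (z + r *\<^sub>R w)) = integral (cbox a b) (\<lambda>z. p z * q (z + r *\<^sub>R w))"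
    if "r \<in> {-1..1}" for r
    by (rule integral_compact_support(2)[OF cont supp]) (use that in auto)
  have d0: "?d s z = 0" if "z \<notin> cbox a b" for z
  proof -
    have *: "((\<lambda>r. 0) has_real_derivative ?d s z) (at s within {-1..1})"
      by (rule has_field_derivative_transform_within[OF der, of 1]) (use supp[OF that] s in \<open>auto simp: abs_le_iff\<close>)
    have "at s within {-1..1::real} \<noteq> bot"
      using s by (auto simp: trivial_limit_within islimpt_Icc)
    then show ?thesis
      using * vector_derivative_unique_within[of s "{-1..1}" "\<lambda>_. 0" "?d s z" 0]
      by (simp add: has_real_derivative_iff_has_vector_derivative)
  qed
  have contd: "continuous_on UNIV (?d s)"
    by (intro continuous_on_mult p continuous_dpartial_transport[OF q])
  have "((\<lambda>r. integral (cbox a b) (\<lambda>z. p z * q (z + r *\<^sub>R w))) has_real_derivative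
      integral (cbox a b) (?d s)) (at s within {-1..1})"
  proof (rule leibniz_rule_field_derivative[OF der])
    show "(\<lambda>z. p z * q (z + r *\<^sub>R w)) integrable_on cbox a b" for r
      by (rule integrable_continuous) (use cont continuous_on_subset in blast)
    show "continuous_on ({-1..1} \<times> cbox a b) (\<lambda>(x, t). ?d x t)"
      unfolding case_prod_beta
      by (intro continuous_intros continuous_on_compose2[OF p] continuous_on_compose2[OF dq]) auto
  qed (use s in auto)
  then have "((\<lambda>r. LINT z|lebesgue. p z * q (z + r *\<^sub>R w)) has_real_derivative
      integral (cbox a b) (?d s)) (at s within {-1..1})"
    by (rule has_field_derivative_transform_within[of _ _ _ _ 1]) (use eq s in auto)
  moreover have "(LINT z|lebesgue. ?d s z) = integral (cbox a b) (?d s)"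
    by (rule integral_compact_support(2)[OF contd d0])
  ultimately show ?thesis by simp
qed

lemma bump_integrable: "integrable lebesgue (\<lambda>z. F z * bump d c z)"
  if F: "continuous_on UNIV F" and d: "d > 0" for F :: "'a::euclidean_space \<Rightarrow> real"
proof -
  have "bounded (cball c d)" by simp
  then obtain a where a: "cball c d \<subseteq> cbox (-a) a"
    using bounded_subset_cbox_symmetric by blast
  have "bump d c z = 0" if "z \<notin> cbox (-a) a" for z using bump_eq_0[OF d, of z c] a that by blast
  then show ?thesis
    by (intro integral_compact_support(1)[of _ "-a" a] continuous_intros F C1_continuous[OF C1_bump]) simp
qed

lemma bump_integral_pos:
  assumes d: "d > 0" shows "(LINT z|lebesgue. bump d c z) > 0"
proof -
  have "bounded (cball c d)" by simp
  then obtain a where a: "cball c d \<subseteq> cbox (-a) a"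
    using bounded_subset_cbox_symmetric by blast
  have 0: "bump d c z = 0" if "z \<notin> cbox (-a) a" for z using bump_eq_0[OF d, of z c] a that by blast
  have cont: "continuous_on UNIV (bump d c)" by (rule C1_continuous[OF C1_bump])
  have eq: "(LINT z|lebesgue. bump d c z) = integral (cbox (-a) a) (bump d c)"
    by (rule integral_compact_support(2)[OF cont 0])
  have "ball c d \<subseteq> box (-a) a"
    using a by (metis ball_subset_cball interior_maximal interior_cbox open_ball order_trans)
  then have "box (-a) a \<noteq> {}" using d by (metis centre_in_ball empty_iff subsetD)
  then have "integral (cbox (-a) a) (bump d c) \<noteq> 0"
    using integral_cbox_eq_0_iff[OF continuous_on_subset[OF cont] _ bump_nonneg, of "-a" a]
      bump_center[OF d, of c] a d by (metis centre_in_cball less_eq_real_def less_irrefl subsetD subset_UNIV)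
  moreover have "(LINT z|lebesgue. bump d c z) \<ge> 0"
    by (intro integral_nonneg_AE) (simp add: bump_nonneg)
  ultimately show ?thesis using eq by simp
qed

text \<open>A bump of small radius, divided by its integral, evaluates a continuous function up to its
  oscillation.\<close>
lemma bump_average:
  fixes F :: "'a::euclidean_space \<Rightarrow> real"
  assumes F: "continuous_on UNIV F" and d: "d > 0"
    and close: "\<And>z. z \<in> cball c d \<Longrightarrow> \<bar>F z - m\<bar> \<le> e"
  shows "\<bar>(LINT z|lebesgue. F z * bump d c z) - m * (LINT z|lebesgue. bump d c z)\<bar>
           \<le> e * (LINT z|lebesgue. bump d c z)"
proof -
  have i: "integrable lebesgue (\<lambda>z. F z * bump d c z)" by (rule bump_integrable[OF F d])
  have j: "integrable lebesgue (bump d c)" using bump_integrable[OF _ d, of "\<lambda>_. 1"] by simp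
  have "(LINT z|lebesgue. F z * bump d c z) - m * (LINT z|lebesgue. bump d c z)
      = (LINT z|lebesgue. F z * bump d c z - m * bump d c z)"
    using i j by simp
  also have "\<bar>\<dots>\<bar> \<le> (LINT z|lebesgue. \<bar>F z * bump d c z - m * bump d c z\<bar>)"
    by (rule integral_abs_bound)
  also have "\<dots> \<le> (LINT z|lebesgue. e * bump d c z)"
  proof (rule integral_mono)
    fix z show "\<bar>F z * bump d c z - m * bump d c z\<bar> \<le> e * bump d c z"
      using close[of z] bump_eq_0[OF d, of z c] bump_nonneg[of d c z]
      by (cases "z \<in> cball c d")
         (auto simp: abs_mult left_diff_distrib[symmetric] intro: mult_right_mono)
  qed (use i j in auto)
  also have "\<dots> = e * (LINT z|lebesgue. bump d c z)" by simp
  finally show ?thesis .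
qed

section \<open>Sobolev functions of exponent infinity\<close>

text \<open>The mean value theorem for weak derivatives. Let \<open>\<rho>\<close> be a bump around \<open>x\<close>. The function
  \<open>s \<mapsto> \<integral> f z * \<rho> (z - s *\<^sub>R v) \<partial>z\<close> has the derivative \<open>\<integral> (\<Sum>i\<in>Basis. (v \<bullet> i) * g i z) * \<rho> (z - s *\<^sub>R v) \<partial>z\<close>,
  which differs from \<open>c * \<integral> \<rho>\<close> by at most \<open>K * \<integral> \<rho>\<close>; convexity keeps the translated bumps inside
  \<open>\<Omega>\<close>. The ordinary mean value theorem on \<open>[0, 1]\<close> and bumps of vanishing radius give the claim. With
  \<open>c = 0\<close> it yields Lipschitz bounds; with \<open>c\<close> the value of the derivative at \<open>x\<close> it yields a Taylor
  expansion.\<close>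

lemma weak_partial_increment:
  fixes f :: "'a::euclidean_space \<Rightarrow> real"
  assumes "open \<Omega>" "convex \<Omega>" and f: "continuous_on (closure \<Omega>) f"
    and weak: "\<And>i. i \<in> Basis \<Longrightarrow> weak_partial \<Omega> i f (g i)"
    and bdd: "\<And>i. i \<in> Basis \<Longrightarrow> W_inf 0 \<Omega> (g i)"
    and K: "AE z in lebesgue_on \<Omega>. \<bar>(\<Sum>i\<in>Basis. (v \<bullet> i) * g i z) - c\<bar> \<le> K"
    and x: "x \<in> \<Omega>" and xv: "x + v \<in> \<Omega>"
  shows "\<bar>f (x + v) - f x - c\<bar> \<le> K"
proof -
  \<comment> \<open>Integrands have to be continuous on the whole space; the bumps below vanish where \<open>f\<close> is altered.\<close>
  obtain F where F: "continuous_on UNIV F" and Ff: "\<And>z. z \<in> closure \<Omega> \<Longrightarrow> F z = f z"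
    using Tietze_unbounded[OF f, of UNIV] by auto
  have Ff': "F z = f z" if "z \<in> \<Omega>" for z using that Ff closure_subset by blast
  have \<Omega>m[measurable]: "\<Omega> \<in> sets lebesgue" using \<open>open \<Omega>\<close> by simp
  obtain \<eta>1 where \<eta>1: "\<eta>1 > 0" "cball x \<eta>1 \<subseteq> \<Omega>" using \<open>open \<Omega>\<close> x open_contains_cball by metis
  obtain \<eta>2 where \<eta>2: "\<eta>2 > 0" "cball (x + v) \<eta>2 \<subseteq> \<Omega>" using \<open>open \<Omega>\<close> xv open_contains_cball by metis
  have inside: "cball (x + s *\<^sub>R v) d \<subseteq> \<Omega>" if d: "d \<le> \<eta>1" "d \<le> \<eta>2" and s: "0 \<le> s" "s \<le> 1" for s d
  proof
    fix z assume z: "z \<in> cball (x + s *\<^sub>R v) d"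
    have "z - s *\<^sub>R v \<in> cball x \<eta>1" "z + (1 - s) *\<^sub>R v \<in> cball (x + v) \<eta>2"
      using z d by (auto simp: dist_norm algebra_simps)
    then have "(1 - s) *\<^sub>R (z - s *\<^sub>R v) + s *\<^sub>R (z + (1 - s) *\<^sub>R v) \<in> \<Omega>"
      using s \<eta>1 \<eta>2 by (intro convexD[OF \<open>convex \<Omega>\<close>]) auto
    then show "z \<in> \<Omega>" by (simp add: algebra_simps)
  qed
  have main: "\<bar>(LINT z|lebesgue. F z * bump d (x + v) z) - (LINT z|lebesgue. F z * bump d x z)
                - c * (LINT z|lebesgue. bump d x z)\<bar> \<le> K * (LINT z|lebesgue. bump d x z)"
    if d: "d > 0" "d \<le> \<eta>1" "d \<le> \<eta>2" for d
  proof -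
    define J where "J = (LINT z|lebesgue. bump d x z)"
    define I where "I = (\<lambda>r. LINT z|lebesgue. F z * bump d x (z + r *\<^sub>R (- v)))"
    define I' where "I' = (\<lambda>r. LINT z|lebesgue. F z * (\<Sum>i\<in>Basis. ((- v) \<bullet> i) * dpartial i (bump d x) (z + r *\<^sub>R (- v))))"
    have "bounded (cball x (d + norm v))" by simp
    then obtain a where a: "cball x (d + norm v) \<subseteq> cbox (-a) a"
      using bounded_subset_cbox_symmetric by blast
    have supp: "F z * bump d x (z + r *\<^sub>R (- v)) = 0" if "z \<notin> cbox (-a) a" "\<bar>r\<bar> \<le> 1" for z r
    proof -
      have "norm (r *\<^sub>R v) \<le> norm v" using that(2) by (simp add: mult_left_le_one_le)
      moreover have "z \<notin> cball x (d + norm v)" using that(1) a by blast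
      then have "norm (z - x) > d + norm v" by (simp add: dist_norm norm_minus_commute)
      ultimately have "z + r *\<^sub>R (- v) \<notin> cball x d"
        using norm_triangle_ineq2[of "z - x" "r *\<^sub>R v"] by (auto simp: dist_norm norm_minus_commute algebra_simps)
      then show ?thesis using bump_eq_0[OF d(1)] by auto
    qed
    have DI: "(I has_real_derivative I' s) (at s within {-1..1})" if "\<bar>s\<bar> \<le> 1" for s
      unfolding I_def I'_def
      by (rule DERIV_integral_transport[OF F C1_bump supp that])
    have I'_bound: "\<bar>I' s - c * J\<bar> \<le> K * J" if s: "0 \<le> s" "s \<le> 1" for s
    proof -
      define \<psi> where "\<psi> = bump d (x + s *\<^sub>R v)"
      have \<psi>eq: "(\<lambda>z. bump d x (z + s *\<^sub>R (- v))) = \<psi>"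
        unfolding \<psi>_def by (rule ext) (subst bump_shift, simp)
      have C1\<psi>: "C1 \<psi>" unfolding \<psi>_def by (rule C1_bump)
      have \<psi>0: "\<psi> z \<ge> 0" for z by (simp add: \<psi>_def bump_nonneg)
      have \<psi>out: "\<psi> z = 0" if "z \<notin> cball (x + s *\<^sub>R v) d" for z
        unfolding \<psi>_def by (rule bump_eq_0[OF d(1) that])
      have sub: "cball (x + s *\<^sub>R v) d \<subseteq> \<Omega>" by (rule inside) (use d s in auto)
      have test: "C1_compact_support \<Omega> \<psi>"
        by (rule C1_compact_supportI[OF C1\<psi> compact_cball sub \<psi>out])
      have \<psi>\<Omega>: "\<psi> z = 0" if "z \<notin> \<Omega>" for z using \<psi>out sub that by blast
      have d\<psi>out: "dpartial i \<psi> z = 0" if "z \<notin> cball (x + s *\<^sub>R v) d" for i z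
        by (rule dpartial_0_outside[OF closed_cball \<psi>out that])
      have d\<psi>: "dpartial i (bump d x) (z + s *\<^sub>R (- v)) = dpartial i \<psi> z" if "i \<in> Basis" for i z
        using C1_shift(2)[OF C1_bump that, of d x "s *\<^sub>R (- v)" z] \<psi>eq by simp
      have contd: "continuous_on UNIV (dpartial i \<psi>)" if "i \<in> Basis" for i
        using C1\<psi> that by (simp add: C1_def)
      have "bounded (cball (x + s *\<^sub>R v) d)" by simp
      then obtain a where a: "cball (x + s *\<^sub>R v) d \<subseteq> cbox (-a) a"
        using bounded_subset_cbox_symmetric by blast
      have intF: "integrable lebesgue (\<lambda>z. F z * dpartial i \<psi> z)" if "i \<in> Basis" for i
      proof (rule integral_compact_support(1)[of _ "-a" a])
        show "continuous_on UNIV (\<lambda>z. F z * dpartial i \<psi> z)"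
          by (intro continuous_on_mult F contd that)
        show "F z * dpartial i \<psi> z = 0" if "z \<notin> cbox (-a) a" for z
          using d\<psi>out[of z i] that a by (metis mult_zero_right subsetD)
      qed
      have int\<psi>: "integrable lebesgue \<psi>"
        using bump_integrable[OF _ d(1), of "\<lambda>_. 1"] by (simp add: \<psi>_def)
      have intg: "integrable lebesgue (\<lambda>z. indicator \<Omega> z *\<^sub>R (g i z * \<psi> z))" if "i \<in> Basis" for i
      proof -
        obtain C where C: "AE z in lebesgue_on \<Omega>. \<bar>g i z\<bar> \<le> C" and gm: "g i \<in> borel_measurable (lebesgue_on \<Omega>)"
          using bdd[OF \<open>i \<in> Basis\<close>] by auto
        have C': "AE z in lebesgue. z \<in> \<Omega> \<longrightarrow> \<bar>g i z\<bar> \<le> C"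
          using C by (simp add: AE_restrict_space_iff)
        have "integrable lebesgue (\<lambda>z. C * \<psi> z)" using int\<psi> by simp
        then show ?thesis
        proof (rule Bochner_Integration.integrable_bound)
          have m1: "(\<lambda>z. indicator \<Omega> z *\<^sub>R g i z) \<in> borel_measurable lebesgue"
            using gm by (subst (asm) borel_measurable_restrict_space_iff) simp_all
          have m2: "\<psi> \<in> borel_measurable lebesgue" using int\<psi> by simp
          have "(\<lambda>z. (indicator \<Omega> z *\<^sub>R g i z) * \<psi> z) \<in> borel_measurable lebesgue"
            using m1 m2 by (rule borel_measurable_times)
          then show "(\<lambda>z. indicator \<Omega> z *\<^sub>R (g i z * \<psi> z)) \<in> borel_measurable lebesgue"
            by (simp add: mult.assoc)
          show "AE z in lebesgue. norm (indicator \<Omega> z *\<^sub>R (g i z * \<psi> z)) \<le> norm (C * \<psi> z)"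
            using C' by eventually_elim (auto simp: indicator_def abs_mult intro!: mult_right_mono)
        qed
      qed
      have Fi: "(LINT z|lebesgue. F z * dpartial i \<psi> z) = - (LINT z|lebesgue. indicator \<Omega> z *\<^sub>R (g i z * \<psi> z))"
        if "i \<in> Basis" for i
      proof -
        have "(LINT z|lebesgue. F z * dpartial i \<psi> z) = (LINT z:\<Omega>|lebesgue. f z * dpartial i \<psi> z)"
          unfolding set_lebesgue_integral_def
        proof (rule Bochner_Integration.integral_cong)
          show "F z * dpartial i \<psi> z = indicator \<Omega> z *\<^sub>R (f z * dpartial i \<psi> z)" for z
          proof (cases "z \<in> \<Omega>")
            case False
            then have "z \<notin> cball (x + s *\<^sub>R v) d" using sub by blast
            then show ?thesis using d\<psi>out[of z i] False by simp
          qed (simp add: Ff')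
        qed simp
        also have "\<dots> = - (LINT z:\<Omega>|lebesgue. g i z * \<psi> z)"
          using weak[OF that] test by (simp add: weak_partial_def)
        finally show ?thesis by (simp add: set_lebesgue_integral_def)
      qed
      have "I' s = (LINT z|lebesgue. (\<Sum>i\<in>Basis. - (v \<bullet> i) * (F z * dpartial i \<psi> z)))"
        unfolding I'_def
      proof (rule Bochner_Integration.integral_cong)
        show "F z * (\<Sum>i\<in>Basis. - v \<bullet> i * dpartial i (bump d x) (z + s *\<^sub>R - v)) =
            (\<Sum>i\<in>Basis. - (v \<bullet> i) * (F z * dpartial i \<psi> z))" for z
          unfolding sum_distrib_left by (rule sum.cong) (simp_all only: d\<psi>, simp_all)
      qed simp
      also have "\<dots> = (\<Sum>i\<in>Basis. - (v \<bullet> i) * (LINT z|lebesgue. F z * dpartial i \<psi> z))"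
        using intF by (subst Bochner_Integration.integral_sum) auto
      also have "\<dots> = (\<Sum>i\<in>Basis. (v \<bullet> i) * (LINT z|lebesgue. indicator \<Omega> z *\<^sub>R (g i z * \<psi> z)))"
        by (intro sum.cong) (simp_all add: Fi)
      also have "\<dots> = (LINT z|lebesgue. (\<Sum>i\<in>Basis. (v \<bullet> i) * (indicator \<Omega> z *\<^sub>R (g i z * \<psi> z))))"
        using intg by (subst Bochner_Integration.integral_sum) auto
      finally have I's: "I' s = \<dots>" .
      have intsum: "integrable lebesgue (\<lambda>z. \<Sum>i\<in>Basis. (v \<bullet> i) * (indicator \<Omega> z *\<^sub>R (g i z * \<psi> z)))"
        using intg by (intro Bochner_Integration.integrable_sum integrable_mult_right) auto
      have J: "J = (LINT z|lebesgue. \<psi> z)"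
        unfolding J_def \<psi>eq[symmetric]
        by (rule integral_translate[symmetric]) (rule C1_continuous[OF C1_bump])
      have "I' s - c * J = (LINT z|lebesgue. (\<Sum>i\<in>Basis. (v \<bullet> i) * (indicator \<Omega> z *\<^sub>R (g i z * \<psi> z))) - c * \<psi> z)"
        unfolding I's J using intsum int\<psi> by simp
      also have "\<bar>\<dots>\<bar> \<le> (LINT z|lebesgue. \<bar>(\<Sum>i\<in>Basis. (v \<bullet> i) * (indicator \<Omega> z *\<^sub>R (g i z * \<psi> z))) - c * \<psi> z\<bar>)"
        by (rule integral_abs_bound)
      also have "\<dots> \<le> (LINT z|lebesgue. K * \<psi> z)"
      proof (rule integral_mono_AE)
        have K': "AE z in lebesgue. z \<in> \<Omega> \<longrightarrow> \<bar>(\<Sum>i\<in>Basis. (v \<bullet> i) * g i z) - c\<bar> \<le> K"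
          using K by (simp add: AE_restrict_space_iff)
        then show "AE z in lebesgue. \<bar>(\<Sum>i\<in>Basis. (v \<bullet> i) * (indicator \<Omega> z *\<^sub>R (g i z * \<psi> z))) - c * \<psi> z\<bar> \<le> K * \<psi> z"
        proof eventually_elim
          case (elim z)
          show ?case
          proof (cases "z \<in> \<Omega>")
            case True
            then have "(\<Sum>i\<in>Basis. (v \<bullet> i) * (indicator \<Omega> z *\<^sub>R (g i z * \<psi> z))) - c * \<psi> z
                = ((\<Sum>i\<in>Basis. (v \<bullet> i) * g i z) - c) * \<psi> z"
              by (simp add: sum_distrib_right left_diff_distrib mult.assoc)
            then show ?thesis using elim True \<psi>0[of z] by (simp add: abs_mult mult_right_mono)
          qed (simp add: \<psi>\<Omega>)
        qed
      qed (use intsum int\<psi> in auto)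
      also have "\<dots> = K * J" using J by simp
      finally show ?thesis .
    qed
    have "norm ((\<lambda>r. I r - r * (c * J)) 1 - (\<lambda>r. I r - r * (c * J)) 0) \<le> K * J * norm (1 - 0::real)"
    proof (rule field_differentiable_bound[where S="{0..1}" and f'="\<lambda>s. I' s - c * J"])
      fix s :: real assume s: "s \<in> {0..1}"
      have "(I has_real_derivative I' s) (at s within {0..1})"
        by (rule has_field_derivative_subset[OF DI]) (use s in auto)
      then show "((\<lambda>r. I r - r * (c * J)) has_real_derivative I' s - c * J) (at s within {0..1})"
        by (auto intro!: derivative_eq_intros)
      show "norm (I' s - c * J) \<le> K * J" using I'_bound s by simp
    qed auto
    then have "\<bar>I 1 - I 0 - c * J\<bar> \<le> K * J" by (simp add: algebra_simps)
    moreover have "I 1 = (LINT z|lebesgue. F z * bump d (x + v) z)" "I 0 = (LINT z|lebesgue. F z * bump d x z)"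
      unfolding I_def using bump_shift[of d x _ "- v"] by simp_all
    ultimately show ?thesis by (simp add: J_def)
  qed
  show ?thesis
  proof (rule field_le_epsilon)
    fix e :: real assume "e > 0"
    then have e2: "e / 2 > 0" by simp
    have loc: "\<exists>d>0. \<forall>z\<in>cball p d. \<bar>F z - F p\<bar> \<le> e / 2" for p
    proof -
      obtain d where "d > 0" "\<And>z. dist z p < d \<Longrightarrow> dist (F z) (F p) < e / 2"
        using F e2 unfolding continuous_on_iff by (metis UNIV_I)
      then show ?thesis
        by (intro exI[of _ "d / 2"]) (auto simp: dist_commute dist_real_def less_imp_le)
    qed
    obtain d1 where d1: "d1 > 0" "\<And>z. z \<in> cball x d1 \<Longrightarrow> \<bar>F z - F x\<bar> \<le> e / 2" using loc by blast
    obtain d2 where d2: "d2 > 0" "\<And>z. z \<in> cball (x + v) d2 \<Longrightarrow> \<bar>F z - F (x + v)\<bar> \<le> e / 2" using loc by blast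
    define d where "d = min (min d1 d2) (min \<eta>1 \<eta>2)"
    have d: "d > 0" "d \<le> \<eta>1" "d \<le> \<eta>2" "d \<le> d1" "d \<le> d2" using d1 d2 \<eta>1 \<eta>2 by (auto simp: d_def)
    define J where "J = (LINT z|lebesgue. bump d x z)"
    have Jv: "(LINT z|lebesgue. bump d (x + v) z) = J"
      unfolding J_def using integral_translate[OF C1_continuous[OF C1_bump], of d x "- v"] bump_shift[of d x _ "- v"] by simp
    have "\<bar>(LINT z|lebesgue. F z * bump d (x + v) z) - F (x + v) * J\<bar> \<le> e / 2 * J"
      unfolding Jv[symmetric] by (rule bump_average[OF F]) (use d d2 in auto)
    moreover have "\<bar>(LINT z|lebesgue. F z * bump d x z) - F x * J\<bar> \<le> e / 2 * J"
      unfolding J_def by (rule bump_average[OF F]) (use d d1 in auto)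
    moreover note main[OF d(1-3), folded J_def]
    ultimately have "\<bar>F (x + v) * J - F x * J - c * J\<bar> \<le> K * J + e / 2 * J + e / 2 * J"
      by linarith
    also have "\<dots> = (K + e) * J" by (simp add: algebra_simps)
    finally have "\<bar>F (x + v) - F x - c\<bar> * J \<le> (K + e) * J"
      using bump_integral_pos[OF d(1), of x]
      by (simp add: J_def[symmetric] left_diff_distrib[symmetric] abs_mult)
    then have "\<bar>F (x + v) - F x - c\<bar> \<le> K + e"
      using bump_integral_pos[OF d(1), of x] by (simp add: J_def[symmetric])
    then show "\<bar>f (x + v) - f x - c\<bar> \<le> K + e" using Ff' x xv by simp
  qed
qed

lemma W_inf_0I:
  assumes "open \<Omega>" "continuous_on \<Omega> g" "\<And>x. x \<in> \<Omega> \<Longrightarrow> \<bar>g x\<bar> \<le> B"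
  shows "W_inf 0 \<Omega> g"
proof -
  have "g \<in> borel_measurable (lebesgue_on \<Omega>)"
    using assms by (intro continuous_imp_measurable_on_sets_lebesgue) auto
  moreover have "AE x in lebesgue_on \<Omega>. \<bar>g x\<bar> \<le> B" using assms(3) by (intro AE_I2) simp
  ultimately show ?thesis by auto
qed

lemma W_inf_imp_W_inf_0:
  assumes "open \<Omega>" "W_inf k \<Omega> g"
  shows "W_inf 0 \<Omega> g"
proof (cases k)
  case (Suc j)
  then have "continuous_on (closure \<Omega>) g" "bounded (g ` \<Omega>)" using assms(2) by auto
  moreover from this(1) have "continuous_on \<Omega> g" by (rule continuous_on_subset[OF _ closure_subset])
  ultimately show ?thesis
    using W_inf_0I[OF \<open>open \<Omega>\<close>, of g] by (auto simp: bounded_iff)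
qed (use assms in simp)

lemma W_inf_Suc_bounded:
  assumes "W_inf (Suc k) \<Omega> f"
  shows "\<exists>B\<ge>0. \<forall>p\<in>closure \<Omega>. \<bar>f p\<bar> \<le> B"
proof -
  obtain B where B: "\<And>p. p \<in> \<Omega> \<Longrightarrow> \<bar>f p\<bar> \<le> B" using assms by (auto simp: bounded_iff)
  have c: "continuous_on (closure \<Omega>) (\<lambda>p. \<bar>f p\<bar>)" using assms by (auto intro!: continuous_intros)
  have "\<bar>f p\<bar> \<le> max 0 B" if "p \<in> closure \<Omega>" for p
    by (rule continuous_le_on_closure[OF c that]) (use B in force)
  then show ?thesis
    by (intro exI[of _ "max 0 B"]) simp
qed

text \<open>Carries estimates between pairs of interior points over to the boundary, in particular to
  the end times of a time slab.\<close>
lemma le_on_closure_pairs: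
  fixes H :: "'a::topological_space \<Rightarrow> 'b::topological_space \<Rightarrow> real"
  assumes "continuous_on (closure S \<times> closure S') (\<lambda>(p, q). H p q)"
    and "\<And>p q. p \<in> S \<Longrightarrow> q \<in> S' \<Longrightarrow> H p q \<le> 0"
    and "p \<in> closure S" "q \<in> closure S'"
  shows "H p q \<le> 0"
  using continuous_le_on_closure[of "S \<times> S'" "\<lambda>(p, q). H p q" "(p, q)" 0] assms
  by (auto simp: closure_Times)

lemma W_inf_1_lipschitz:
  fixes f :: "'a::euclidean_space \<Rightarrow> real"
  assumes \<Omega>: "open \<Omega>" "convex \<Omega>" and f: "W_inf (Suc k) \<Omega> f"
  shows "\<exists>L\<ge>0. \<forall>p\<in>closure \<Omega>. \<forall>q\<in>closure \<Omega>. \<bar>f q - f p\<bar> \<le> L * norm (q - p)"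
proof -
  have cf: "continuous_on (closure \<Omega>) f" using f by simp
  obtain g where g: "\<And>i. i \<in> Basis \<Longrightarrow> weak_partial \<Omega> i f (g i)" "\<And>i. i \<in> Basis \<Longrightarrow> W_inf k \<Omega> (g i)"
    using f by simp metis
  have g0: "W_inf 0 \<Omega> (g i)" if "i \<in> Basis" for i using W_inf_imp_W_inf_0[OF \<Omega>(1) g(2)] that by blast
  then obtain C where C: "\<And>i. i \<in> Basis \<Longrightarrow> AE z in lebesgue_on \<Omega>. \<bar>g i z\<bar> \<le> C i"
    by simp metis
  define L where "L = (\<Sum>i\<in>(Basis::'a set). max 0 (C i))"
  have L0: "L \<ge> 0" by (simp add: L_def sum_nonneg)
  have AE_all: "AE z in lebesgue_on \<Omega>. \<forall>i\<in>Basis. \<bar>g i z\<bar> \<le> C i"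
    using C by (intro eventually_ball_finite) auto
  have inner: "\<bar>f q - f p\<bar> \<le> L * norm (q - p)" if "p \<in> \<Omega>" "q \<in> \<Omega>" for p q
  proof -
    define v where "v = q - p"
    have "\<bar>f (p + v) - f p - 0\<bar> \<le> L * norm v"
    proof (rule weak_partial_increment[OF \<Omega> cf g(1) g0])
      show "AE z in lebesgue_on \<Omega>. \<bar>(\<Sum>i\<in>Basis. v \<bullet> i * g i z) - 0\<bar> \<le> L * norm v"
        using AE_all
      proof eventually_elim
        case (elim z)
        have "\<bar>\<Sum>i\<in>Basis. v \<bullet> i * g i z\<bar> \<le> (\<Sum>i\<in>Basis. \<bar>v \<bullet> i * g i z\<bar>)" by (rule sum_abs)
        also have "\<dots> \<le> (\<Sum>i\<in>Basis. norm v * max 0 (C i))"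
          using elim by (intro sum_mono) (force simp: abs_mult intro!: mult_mono Basis_le_norm)
        finally show ?case by (simp add: L_def sum_distrib_left mult.commute)
      qed
    qed (use that in \<open>auto simp: v_def\<close>)
    then show ?thesis by (simp add: v_def)
  qed
  have "\<bar>f q - f p\<bar> - L * norm (q - p) \<le> 0" if "p \<in> closure \<Omega>" "q \<in> closure \<Omega>" for p q
  proof (rule le_on_closure_pairs[where S=\<Omega> and S'=\<Omega> and H="\<lambda>p q. \<bar>f q - f p\<bar> - L * norm (q - p)"])
    show "continuous_on (closure \<Omega> \<times> closure \<Omega>) (\<lambda>(p, q). \<bar>f q - f p\<bar> - L * norm (q - p))"
      unfolding case_prod_beta by (intro continuous_intros continuous_on_compose2[OF cf]) auto
  qed (use inner that in auto)
  then show ?thesis using L0 by force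
qed

lemma weak_partial_subset:
  assumes "weak_partial \<Omega> i f g" "\<Omega>' \<subseteq> \<Omega>"
  shows "weak_partial \<Omega>' i f g"
  unfolding weak_partial_def
proof (intro allI impI)
  fix \<psi> :: "'a \<Rightarrow> real" assume "C1_compact_support \<Omega>' \<psi>"
  then obtain K where K: "compact K" "K \<subseteq> \<Omega>'" "\<And>x. x \<notin> K \<Longrightarrow> \<psi> x = 0"
    and \<psi>: "C1_compact_support \<Omega> \<psi>"
    using assms(2) unfolding C1_compact_support_def by (elim conjE exE) blast
  have d: "dpartial i \<psi> x = 0" if "x \<notin> K" for x
    by (rule dpartial_0_outside[OF compact_imp_closed[OF K(1)] K(3) that])
  have "(LINT x:\<Omega>'|lebesgue. f x * dpartial i \<psi> x) = (LINT x:\<Omega>|lebesgue. f x * dpartial i \<psi> x)"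
    unfolding set_lebesgue_integral_def
    by (rule Bochner_Integration.integral_cong) (use K d assms(2) in \<open>auto simp: indicator_def\<close>)
  moreover have "(LINT x:\<Omega>'|lebesgue. g x * \<psi> x) = (LINT x:\<Omega>|lebesgue. g x * \<psi> x)"
    unfolding set_lebesgue_integral_def
    by (rule Bochner_Integration.integral_cong) (use K assms(2) in \<open>auto simp: indicator_def\<close>)
  ultimately show "(LINT x:\<Omega>'|lebesgue. f x * dpartial i \<psi> x) = - (LINT x:\<Omega>'|lebesgue. g x * \<psi> x)"
    using assms(1) \<psi> by (simp add: weak_partial_def)
qed

text \<open>The weak derivatives are Lipschitz. On the part of \<open>\<Omega>\<close> within distance \<open>2 * norm (q - p)\<close> of \<open>p\<close>
  they thus differ from their values at \<open>p\<close> by \<open>O(norm (q - p))\<close>, and the mean value theorem on this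
  smaller convex set gives a quadratic remainder.\<close>
lemma W_inf_2_taylor:
  fixes f :: "'a::euclidean_space \<Rightarrow> real"
  assumes \<Omega>: "open \<Omega>" "convex \<Omega>" and f: "W_inf (Suc (Suc k)) \<Omega> f"
  shows "\<exists>g K. (\<forall>i\<in>Basis. W_inf (Suc k) \<Omega> (g i)) \<and> K \<ge> 0 \<and>
     (\<forall>p\<in>closure \<Omega>. \<forall>q\<in>closure \<Omega>. \<bar>f q - f p - (\<Sum>i\<in>Basis. ((q - p) \<bullet> i) * g i p)\<bar> \<le> K * (norm (q - p))\<^sup>2)"
proof -
  have cf: "continuous_on (closure \<Omega>) f" using f by simp
  obtain g where g: "\<And>i. i \<in> Basis \<Longrightarrow> weak_partial \<Omega> i f (g i)" "\<And>i. i \<in> Basis \<Longrightarrow> W_inf (Suc k) \<Omega> (g i)"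
    using f unfolding W_inf.simps(2)[of "Suc k"] by metis
  have cg: "continuous_on (closure \<Omega>) (g i)" if "i \<in> Basis" for i using g(2)[OF that] by simp
  obtain L where L: "\<And>i. i \<in> Basis \<Longrightarrow> L i \<ge> 0"
    "\<And>i p q. i \<in> Basis \<Longrightarrow> p \<in> closure \<Omega> \<Longrightarrow> q \<in> closure \<Omega> \<Longrightarrow> \<bar>g i q - g i p\<bar> \<le> L i * norm (q - p)"
    using W_inf_1_lipschitz[OF \<Omega> g(2)] by metis
  define K where "K = (\<Sum>i\<in>(Basis::'a set). 2 * L i)"
  have K0: "K \<ge> 0" using L(1) by (simp add: K_def sum_nonneg)
  have inner: "\<bar>f q - f p - (\<Sum>i\<in>Basis. ((q - p) \<bullet> i) * g i p)\<bar> \<le> K * (norm (q - p))\<^sup>2"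
    if pq: "p \<in> \<Omega>" "q \<in> \<Omega>" for p q
  proof (cases "p = q")
    case False
    define v where "v = q - p"
    \<comment> \<open>The factor 2 puts \<open>q\<close> into the interior of the ball.\<close>
    define \<Omega>' where "\<Omega>' = \<Omega> \<inter> ball p (2 * norm v)"
    have v: "norm v > 0" using False by (simp add: v_def)
    have \<Omega>': "open \<Omega>'" "convex \<Omega>'" "\<Omega>' \<subseteq> \<Omega>" "closure \<Omega>' \<subseteq> closure \<Omega>"
      using \<Omega> by (auto simp: \<Omega>'_def convex_Int intro!: closure_mono)
    have "\<bar>f (p + v) - f p - (\<Sum>i\<in>Basis. (v \<bullet> i) * g i p)\<bar> \<le> K * (norm v)\<^sup>2"
    proof (rule weak_partial_increment[OF \<Omega>'(1,2)])
      show "continuous_on (closure \<Omega>') f" by (rule continuous_on_subset[OF cf \<Omega>'(4)])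
      show "weak_partial \<Omega>' i f (g i)" if "i \<in> Basis" for i
        by (rule weak_partial_subset[OF g(1)[OF that] \<Omega>'(3)])
      show "W_inf 0 \<Omega>' (g i)" if "i \<in> Basis" for i
      proof -
        have "continuous_on \<Omega>' (g i)"
          using cg[OF that] \<Omega>'(3) closure_subset by (meson continuous_on_subset order_trans)
        moreover obtain B where "\<And>z. z \<in> \<Omega> \<Longrightarrow> \<bar>g i z\<bar> \<le> B"
          using g(2)[OF \<open>i \<in> Basis\<close>] by (auto simp: bounded_iff)
        ultimately show ?thesis using \<Omega>'(3) W_inf_0I[OF \<Omega>'(1), of "g i" B] by blast
      qed
      show "AE z in lebesgue_on \<Omega>'. \<bar>(\<Sum>i\<in>Basis. v \<bullet> i * g i z) - (\<Sum>i\<in>Basis. v \<bullet> i * g i p)\<bar> \<le> K * (norm v)\<^sup>2"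
      proof (rule AE_I2)
        fix z assume "z \<in> space (lebesgue_on \<Omega>')"
        then have z: "z \<in> \<Omega>" "norm (z - p) \<le> 2 * norm v"
          by (auto simp: \<Omega>'_def dist_norm norm_minus_commute)
        have "\<bar>(\<Sum>i\<in>Basis. v \<bullet> i * g i z) - (\<Sum>i\<in>Basis. v \<bullet> i * g i p)\<bar> = \<bar>\<Sum>i\<in>Basis. v \<bullet> i * (g i z - g i p)\<bar>"
          by (simp add: sum_subtractf right_diff_distrib)
        also have "\<dots> \<le> (\<Sum>i\<in>Basis. \<bar>v \<bullet> i * (g i z - g i p)\<bar>)" by (rule sum_abs)
        also have "\<dots> \<le> (\<Sum>i\<in>Basis. norm v * (L i * (2 * norm v)))"
        proof (rule sum_mono)
          fix i :: 'a assume i: "i \<in> Basis"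
          have "\<bar>g i z - g i p\<bar> \<le> L i * norm (z - p)"
            using L(2)[OF i] z(1) pq(1) closure_subset by blast
          also have "\<dots> \<le> L i * (2 * norm v)" using L(1)[OF i] z(2) by (rule mult_left_mono[rotated])
          finally show "\<bar>v \<bullet> i * (g i z - g i p)\<bar> \<le> norm v * (L i * (2 * norm v))"
            using i L(1)[OF i] by (auto simp: abs_mult intro!: mult_mono Basis_le_norm)
        qed
        also have "\<dots> = K * (norm v)\<^sup>2"
          by (simp add: K_def sum_distrib_left sum_distrib_right power2_eq_square algebra_simps)
        finally show "\<bar>(\<Sum>i\<in>Basis. v \<bullet> i * g i z) - (\<Sum>i\<in>Basis. v \<bullet> i * g i p)\<bar> \<le> K * (norm v)\<^sup>2" .
      qed
      show "p \<in> \<Omega>'" "p + v \<in> \<Omega>'" using pq v by (auto simp: \<Omega>'_def v_def dist_norm norm_minus_commute)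
    qed
    then show ?thesis by (simp add: v_def)
  qed simp
  have "\<bar>f q - f p - (\<Sum>i\<in>Basis. ((q - p) \<bullet> i) * g i p)\<bar> - K * (norm (q - p))\<^sup>2 \<le> 0"
    if "p \<in> closure \<Omega>" "q \<in> closure \<Omega>" for p q
  proof (rule le_on_closure_pairs[where S=\<Omega> and S'=\<Omega> and
        H="\<lambda>p q. \<bar>f q - f p - (\<Sum>i\<in>Basis. ((q - p) \<bullet> i) * g i p)\<bar> - K * (norm (q - p))\<^sup>2"])
    show "continuous_on (closure \<Omega> \<times> closure \<Omega>)
      (\<lambda>(p, q). \<bar>f q - f p - (\<Sum>i\<in>Basis. ((q - p) \<bullet> i) * g i p)\<bar> - K * (norm (q - p))\<^sup>2)"
      unfolding case_prod_beta
      by (intro continuous_intros continuous_on_compose2[OF cf] continuous_on_compose2[OF cg]) auto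
  qed (use inner that in auto)
  then have "\<bar>f q - f p - (\<Sum>i\<in>Basis. ((q - p) \<bullet> i) * g i p)\<bar> \<le> K * (norm (q - p))\<^sup>2"
    if "p \<in> closure \<Omega>" "q \<in> closure \<Omega>" for p q using that by force
  then show ?thesis using g(2) K0 by (intro exI[of _ g] exI[of _ K]) blast
qed

section \<open>The weak divergence of the drift\<close>

lemma DERIV_integral_transport_0:
  fixes p q :: "'a::euclidean_space \<Rightarrow> real"
  assumes p: "continuous_on UNIV p" and q: "C1 q" and K: "compact K"
    and supp: "(\<forall>z. z \<notin> K \<longrightarrow> p z = 0) \<or> (\<forall>z. z \<notin> K \<longrightarrow> q z = 0)"
  shows "((\<lambda>r. LINT z|lebesgue. p z * q (z + r *\<^sub>R w)) has_real_derivative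
           (LINT z|lebesgue. p z * (\<Sum>i\<in>Basis. (w \<bullet> i) * dpartial i q z))) (at 0)"
proof -
  obtain R where R: "\<And>z. z \<in> K \<Longrightarrow> norm z \<le> R" using compact_imp_bounded[OF K] by (auto simp: bounded_iff)
  have "bounded (cball (0::'a) (R + norm w))" by simp
  then obtain a :: 'a where a: "cball 0 (R + norm w) \<subseteq> cbox (-a) a"
    using bounded_subset_cbox_symmetric by blast
  have out: "p z * q (z + r *\<^sub>R w) = 0" if "z \<notin> cbox (-a) a" "\<bar>r\<bar> \<le> 1" for z :: 'a and r
  proof -
    have "z \<notin> cball 0 (R + norm w)" using that(1) a by blast
    then have z: "norm z > R + norm w" by simp
    have rw: "norm (r *\<^sub>R w) \<le> norm w" using that(2) by (simp add: mult_left_le_one_le)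
    have "norm z \<le> norm (z + r *\<^sub>R w) + norm (r *\<^sub>R w)" using norm_triangle_sub[of z "- (r *\<^sub>R w)"] by simp
    then have "z + r *\<^sub>R w \<notin> K" "z \<notin> K" using R[of "z + r *\<^sub>R w"] R[of z] z rw norm_ge_zero[of w] by linarith+
    then show ?thesis using supp by auto
  qed
  have "\<bar>0::real\<bar> \<le> 1" by simp
  from DERIV_integral_transport[OF p q out this]
  show ?thesis by (simp add: at_within_Icc_at)
qed

text \<open>The function \<open>r \<mapsto> \<integral> u z * \<psi> (z + r *\<^sub>R i) \<partial>z\<close> equals \<open>r \<mapsto> \<integral> \<psi> z * u (z - r *\<^sub>R i) \<partial>z\<close>; the derivatives
  of these two expressions at 0 are, up to the sign, the two sides of the claim.\<close>
lemma integral_by_parts: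
  fixes u \<psi> :: "'a::euclidean_space \<Rightarrow> real"
  assumes u: "C1 u" and \<psi>: "C1 \<psi>" and K: "compact K" "\<And>z. z \<notin> K \<Longrightarrow> \<psi> z = 0" and i: "i \<in> Basis"
  shows "(LINT z|lebesgue. dpartial i u z * \<psi> z) = - (LINT z|lebesgue. u z * dpartial i \<psi> z)"
proof -
  have uc: "continuous_on UNIV u" and \<psi>c: "continuous_on UNIV \<psi>" using u \<psi> C1_continuous by auto
  have basis: "(\<Sum>j\<in>Basis. (i \<bullet> j) * F j) = F i" for F :: "'a \<Rightarrow> real"
    using i by (simp add: inner_Basis if_distrib if_distribR cong: if_cong)
  have 1: "((\<lambda>r. LINT z|lebesgue. u z * \<psi> (z + r *\<^sub>R i)) has_real_derivative
           (LINT z|lebesgue. u z * dpartial i \<psi> z)) (at 0)"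
    using DERIV_integral_transport_0[OF uc \<psi> K(1), of i] K(2) basis by auto
  have 2: "((\<lambda>r. LINT z|lebesgue. \<psi> z * u (z + r *\<^sub>R (- i))) has_real_derivative
           (LINT z|lebesgue. \<psi> z * - dpartial i u z)) (at 0)"
    using DERIV_integral_transport_0[OF \<psi>c u K(1), of "- i"] K(2) basis by (auto simp: sum_negf)
  have "(LINT z|lebesgue. u z * \<psi> (z + r *\<^sub>R i)) = (LINT z|lebesgue. \<psi> z * u (z + r *\<^sub>R (- i)))" for r
    using integral_translate[of "\<lambda>z. u z * \<psi> (z + r *\<^sub>R i)" "r *\<^sub>R (- i)"] uc
    by (simp add: mult.commute continuous_intros continuous_on_compose2[OF \<psi>c])
  then have "(LINT z|lebesgue. u z * dpartial i \<psi> z) = (LINT z|lebesgue. \<psi> z * - dpartial i u z)"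
    using DERIV_unique[OF 1] 2 by simp
  then show ?thesis by (simp add: mult.commute)
qed

text \<open>Since \<open>u\<close> has no second derivatives, they must not appear even intermediately. The function
  \<open>r \<mapsto> \<integral> dpartial i u z * \<psi> (z + r *\<^sub>R j) \<partial>z\<close> has the left hand side as derivative at 0. Integrating it
  by parts first and translating the shift from \<open>\<psi>\<close> to \<open>u\<close>, its derivative is the right hand side.\<close>
lemma gradient_weak_curl_free:
  fixes u \<psi> :: "'a::euclidean_space \<Rightarrow> real"
  assumes u: "C1 u" and \<psi>: "C1 \<psi>" and K: "compact K" "\<And>z. z \<notin> K \<Longrightarrow> \<psi> z = 0" and ij: "i \<in> Basis" "j \<in> Basis"
  shows "(LINT z|lebesgue. dpartial i u z * dpartial j \<psi> z) = (LINT z|lebesgue. dpartial j u z * dpartial i \<psi> z)"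
proof -
  have uc: "continuous_on UNIV u" and \<psi>c: "continuous_on UNIV \<psi>" using u \<psi> C1_continuous by auto
  have du: "continuous_on UNIV (dpartial i u)" and d\<psi>: "continuous_on UNIV (dpartial i \<psi>)"
    using u \<psi> ij by (auto simp: C1_def)
  have d\<psi>0: "dpartial i \<psi> z = 0" if "z \<notin> K" for z
    by (rule dpartial_0_outside[OF compact_imp_closed[OF K(1)] K(2) that])
  have basis: "(\<Sum>k\<in>Basis. (j \<bullet> k) * F k) = F j" for F :: "'a \<Rightarrow> real"
    using ij by (simp add: inner_Basis if_distrib if_distribR cong: if_cong)
  have 1: "((\<lambda>r. LINT z|lebesgue. dpartial i u z * \<psi> (z + r *\<^sub>R j)) has_real_derivative
           (LINT z|lebesgue. dpartial i u z * dpartial j \<psi> z)) (at 0)"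
    using DERIV_integral_transport_0[OF du \<psi> K(1), of j] K(2) basis by auto
  have "((\<lambda>r. LINT z|lebesgue. dpartial i \<psi> z * u (z + r *\<^sub>R (- j))) has_real_derivative
           (LINT z|lebesgue. dpartial i \<psi> z * - dpartial j u z)) (at 0)"
    using DERIV_integral_transport_0[OF d\<psi> u K(1), of "- j"] d\<psi>0 basis by (auto simp: sum_negf)
  then have 2: "((\<lambda>r. - (LINT z|lebesgue. dpartial i \<psi> z * u (z + r *\<^sub>R (- j)))) has_real_derivative
           - (LINT z|lebesgue. dpartial i \<psi> z * - dpartial j u z)) (at 0)"
    by (rule DERIV_minus)
  have "(LINT z|lebesgue. dpartial i u z * \<psi> (z + r *\<^sub>R j)) = - (LINT z|lebesgue. dpartial i \<psi> z * u (z + r *\<^sub>R (- j)))" for r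
  proof -
    have K': "compact ((+) (- (r *\<^sub>R j)) ` K)" by (rule compact_translation[OF K(1)])
    have "\<psi> (z + r *\<^sub>R j) = 0" if "z \<notin> (+) (- (r *\<^sub>R j)) ` K" for z
    proof (rule K(2), rule notI)
      assume "z + r *\<^sub>R j \<in> K"
      then have "- (r *\<^sub>R j) + (z + r *\<^sub>R j) \<in> (+) (- (r *\<^sub>R j)) ` K" by (rule imageI)
      then show False using that by simp
    qed
    from integral_by_parts[OF u C1_shift(1)[OF \<psi>] K' this ij(1)]
    have "(LINT z|lebesgue. dpartial i u z * \<psi> (z + r *\<^sub>R j)) = - (LINT z|lebesgue. u z * dpartial i \<psi> (z + r *\<^sub>R j))"
      by (simp add: C1_shift(2)[OF \<psi> ij(1)])
    also have "(LINT z|lebesgue. u z * dpartial i \<psi> (z + r *\<^sub>R j)) = (LINT z|lebesgue. dpartial i \<psi> z * u (z + r *\<^sub>R (- j)))"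
      using integral_translate[of "\<lambda>z. u z * dpartial i \<psi> (z + r *\<^sub>R j)" "r *\<^sub>R (- j)"] uc
      by (simp add: mult.commute continuous_intros continuous_on_compose2[OF d\<psi>])
    finally show ?thesis .
  qed
  then have "(LINT z|lebesgue. dpartial i u z * dpartial j \<psi> z) = - (LINT z|lebesgue. dpartial i \<psi> z * - dpartial j u z)"
    using DERIV_unique[OF 1] 2 by simp
  then show ?thesis by (simp add: mult.commute)
qed

text \<open>Test with a bump on which the difference stays close to its central value. This is what makes the definite description in \<^const>\<open>div_perp\<close> meaningful.\<close>
lemma weakly_equal_imp_equal:
  fixes D D' :: "'a::euclidean_space \<Rightarrow> real"
  assumes "continuous_on UNIV D" "continuous_on UNIV D'"
    and eq: "\<And>\<psi>. C1_compact_support UNIV \<psi> \<Longrightarrow> (LINT x|lebesgue. D x * \<psi> x) = (LINT x|lebesgue. D' x * \<psi> x)"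
  shows "D = D'"
proof (rule ext, rule ccontr)
  fix x assume ne: "D x \<noteq> D' x"
  let ?F = "\<lambda>x. D x - D' x"
  have F: "continuous_on UNIV ?F" using assms by (intro continuous_intros)
  have e: "\<bar>?F x\<bar> / 2 > 0" using ne by simp
  then obtain d where d: "d > 0" "\<And>z. dist z x < d \<Longrightarrow> dist (?F z) (?F x) < \<bar>?F x\<bar> / 2"
    using F unfolding continuous_on_iff by (metis UNIV_I)
  have d2: "d / 2 > 0" using d by simp
  have "C1_compact_support UNIV (bump (d/2) x)"
    by (rule C1_compact_supportI[OF C1_bump compact_cball subset_UNIV bump_eq_0[OF d2]])
  then have "(LINT z|lebesgue. D z * bump (d/2) x z) = (LINT z|lebesgue. D' z * bump (d/2) x z)" by (rule eq)
  then have 0: "(LINT z|lebesgue. ?F z * bump (d/2) x z) = 0"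
    using bump_integrable[OF assms(1) d2, of x] bump_integrable[OF assms(2) d2, of x] by (simp add: left_diff_distrib)
  have "\<bar>(LINT z|lebesgue. ?F z * bump (d/2) x z) - ?F x * (LINT z|lebesgue. bump (d/2) x z)\<bar>
      \<le> (\<bar>?F x\<bar> / 2) * (LINT z|lebesgue. bump (d/2) x z)"
  proof (rule bump_average[OF F d2])
    fix z assume "z \<in> cball x (d/2)"
    then have "dist z x < d" using d(1) by (simp add: dist_commute)
    then show "\<bar>?F z - ?F x\<bar> \<le> \<bar>?F x\<bar> / 2" using d(2) by (simp add: dist_real_def less_imp_le)
  qed
  then show False using 0 bump_integral_pos[OF d2, of x] ne by (simp add: abs_mult)
qed

lemma C1_inverse:
  assumes f: "C1 f" and nz: "\<And>x. f x \<noteq> 0"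
  shows "C1 (\<lambda>x. inverse (f x))"
    and "i \<in> Basis \<Longrightarrow> dpartial i (\<lambda>x. inverse (f x)) x = - dpartial i f x / (f x)\<^sup>2"
proof -
  let ?D = "\<lambda>x h. - (inverse (f x) * (\<Sum>i\<in>Basis. (h \<bullet> i) * dpartial i f x) * inverse (f x))"
  have 1: "((\<lambda>x. inverse (f x)) has_derivative ?D x) (at x)" for x
    by (intro Deriv.has_derivative_inverse C1_has_derivative f nz)
  have 2: "continuous_on UNIV (\<lambda>x. ?D x i)" if "i \<in> Basis" for i
    using f C1_continuous[OF f] nz by (auto simp: C1_def intro!: continuous_intros)
  note * = C1I[OF 1 2]
  show "C1 (\<lambda>x. inverse (f x))" by (rule *(1))
  show "dpartial i (\<lambda>x. inverse (f x)) x = - dpartial i f x / (f x)\<^sup>2" if "i \<in> Basis"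
    using *(2)[of i x] that
    by (simp add: inner_Basis if_distrib if_distribR power2_eq_square field_simps cong: if_cong)
qed

text \<open>Testing the curl identity with \<open>\<psi> / \<beta>\<close> instead of \<open>\<psi>\<close> produces the divergence of \<open>A / \<beta>\<close> on one
  side, and on the other side only derivatives of \<open>\<beta>\<close>. Hence the divergence is continuous although
  \<open>A\<close> need not be differentiable.\<close>
lemma div_perp_rot_drift:
  fixes A :: "real^3 \<Rightarrow> real^3" and \<beta> :: "real^3 \<Rightarrow> real"
  assumes A: "continuous_on UNIV A" and \<beta>: "C1 \<beta>" and pos: "\<And>y. \<beta> y > 0"
    and curl: "\<And>\<psi>. C1_compact_support UNIV \<psi> \<Longrightarrow>
        (LINT z|lebesgue. A z $ 1 * dpartial (axis 2 1) \<psi> z) = (LINT z|lebesgue. A z $ 2 * dpartial (axis 1 1) \<psi> z)"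
  shows "div_perp (\<lambda>y. rot (perp (A y /\<^sub>R \<beta> y))) x =
     (A x $ 2 * dpartial (axis 1 1) \<beta> x - A x $ 1 * dpartial (axis 2 1) \<beta> x) / (\<beta> x)\<^sup>2"
proof -
  let ?G = "\<lambda>y. rot (perp (A y /\<^sub>R \<beta> y))"
  let ?D = "\<lambda>x. (A x $ 2 * dpartial (axis 1 1) \<beta> x - A x $ 1 * dpartial (axis 2 1) \<beta> x) / (\<beta> x)\<^sup>2"
  have ax: "axis k 1 \<in> (Basis :: (real^3) set)" for k by (simp add: axis_in_Basis_iff)
  have \<beta>c: "continuous_on UNIV \<beta>" by (rule C1_continuous[OF \<beta>])
  have d\<beta>: "continuous_on UNIV (dpartial (axis k 1) \<beta>)" for k using \<beta> ax by (simp add: C1_def)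
  have nz: "\<beta> y \<noteq> 0" for y using pos[of y] by simp
  have cD: "continuous_on UNIV ?D"
    using A \<beta>c d\<beta> nz by (auto intro!: continuous_intros)
  have weak: "weak_div_perp ?G ?D"
    unfolding weak_div_perp_def
  proof (intro allI impI)
    fix \<psi> :: "real^3 \<Rightarrow> real" assume "C1_compact_support UNIV \<psi>"
    then obtain K where \<psi>: "C1 \<psi>" and K: "compact K" "\<And>z. z \<notin> K \<Longrightarrow> \<psi> z = 0"
      by (auto simp: C1_compact_support_def C1_def)
    have "bounded K" using K(1) compact_imp_bounded by blast
    then obtain a where a: "K \<subseteq> cbox (-a) a" using bounded_subset_cbox_symmetric by blast
    have \<psi>c: "continuous_on UNIV \<psi>" by (rule C1_continuous[OF \<psi>])
    have d\<psi>: "continuous_on UNIV (dpartial (axis k 1) \<psi>)" for k using \<psi> ax by (simp add: C1_def)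
    have d\<psi>0: "dpartial i \<psi> z = 0" if "z \<notin> K" for i z
      by (rule dpartial_0_outside[OF compact_imp_closed[OF K(1)] K(2) that])
    define \<zeta> where "\<zeta> = (\<lambda>x. \<psi> x * inverse (\<beta> x))"
    have \<zeta>: "C1 \<zeta>" unfolding \<zeta>_def by (intro C1_times(1) \<psi> C1_inverse(1) \<beta> nz)
    have "C1_compact_support UNIV \<zeta>"
      by (rule C1_compact_supportI[OF \<zeta> K(1)]) (auto simp: \<zeta>_def K(2))
    then have c: "(LINT z|lebesgue. A z $ 1 * dpartial (axis 2 1) \<zeta> z) = (LINT z|lebesgue. A z $ 2 * dpartial (axis 1 1) \<zeta> z)"
      by (rule curl)
    have d\<zeta>: "dpartial (axis k 1) \<zeta> z = dpartial (axis k 1) \<psi> z / \<beta> z - \<psi> z * dpartial (axis k 1) \<beta> z / (\<beta> z)\<^sup>2" for k z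
      unfolding \<zeta>_def C1_times(2)[OF \<psi> C1_inverse(1)[OF \<beta> nz] ax] C1_inverse(2)[OF \<beta> nz ax]
      by (simp add: divide_inverse)
    have i0: "integrable lebesgue (\<lambda>z. h z * dpartial (axis k 1) \<psi> z)" "integrable lebesgue (\<lambda>z. h z * \<psi> z)"
      if "continuous_on UNIV h" for h k
    proof -
      have out: "\<psi> z = 0" "dpartial (axis k 1) \<psi> z = 0" if "z \<notin> cbox (-a) a" for z
        using K(2)[of z] d\<psi>0[of z] a that by auto
      show "integrable lebesgue (\<lambda>z. h z * dpartial (axis k 1) \<psi> z)"
        by (rule integral_compact_support(1)[of _ "-a" a]) (simp_all add: out continuous_on_mult that d\<psi>)
      show "integrable lebesgue (\<lambda>z. h z * \<psi> z)"
        by (rule integral_compact_support(1)[of _ "-a" a]) (simp_all add: out continuous_on_mult that \<psi>c)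
    qed
    have i1: "integrable lebesgue (\<lambda>z. A z $ l * dpartial (axis k 1) \<psi> z / \<beta> z)" for k l
      using i0(1)[of "\<lambda>z. A z $ l / \<beta> z" k] A \<beta>c nz by (simp add: continuous_intros)
    have i2: "integrable lebesgue (\<lambda>z. A z $ l * dpartial (axis k 1) \<beta> z / (\<beta> z)\<^sup>2 * \<psi> z)" for k l
      by (rule i0(2)) (use A \<beta>c d\<beta> nz in \<open>auto intro!: continuous_intros\<close>)
    have split: "(LINT z|lebesgue. A z $ l * dpartial (axis k 1) \<zeta> z)
       = (LINT z|lebesgue. A z $ l * dpartial (axis k 1) \<psi> z / \<beta> z) - (LINT z|lebesgue. A z $ l * dpartial (axis k 1) \<beta> z / (\<beta> z)\<^sup>2 * \<psi> z)" for k l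
      unfolding Bochner_Integration.integral_diff[OF i1 i2, symmetric]
      by (rule Bochner_Integration.integral_cong) (simp_all add: d\<zeta> algebra_simps)
    have "(LINT x|lebesgue. ?G x \<bullet> grad_perp \<psi> x) =
        (LINT z|lebesgue. A z $ 1 * dpartial (axis 2 1) \<psi> z / \<beta> z - A z $ 2 * dpartial (axis 1 1) \<psi> z / \<beta> z)"
      by (rule Bochner_Integration.integral_cong)
         (simp_all add: inner_vec_def sum_3 rot_def perp_def grad_perp_def divide_inverse algebra_simps)
    also have "\<dots> = (LINT z|lebesgue. A z $ 1 * dpartial (axis 2 1) \<psi> z / \<beta> z) - (LINT z|lebesgue. A z $ 2 * dpartial (axis 1 1) \<psi> z / \<beta> z)"
      by (rule Bochner_Integration.integral_diff[OF i1 i1])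
    also have "\<dots> = (LINT z|lebesgue. A z $ 1 * dpartial (axis 2 1) \<beta> z / (\<beta> z)\<^sup>2 * \<psi> z) - (LINT z|lebesgue. A z $ 2 * dpartial (axis 1 1) \<beta> z / (\<beta> z)\<^sup>2 * \<psi> z)"
      using c split[of 1 2] split[of 2 1] by simp
    also have "\<dots> = (LINT z|lebesgue. A z $ 1 * dpartial (axis 2 1) \<beta> z / (\<beta> z)\<^sup>2 * \<psi> z - A z $ 2 * dpartial (axis 1 1) \<beta> z / (\<beta> z)\<^sup>2 * \<psi> z)"
      by (rule Bochner_Integration.integral_diff[OF i2 i2, symmetric])
    also have "\<dots> = (LINT z|lebesgue. - (?D z * \<psi> z))"
      by (rule Bochner_Integration.integral_cong) (simp_all add: diff_divide_distrib algebra_simps)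
    finally show "(LINT x|lebesgue. ?G x \<bullet> grad_perp \<psi> x) = - (LINT x|lebesgue. ?D x * \<psi> x)" by simp
  qed
  have "div_perp ?G = ?D"
    unfolding div_perp_def
  proof (rule the_equality)
    show "continuous_on UNIV ?D \<and> weak_div_perp ?G ?D" using cD weak by simp
    fix D assume D: "continuous_on UNIV D \<and> weak_div_perp ?G D"
    show "D = ?D"
    proof (rule weakly_equal_imp_equal)
      show "(LINT x|lebesgue. D x * \<psi> x) = (LINT x|lebesgue. ?D x * \<psi> x)" if "C1_compact_support UNIV \<psi>" for \<psi>
        using D weak that unfolding weak_div_perp_def by (metis (no_types, lifting) neg_equal_iff_equal)
    qed (use D cD in auto)
  qed
  then show ?thesis by simp
qed

section \<open>The coefficient of the scheme and the time grid\<close>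

lemma \<gamma>_bounds: "0 < \<gamma>" "2 * \<gamma> < 1" and \<gamma>_root: "\<gamma>\<^sup>2 - 2 * \<gamma> + 1/2 = 0"
  and \<gamma>_ratio: "1 - \<gamma> = (1 + sqrt 2) * \<gamma>"
proof -
  have s: "sqrt 2 * sqrt 2 = 2" by simp
  have "1 < sqrt 2" "sqrt 2 < 2" by (simp_all add: real_less_lsqrt)
  have g: "\<gamma> = 1 - sqrt 2 / 2" unfolding \<gamma>_def using real_div_sqrt[of 2] by (simp add: field_simps)
  show "0 < \<gamma>" "2 * \<gamma> < 1" using \<open>1 < sqrt 2\<close> \<open>sqrt 2 < 2\<close> by (simp_all add: g)
  show "\<gamma>\<^sup>2 - 2 * \<gamma> + 1/2 = 0" using s by (simp add: g power2_eq_square field_simps)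
  show "1 - \<gamma> = (1 + sqrt 2) * \<gamma>" using s by (simp add: g algebra_simps add_divide_distrib)
qed

lemma \<gamma>_ge: "1/4 \<le> \<gamma>"
proof -
  have "sqrt 2 \<le> 3/2" by (rule real_le_lsqrt) (simp_all add: power2_eq_square)
  moreover have "\<gamma> = 1 - sqrt 2 / 2" unfolding \<gamma>_def using real_div_sqrt[of 2] by (simp add: field_simps)
  ultimately show ?thesis by simp
qed

lemma half_\<gamma>_le: "1 / (2 * \<gamma>) \<le> 2" "1 / (2 * \<gamma>) > 0"
  using \<gamma>_ge by (auto simp: field_simps)

definition horizon :: "real \<Rightarrow> real" where "horizon T = T / (2 * \<gamma>)"

lemma horizon_gt: "T > 0 \<Longrightarrow> T < horizon T"
  using \<gamma>_bounds by (simp add: horizon_def field_simps)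

lemma field_domain_props:
  assumes "T > 0"
  shows "open (field_domain T)" "convex (field_domain T)" "closure (field_domain T) = {0..horizon T} \<times> UNIV"
  using assms \<gamma>_bounds
  by (auto simp: field_domain_def horizon_def closure_Times open_Times convex_Times)

text \<open>In the last part, \<open>n * \<Delta>t + \<Delta>t / (2 * \<gamma>)\<close> is at most \<open>T + \<Delta>t * (1 / (2 * \<gamma>) - 1)\<close>. The bracket is
  positive, so that \<open>\<Delta>t \<le> T\<close> gives the bound \<open>T / (2 * \<gamma>)\<close>.\<close>
lemma num_steps_times:
  assumes "T > 0" "\<Delta>t > 0"
  shows "n \<le> num_steps T \<Delta>t \<Longrightarrow> real n * \<Delta>t \<le> T"
    and "n < num_steps T \<Delta>t \<Longrightarrow> real n * \<Delta>t + \<Delta>t \<le> T"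
    and "n < num_steps T \<Delta>t \<Longrightarrow> \<Delta>t \<le> T"
    and "n < num_steps T \<Delta>t \<Longrightarrow> real n * \<Delta>t \<in> {0..horizon T}"
    and "n < num_steps T \<Delta>t \<Longrightarrow> real n * \<Delta>t + \<Delta>t / (2 * \<gamma>) \<in> {0..horizon T}"
proof -
  have fl: "real (num_steps T \<Delta>t) \<le> T / \<Delta>t"
    using assms by (simp add: num_steps_def)
  show 1: "real n * \<Delta>t \<le> T" if "n \<le> num_steps T \<Delta>t" for n
  proof -
    have "real n \<le> T / \<Delta>t" using that fl by linarith
    then show ?thesis using assms by (simp add: field_simps)
  qed
  show 2: "real n * \<Delta>t + \<Delta>t \<le> T" if "n < num_steps T \<Delta>t" for n
    using 1[of "Suc n"] that by (simp add: algebra_simps)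
  show 3: "\<Delta>t \<le> T" if "n < num_steps T \<Delta>t"
    using 2[OF that] assms by (smt (verit) mult_nonneg_nonneg of_nat_0_le_iff)
  show "real n * \<Delta>t \<in> {0..horizon T}" if "n < num_steps T \<Delta>t"
    using 1[of n] that horizon_gt[OF assms(1)] assms by auto
  show "real n * \<Delta>t + \<Delta>t / (2 * \<gamma>) \<in> {0..horizon T}" if n: "n < num_steps T \<Delta>t"
  proof -
    have g: "0 < 2 * \<gamma>" "2 * \<gamma> < 1" using \<gamma>_bounds by auto
    have "\<Delta>t * (1 - 2 * \<gamma>) \<le> T * (1 - 2 * \<gamma>)" using 3[OF n] g by (intro mult_right_mono) auto
    moreover have "(real n * \<Delta>t) * (2 * \<gamma>) \<le> (T - \<Delta>t) * (2 * \<gamma>)"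
      using 2[OF n] g by (intro mult_right_mono) auto
    ultimately have "(real n * \<Delta>t) * (2 * \<gamma>) + \<Delta>t \<le> T" by (simp add: algebra_simps)
    moreover have "0 \<le> real n * \<Delta>t" "0 \<le> \<Delta>t / (2 * \<gamma>)" using assms g by simp_all
    moreover have "real n * \<Delta>t + \<Delta>t / (2 * \<gamma>) = ((real n * \<Delta>t) * (2 * \<gamma>) + \<Delta>t) / (2 * \<gamma>)"
      using g by (simp add: field_simps)
    ultimately show ?thesis using g by (simp add: horizon_def divide_right_mono)
  qed
qed

section \<open>Functions with a uniform first order Taylor expansion\<close>

text \<open>Boundedness together with a uniform quadratic Taylor remainder. The definition refers only to pairs
  of points of \<open>S\<close>, so it applies to time slabs including their end times. On the closure
  of a convex open set it follows from bounded weak derivatives of first and second order, it is stable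
  under the algebra that builds the drift velocity from the fields, and it suffices for second order convergence in time.\<close>

definition C11 :: "'a::real_normed_vector set \<Rightarrow> ('a \<Rightarrow> 'b::real_normed_vector) \<Rightarrow> bool" where
  "C11 S f \<longleftrightarrow> (\<exists>A K. \<forall>p\<in>S. linear (A p) \<and> norm (f p) \<le> K \<and> (\<forall>h. norm (A p h) \<le> K * norm h) \<and>
      (\<forall>q\<in>S. norm (f q - f p - A p (q - p)) \<le> K * (norm (q - p))\<^sup>2))"

lemma C11_I:
  assumes "\<And>p. p \<in> S \<Longrightarrow> linear (A p)"
    and "\<And>p. p \<in> S \<Longrightarrow> norm (f p) \<le> K1"
    and "\<And>p h. p \<in> S \<Longrightarrow> norm (A p h) \<le> K2 * norm h"
    and "\<And>p q. p \<in> S \<Longrightarrow> q \<in> S \<Longrightarrow> norm (f q - f p - A p (q - p)) \<le> K3 * (norm (q - p))\<^sup>2"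
  shows "C11 S f"
proof -
  define K where "K = max K1 (max K2 K3)"
  have le: "K1 \<le> K" "K2 \<le> K" "K3 \<le> K" by (auto simp: K_def)
  have "norm (A p h) \<le> K * norm h" if "p \<in> S" for p h
    using assms(3)[OF that, of h] mult_right_mono[OF le(2), of "norm h"] by simp
  moreover have "norm (f q - f p - A p (q - p)) \<le> K * (norm (q - p))\<^sup>2" if "p \<in> S" "q \<in> S" for p q
    using assms(4)[OF that] mult_right_mono[OF le(3), of "(norm (q - p))\<^sup>2"] by simp
  moreover have "norm (f p) \<le> K" if "p \<in> S" for p using assms(2)[OF that] le(1) by simp
  ultimately show ?thesis
    unfolding C11_def using assms(1) by blast
qed

text \<open>The Lipschitz bound comes from the Taylor expansion for points at distance at most 1, and from
  boundedness for points farther apart.\<close>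
lemma C11_E:
  assumes "C11 S f"
  obtains A K L where "K \<ge> 0" "\<And>p. p \<in> S \<Longrightarrow> linear (A p)" "\<And>p. p \<in> S \<Longrightarrow> norm (f p) \<le> K"
    "\<And>p h. p \<in> S \<Longrightarrow> norm (A p h) \<le> K * norm h"
    "\<And>p q. p \<in> S \<Longrightarrow> q \<in> S \<Longrightarrow> norm (f q - f p - A p (q - p)) \<le> K * (norm (q - p))\<^sup>2"
    "L \<ge> 0" "\<And>p q. p \<in> S \<Longrightarrow> q \<in> S \<Longrightarrow> norm (f q - f p) \<le> L * norm (q - p)"
proof (cases "S = {}")
  case True
  then show ?thesis using that[of 0 "\<lambda>_ _. 0" 0] by simp
next
  case False
  obtain A K where lin: "\<And>p. p \<in> S \<Longrightarrow> linear (A p)" and K: "\<And>p. p \<in> S \<Longrightarrow> norm (f p) \<le> K"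
    "\<And>p h. p \<in> S \<Longrightarrow> norm (A p h) \<le> K * norm h"
    "\<And>p q. p \<in> S \<Longrightarrow> q \<in> S \<Longrightarrow> norm (f q - f p - A p (q - p)) \<le> K * (norm (q - p))\<^sup>2"
    using assms unfolding C11_def by blast
  have K0: "K \<ge> 0" using False K(1) norm_ge_zero order_trans by blast
  have lip: "norm (f q - f p) \<le> (2 * K) * norm (q - p)" if "p \<in> S" "q \<in> S" for p q
  proof (cases "norm (q - p) \<le> 1")
    case True
    have "norm (f q - f p) \<le> norm (f q - f p - A p (q - p)) + norm (A p (q - p))"
      using norm_triangle_sub[of "f q - f p" "A p (q - p)"] by simp
    also have "\<dots> \<le> K * (norm (q - p))\<^sup>2 + K * norm (q - p)"
      using K that by (intro add_mono) auto
    also have "\<dots> \<le> K * norm (q - p) + K * norm (q - p)"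
      using True K0 by (intro add_mono mult_left_mono) (auto simp: power2_eq_square mult_left_le)
    finally show ?thesis by simp
  next
    case far: False
    have "norm (f q - f p) \<le> K + K" using norm_triangle_ineq4[of "f q" "f p"] K(1)[OF that(1)] K(1)[OF that(2)] by linarith
    also have "\<dots> \<le> (2 * K) * norm (q - p)" using far K0 by (simp add: mult_le_cancel_left1)
    finally show ?thesis .
  qed
  show ?thesis by (rule that[OF K0 lin K, of "2 * K"]) (use K0 lip in auto)
qed

lemma C11_cong: "C11 S f \<Longrightarrow> (\<And>p. p \<in> S \<Longrightarrow> f p = g p) \<Longrightarrow> C11 S g"
  unfolding C11_def by (elim exE, rename_tac A K, rule_tac x=A in exI, rule_tac x=K in exI) simp

lemma C11_bounded_lipschitz:
  assumes "C11 S f"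
  shows "\<exists>K\<ge>0. \<forall>p\<in>S. norm (f p) \<le> K" "\<exists>L\<ge>0. \<forall>p\<in>S. \<forall>q\<in>S. norm (f q - f p) \<le> L * norm (q - p)"
proof -
  obtain A K L where K: "K \<ge> 0" and "\<And>p. p \<in> S \<Longrightarrow> linear (A p)" and fK: "\<And>p. p \<in> S \<Longrightarrow> norm (f p) \<le> K"
    and "\<And>p h. p \<in> S \<Longrightarrow> norm (A p h) \<le> K * norm h"
    and "\<And>p q. p \<in> S \<Longrightarrow> q \<in> S \<Longrightarrow> norm (f q - f p - A p (q - p)) \<le> K * (norm (q - p))\<^sup>2"
    and L: "L \<ge> 0" "\<And>p q. p \<in> S \<Longrightarrow> q \<in> S \<Longrightarrow> norm (f q - f p) \<le> L * norm (q - p)"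
    by (rule C11_E[OF assms]) (rule that)
  show "\<exists>K\<ge>0. \<forall>p\<in>S. norm (f p) \<le> K" using K fK by (intro exI[of _ K]) simp
  show "\<exists>L\<ge>0. \<forall>p\<in>S. \<forall>q\<in>S. norm (f q - f p) \<le> L * norm (q - p)" using L by (intro exI[of _ L]) simp
qed

lemma C11_const: "C11 S (\<lambda>p. c)"
  by (rule C11_I[where A="\<lambda>_ _. 0" and ?K1.0="norm c" and ?K2.0=0 and ?K3.0=0]) (auto simp: linear_iff)

lemma C11_bounded_linear:
  assumes "bounded_linear l" "\<And>p. p \<in> S \<Longrightarrow> norm (l p) \<le> R"
  shows "C11 S l"
proof -
  interpret bounded_linear l by fact
  obtain K where K: "\<And>x. norm (l x) \<le> norm x * K" using bounded by blast
  show ?thesis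
    by (rule C11_I[where A="\<lambda>_. l" and ?K1.0=R and ?K2.0=K and ?K3.0=0])
      (use assms K in \<open>auto simp: linear_axioms diff mult.commute\<close>)
qed

lemma C11_compose_linear:
  assumes f: "C11 S f" and l: "bounded_linear l" and sub: "\<And>p. p \<in> S' \<Longrightarrow> l p \<in> S"
  shows "C11 S' (\<lambda>p. f (l p))"
proof -
  interpret bounded_linear l by fact
  obtain C where C: "C \<ge> 0" "\<And>x. norm (l x) \<le> norm x * C" using nonneg_bounded by blast
  from f obtain A K L where f: "K \<ge> 0" "\<And>p. p \<in> S \<Longrightarrow> linear (A p)" "\<And>p. p \<in> S \<Longrightarrow> norm (f p) \<le> K"
    "\<And>p h. p \<in> S \<Longrightarrow> norm (A p h) \<le> K * norm h"
    "\<And>p q. p \<in> S \<Longrightarrow> q \<in> S \<Longrightarrow> norm (f q - f p - A p (q - p)) \<le> K * (norm (q - p))\<^sup>2"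
    by (rule C11_E) (rule that)
  show ?thesis
  proof (rule C11_I[where A="\<lambda>p h. A (l p) (l h)" and ?K1.0=K and ?K2.0="K * C" and ?K3.0="K * C\<^sup>2"])
    show "linear (\<lambda>h. A (l p) (l h))" if "p \<in> S'" for p
      using linear_compose[OF linear_axioms f(2)[OF sub[OF that]]] by (simp add: o_def)
    show "norm (f (l p)) \<le> K" if "p \<in> S'" for p using f(3) sub that by blast
    show "norm (A (l p) (l h)) \<le> K * C * norm h" if "p \<in> S'" for p h
      using f(4)[OF sub[OF that], of "l h"] mult_left_mono[OF C(2) f(1), of h] by (simp add: mult_ac)
    show "norm (f (l q) - f (l p) - A (l p) (l (q - p))) \<le> K * C\<^sup>2 * (norm (q - p))\<^sup>2"
      if "p \<in> S'" "q \<in> S'" for p q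
    proof -
      have "norm (f (l q) - f (l p) - A (l p) (l q - l p)) \<le> K * (norm (l q - l p))\<^sup>2"
        using f(5) sub that by blast
      also have "\<dots> \<le> K * (norm (q - p) * C)\<^sup>2"
        using C(2)[of "q - p"] f(1) by (intro mult_left_mono power_mono) (auto simp: diff)
      finally show ?thesis by (simp add: diff power_mult_distrib mult_ac)
    qed
  qed
qed

lemma C11_add:
  assumes "C11 S f" "C11 S g" shows "C11 S (\<lambda>p. f p + g p)"
proof -
  from assms(1) obtain A K where f: "\<And>p. p \<in> S \<Longrightarrow> linear (A p)" "\<And>p. p \<in> S \<Longrightarrow> norm (f p) \<le> K"
    "\<And>p h. p \<in> S \<Longrightarrow> norm (A p h) \<le> K * norm h"
    "\<And>p q. p \<in> S \<Longrightarrow> q \<in> S \<Longrightarrow> norm (f q - f p - A p (q - p)) \<le> K * (norm (q - p))\<^sup>2"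
    unfolding C11_def by blast
  from assms(2) obtain A' K' where g: "\<And>p. p \<in> S \<Longrightarrow> linear (A' p)" "\<And>p. p \<in> S \<Longrightarrow> norm (g p) \<le> K'"
    "\<And>p h. p \<in> S \<Longrightarrow> norm (A' p h) \<le> K' * norm h"
    "\<And>p q. p \<in> S \<Longrightarrow> q \<in> S \<Longrightarrow> norm (g q - g p - A' p (q - p)) \<le> K' * (norm (q - p))\<^sup>2"
    unfolding C11_def by blast
  show ?thesis
  proof (rule C11_I[where A="\<lambda>p h. A p h + A' p h" and ?K1.0="K + K'" and ?K2.0="K + K'" and ?K3.0="K + K'"])
    show "linear (\<lambda>h. A p h + A' p h)" if "p \<in> S" for p
      using f(1)[OF that] g(1)[OF that] by (rule linear_compose_add)
    show "norm (f p + g p) \<le> K + K'" if "p \<in> S" for p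
      using norm_triangle_mono[OF f(2)[OF that] g(2)[OF that]] .
    show "norm (A p h + A' p h) \<le> (K + K') * norm h" if "p \<in> S" for p h
      using norm_triangle_mono[OF f(3)[OF that] g(3)[OF that]] by (simp add: algebra_simps)
    show "norm (f q + g q - (f p + g p) - (A p (q - p) + A' p (q - p))) \<le> (K + K') * (norm (q - p))\<^sup>2"
      if "p \<in> S" "q \<in> S" for p q
      using norm_triangle_mono[OF f(4)[OF that] g(4)[OF that]] by (simp add: algebra_simps)
  qed
qed

lemma C11_scaleR:
  fixes f :: "'a::real_normed_vector \<Rightarrow> real" and g :: "'a \<Rightarrow> 'b::real_normed_vector"
  assumes "C11 S f" "C11 S g" shows "C11 S (\<lambda>p. f p *\<^sub>R g p)"
proof -
  from assms(1) obtain A K L where f: "K \<ge> 0" "\<And>p. p \<in> S \<Longrightarrow> linear (A p)" "\<And>p. p \<in> S \<Longrightarrow> norm (f p) \<le> K"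
    "\<And>p h. p \<in> S \<Longrightarrow> norm (A p h) \<le> K * norm h"
    "\<And>p q. p \<in> S \<Longrightarrow> q \<in> S \<Longrightarrow> norm (f q - f p - A p (q - p)) \<le> K * (norm (q - p))\<^sup>2"
    "L \<ge> 0" "\<And>p q. p \<in> S \<Longrightarrow> q \<in> S \<Longrightarrow> norm (f q - f p) \<le> L * norm (q - p)"
    by (rule C11_E) (rule that)
  from assms(2) obtain A' K' L' where g: "K' \<ge> 0" "\<And>p. p \<in> S \<Longrightarrow> linear (A' p)" "\<And>p. p \<in> S \<Longrightarrow> norm (g p) \<le> K'"
    "\<And>p h. p \<in> S \<Longrightarrow> norm (A' p h) \<le> K' * norm h"
    "\<And>p q. p \<in> S \<Longrightarrow> q \<in> S \<Longrightarrow> norm (g q - g p - A' p (q - p)) \<le> K' * (norm (q - p))\<^sup>2"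
    "L' \<ge> 0" "\<And>p q. p \<in> S \<Longrightarrow> q \<in> S \<Longrightarrow> norm (g q - g p) \<le> L' * norm (q - p)"
    by (rule C11_E) (rule that)
  show ?thesis
  proof (rule C11_I[where A="\<lambda>p h. f p *\<^sub>R A' p h + A p h *\<^sub>R g p" and ?K1.0="K * K'"
        and ?K2.0="2 * K * K'" and ?K3.0="2 * K * K' + L * L'"])
    fix p assume p: "p \<in> S"
    show "linear (\<lambda>h. f p *\<^sub>R A' p h + A p h *\<^sub>R g p)"
      using f(2)[OF p] g(2)[OF p] by (simp add: linear_iff algebra_simps)
    show "norm (f p *\<^sub>R g p) \<le> K * K'" using f(1,3) g(1,3) p by (auto intro!: mult_mono)
    show "norm (f p *\<^sub>R A' p h + A p h *\<^sub>R g p) \<le> 2 * K * K' * norm h" for h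
    proof -
      have "norm (f p *\<^sub>R A' p h) \<le> K * (K' * norm h)"
        unfolding norm_scaleR using f(1) f(3)[OF p] g(4)[OF p] by (intro mult_mono) auto
      moreover have "norm (A p h *\<^sub>R g p) \<le> (K * norm h) * K'"
        unfolding norm_scaleR using f(1) f(4)[OF p] g(3)[OF p] by (intro mult_mono) auto
      ultimately show ?thesis
        using norm_triangle_ineq[of "f p *\<^sub>R A' p h" "A p h *\<^sub>R g p"] by (simp add: algebra_simps)
    qed
    fix q assume q: "q \<in> S"
    let ?d = "norm (q - p)"
    have eq: "f q *\<^sub>R g q - f p *\<^sub>R g p - (f p *\<^sub>R A' p (q - p) + A p (q - p) *\<^sub>R g p)
      = f p *\<^sub>R (g q - g p - A' p (q - p)) + (f q - f p - A p (q - p)) *\<^sub>R g p + (f q - f p) *\<^sub>R (g q - g p)"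
      by (simp add: algebra_simps)
    have 1: "norm (f p *\<^sub>R (g q - g p - A' p (q - p))) \<le> K * (K' * ?d\<^sup>2)"
      unfolding norm_scaleR using f(1) f(3)[OF p] g(5)[OF p q] by (intro mult_mono) auto
    have 2: "norm ((f q - f p - A p (q - p)) *\<^sub>R g p) \<le> (K * ?d\<^sup>2) * K'"
      unfolding norm_scaleR using f(1) f(5)[OF p q] g(3)[OF p] by (intro mult_mono) auto
    have 3: "norm ((f q - f p) *\<^sub>R (g q - g p)) \<le> (L * ?d) * (L' * ?d)"
      unfolding norm_scaleR using f(6,7) g(6,7) p q by (intro mult_mono) auto
    show "norm (f q *\<^sub>R g q - f p *\<^sub>R g p - (f p *\<^sub>R A' p (q - p) + A p (q - p) *\<^sub>R g p))
        \<le> (2 * K * K' + L * L') * ?d\<^sup>2"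
      unfolding eq using norm_triangle_mono[OF norm_triangle_mono[OF 1 2] 3]
      by (simp add: algebra_simps power2_eq_square)
  qed
qed

lemma C11_mult: "C11 S f \<Longrightarrow> C11 S g \<Longrightarrow> C11 S (\<lambda>p. f p * g p)" for f g :: "'a::real_normed_vector \<Rightarrow> real"
  using C11_scaleR[of S f g] by simp

lemma C11_minus: "C11 S f \<Longrightarrow> C11 S (\<lambda>p. - f p)"
  using C11_scaleR[OF C11_const[of S "-1"], of f] by simp

lemma C11_diff: "C11 S f \<Longrightarrow> C11 S g \<Longrightarrow> C11 S (\<lambda>p. f p - g p)"
  using C11_add[OF _ C11_minus, of S f g] by simp

lemma C11_inverse:
  fixes f :: "'a::real_normed_vector \<Rightarrow> real"
  assumes "C11 S f" "m > 0" "\<And>p. p \<in> S \<Longrightarrow> f p \<ge> m"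
  shows "C11 S (\<lambda>p. inverse (f p))"
proof -
  from assms(1) obtain A K L where f: "K \<ge> 0" "\<And>p. p \<in> S \<Longrightarrow> linear (A p)" "\<And>p. p \<in> S \<Longrightarrow> norm (f p) \<le> K"
    "\<And>p h. p \<in> S \<Longrightarrow> norm (A p h) \<le> K * norm h"
    "\<And>p q. p \<in> S \<Longrightarrow> q \<in> S \<Longrightarrow> norm (f q - f p - A p (q - p)) \<le> K * (norm (q - p))\<^sup>2"
    "L \<ge> 0" "\<And>p q. p \<in> S \<Longrightarrow> q \<in> S \<Longrightarrow> norm (f q - f p) \<le> L * norm (q - p)"
    by (rule C11_E) (rule that)
  have inv: "0 < inverse (f p)" "inverse (f p) \<le> inverse m" if "p \<in> S" for p
    using assms(2) assms(3)[OF that] by (auto intro: le_imp_inverse_le)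
  have inv2: "inverse (f p) * inverse (f p) \<le> inverse m * inverse m" if "p \<in> S" for p
    using inv[OF that] assms(2) by (intro mult_mono) auto
  show ?thesis
  proof (rule C11_I[where A="\<lambda>p h. - (inverse (f p) * inverse (f p)) * A p h" and ?K1.0="inverse m"
        and ?K2.0="inverse m * inverse m * K" and ?K3.0="inverse m * inverse m * K + inverse m * inverse m * inverse m * L\<^sup>2"])
    fix p assume p: "p \<in> S"
    have fp: "f p > 0" using assms(2) assms(3)[OF p] by simp
    show "linear (\<lambda>h. - (inverse (f p) * inverse (f p)) * A p h)"
      using f(2)[OF p] by (simp add: linear_iff algebra_simps)
    show "norm (inverse (f p)) \<le> inverse m" using inv[OF p] by simp
    show "norm (- (inverse (f p) * inverse (f p)) * A p h) \<le> inverse m * inverse m * K * norm h" for h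
    proof -
      have "(inverse (f p) * inverse (f p)) * norm (A p h) \<le> (inverse m * inverse m) * (K * norm h)"
        by (rule mult_mono) (use inv2[OF p] f(4)[OF p] assms(2) fp in auto)
      then show ?thesis using fp by (simp add: norm_mult abs_mult mult_ac)
    qed
    fix q assume q: "q \<in> S"
    have fq: "f q > 0" using assms(2) assms(3)[OF q] by simp
    let ?d = "norm (q - p)"
    have eq: "inverse (f q) - inverse (f p) - (- (inverse (f p) * inverse (f p)) * A p (q - p))
       = - ((inverse (f p) * inverse (f p)) * (f q - f p - A p (q - p)))
         + (inverse (f p) * inverse (f p) * inverse (f q)) * (f q - f p)\<^sup>2"
      using fp fq by (simp add: field_simps power2_eq_square)
    have 1: "norm (- ((inverse (f p) * inverse (f p)) * (f q - f p - A p (q - p)))) \<le> (inverse m * inverse m) * (K * ?d\<^sup>2)"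
    proof -
      have "(inverse (f p) * inverse (f p)) * norm (f q - f p - A p (q - p)) \<le> (inverse m * inverse m) * (K * ?d\<^sup>2)"
        by (rule mult_mono) (use inv2[OF p] f(5)[OF p q] assms(2) fp in auto)
      then show ?thesis using fp by (simp add: norm_mult abs_mult mult_ac)
    qed
    have 2: "norm ((inverse (f p) * inverse (f p) * inverse (f q)) * (f q - f p)\<^sup>2) \<le> (inverse m * inverse m * inverse m) * (L * ?d)\<^sup>2"
    proof -
      have "(f q - f p)\<^sup>2 \<le> (L * ?d)\<^sup>2" using f(7)[OF p q] abs_le_square_iff[of "f q - f p" "L * ?d"] f(6) by simp
      then have "(inverse (f p) * inverse (f p) * inverse (f q)) * (f q - f p)\<^sup>2 \<le> (inverse m * inverse m * inverse m) * (L * ?d)\<^sup>2"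
        by (intro mult_mono[of "_ * _ * _" "_ * _ * _"] mult_mono[of "_ * _" "_ * _"] inv2[OF p])
          (use inv[OF q] fp fq assms(2) in auto)
      then show ?thesis using fp fq by (simp add: norm_mult abs_mult mult_ac)
    qed
    show "norm (inverse (f q) - inverse (f p) - - (inverse (f p) * inverse (f p)) * A p (q - p))
       \<le> (inverse m * inverse m * K + inverse m * inverse m * inverse m * L\<^sup>2) * ?d\<^sup>2"
      unfolding eq using norm_triangle_mono[OF 1 2] by (simp add: power_mult_distrib algebra_simps)
  qed
qed

lemma C11_Pair:
  fixes f :: "'a::real_normed_vector \<Rightarrow> 'b::real_normed_vector" and g :: "'a \<Rightarrow> 'c::real_normed_vector"
  assumes "C11 S f" "C11 S g" shows "C11 S (\<lambda>p. (f p, g p))"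
proof -
  have "C11 S (\<lambda>p. (f p, 0 :: 'c))" if "C11 S f" for f :: "'a \<Rightarrow> 'b"
  proof -
    from that obtain A K where f: "\<And>p. p \<in> S \<Longrightarrow> linear (A p)" "\<And>p. p \<in> S \<Longrightarrow> norm (f p) \<le> K"
      "\<And>p h. p \<in> S \<Longrightarrow> norm (A p h) \<le> K * norm h"
      "\<And>p q. p \<in> S \<Longrightarrow> q \<in> S \<Longrightarrow> norm (f q - f p - A p (q - p)) \<le> K * (norm (q - p))\<^sup>2"
      unfolding C11_def by blast
    show ?thesis
      by (rule C11_I[where A="\<lambda>p h. (A p h, 0)" and ?K1.0=K and ?K2.0=K and ?K3.0=K])
         (use f in \<open>auto simp: linear_iff norm_Pair\<close>)
  qed
  moreover have "C11 S (\<lambda>p. (0 :: 'b, g p))" if "C11 S g" for g :: "'a \<Rightarrow> 'c"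
  proof -
    from that obtain A K where f: "\<And>p. p \<in> S \<Longrightarrow> linear (A p)" "\<And>p. p \<in> S \<Longrightarrow> norm (g p) \<le> K"
      "\<And>p h. p \<in> S \<Longrightarrow> norm (A p h) \<le> K * norm h"
      "\<And>p q. p \<in> S \<Longrightarrow> q \<in> S \<Longrightarrow> norm (g q - g p - A p (q - p)) \<le> K * (norm (q - p))\<^sup>2"
      unfolding C11_def by blast
    show ?thesis
      by (rule C11_I[where A="\<lambda>p h. (0, A p h)" and ?K1.0=K and ?K2.0=K and ?K3.0=K])
         (use f in \<open>auto simp: linear_iff norm_Pair\<close>)
  qed
  ultimately show ?thesis using C11_add[of S "\<lambda>p. (f p, 0)" "\<lambda>p. (0, g p)"] assms by simp
qed

lemma W_inf_2_C11:
  fixes f :: "'a::euclidean_space \<Rightarrow> real"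
  assumes \<Omega>: "open \<Omega>" "convex \<Omega>" and f: "W_inf (Suc (Suc k)) \<Omega> f"
  shows "C11 (closure \<Omega>) f"
proof -
  obtain g K where g: "\<And>i. i \<in> Basis \<Longrightarrow> W_inf (Suc k) \<Omega> (g i)" and
     K: "\<And>p q. p \<in> closure \<Omega> \<Longrightarrow> q \<in> closure \<Omega> \<Longrightarrow>
       \<bar>f q - f p - (\<Sum>i\<in>Basis. ((q - p) \<bullet> i) * g i p)\<bar> \<le> K * (norm (q - p))\<^sup>2"
    using W_inf_2_taylor[OF assms] by blast
  obtain C where C: "\<And>i. i \<in> Basis \<Longrightarrow> C i \<ge> 0" "\<And>i p. i \<in> Basis \<Longrightarrow> p \<in> closure \<Omega> \<Longrightarrow> \<bar>g i p\<bar> \<le> C i"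
    using W_inf_Suc_bounded[OF g] by metis
  obtain B where B: "\<And>p. p \<in> closure \<Omega> \<Longrightarrow> \<bar>f p\<bar> \<le> B" using W_inf_Suc_bounded[OF f] by blast
  show ?thesis
  proof (rule C11_I[where A="\<lambda>p h. \<Sum>i\<in>Basis. (h \<bullet> i) * g i p" and ?K1.0=B and ?K2.0="\<Sum>i\<in>(Basis::'a set). C i" and ?K3.0=K])
    fix p assume p: "p \<in> closure \<Omega>"
    show "linear (\<lambda>h. \<Sum>i\<in>Basis. (h \<bullet> i) * g i p)"
      by (simp add: linear_iff inner_add_left distrib_right sum.distrib sum_distrib_left mult.assoc)
    show "norm (\<Sum>i\<in>Basis. h \<bullet> i * g i p) \<le> (\<Sum>i\<in>(Basis::'a set). C i) * norm h" for h
    proof -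
      have "norm (\<Sum>i\<in>Basis. h \<bullet> i * g i p) \<le> (\<Sum>i\<in>Basis. norm (h \<bullet> i * g i p))" by (rule norm_sum)
      also have "\<dots> \<le> (\<Sum>i\<in>Basis. norm h * C i)"
        using C p by (intro sum_mono) (auto simp: abs_mult intro!: mult_mono Basis_le_norm)
      finally show ?thesis by (simp add: sum_distrib_left mult.commute)
    qed
  qed (use B K in auto)
qed

section \<open>The electric and magnetic fields\<close>

text \<open>The Taylor expansion in time and space, restricted to two points at the same time, says that each
  time slice is continuously differentiable. As it holds up to the boundary of the time slab, this
  includes the slices at the two end times.\<close>

lemma W_inf_2_slice:
  fixes f :: "real \<Rightarrow> real^3 \<Rightarrow> real"
  assumes T: "T > 0" and f: "W_inf (Suc (Suc k)) (field_domain T) (\<lambda>(t, y). f t y)"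
  shows "\<exists>g :: real \<times> (real^3) \<Rightarrow> real \<times> (real^3) \<Rightarrow> real. (\<forall>i\<in>Basis. W_inf (Suc k) (field_domain T) (g i)) \<and>
     (\<forall>t\<in>{0..horizon T}. C1 (f t) \<and> (\<forall>k y. dpartial (axis k 1) (f t) y = g (0, axis k 1) (t, y)))"
proof -
  note dom = field_domain_props[OF T]
  obtain g K where g: "\<And>i. i \<in> Basis \<Longrightarrow> W_inf (Suc k) (field_domain T) (g i)" and K: "K \<ge> 0"
     "\<And>p q. p \<in> {0..horizon T} \<times> UNIV \<Longrightarrow> q \<in> {0..horizon T} \<times> UNIV \<Longrightarrow>
       \<bar>(\<lambda>(t, y). f t y) q - (\<lambda>(t, y). f t y) p - (\<Sum>i\<in>Basis. ((q - p) \<bullet> i) * g i p)\<bar> \<le> K * (norm (q - p))\<^sup>2"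
    using W_inf_2_taylor[OF dom(1,2) f] unfolding dom(3) by (elim exE conjE) blast
  have cg: "continuous_on UNIV (\<lambda>y. g i (t, y))" if "i \<in> Basis" "t \<in> {0..horizon T}" for i t
  proof -
    have "continuous_on ({0..horizon T} \<times> UNIV) (g i)" using g[OF that(1)] dom(3) by simp
    then show ?thesis
      by (rule continuous_on_compose2) (use that in \<open>auto intro!: continuous_intros\<close>)
  qed
  have "C1 (f t)" "dpartial (axis k 1) (f t) y = g (0, axis k 1) (t, y)" if t: "t \<in> {0..horizon T}" for t k y
  proof -
    let ?D = "\<lambda>y h. \<Sum>i\<in>Basis. (h \<bullet> snd i) * g i (t, y)"
    have D: "(f t has_derivative ?D y) (at y)" for y
    proof (rule has_derivativeI_sandwich[of 1 _ _ _ _ "\<lambda>z. K * norm (z - y)"])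
      have "linear (?D y)"
        by (simp add: linear_iff inner_add_left distrib_right sum.distrib sum_distrib_left mult.assoc)
      then show "bounded_linear (?D y)" by (simp add: linear_conv_bounded_linear)
      show "((\<lambda>z. K * norm (z - y)) \<longlongrightarrow> 0) (at y)" by (auto intro!: tendsto_eq_intros)
      fix z assume "z \<noteq> y"
      have "\<bar>f t z - f t y - ?D y (z - y)\<bar> \<le> K * (norm (z - y))\<^sup>2"
        using K(2)[of "(t, y)" "(t, z)"] t by (simp add: norm_Pair inner_prod_def)
      then show "norm (f t z - f t y - ?D y (z - y)) / norm (z - y) \<le> K * norm (z - y)"
        using \<open>z \<noteq> y\<close> by (simp add: divide_le_eq power2_eq_square mult.assoc)
    qed simp
    have ax: "(0, axis k 1) \<in> (Basis :: (real \<times> (real^3)) set)" for k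
      by (auto simp: Basis_prod_def axis_in_Basis_iff)
    have cD: "continuous_on UNIV (\<lambda>y. ?D y i)" if "i \<in> Basis" for i
      using cg[OF _ t] by (intro continuous_intros) auto
    note * = C1I[OF D cD]
    show "C1 (f t)" by (rule *(1))
    show "dpartial (axis k 1) (f t) y = g (0, axis k 1) (t, y)"
    proof -
      have "(axis k 1 \<bullet> snd i) = (0, axis k 1) \<bullet> i" for i :: "real \<times> (real^3)" by (simp add: inner_prod_def)
      then have "?D y (axis k 1) = g (0, axis k 1) (t, y)"
        using ax[of k] by (simp add: inner_Basis if_distrib if_distribR cong: if_cong)
      moreover have "dpartial (axis k 1) (f t) y = ?D y (axis k 1)" by (rule *(2))
      ultimately show ?thesis by simp
    qed
  qed
  then show ?thesis using g by blast
qed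

lemma norm_le_3: "norm (x::real^3) \<le> \<bar>x $ 1\<bar> + \<bar>x $ 2\<bar> + \<bar>x $ 3\<bar>"
  using norm_le_l1_cart[of x] by (simp add: sum_3)

text \<open>The hypotheses on the fields. Their consequences are stated on the closed slab \<open>time_range \<times> UNIV\<close>,
  since the schemes start at time 0 and may evaluate the fields at the end of their time horizon.\<close>
locale gyro_fields =
  fixes E :: "real \<Rightarrow> real^3 \<Rightarrow> real^3" and \<phi> b :: "real \<Rightarrow> real^3 \<Rightarrow> real" and b0 T :: real
  assumes T_pos: "T > 0"
    and E_gradient: "\<And>t y. (t, y) \<in> field_domain T \<Longrightarrow> (\<phi> t has_derivative (\<lambda>h. - (E t y \<bullet> h))) (at y)"
    and E_regular: "\<And>i. W_inf 1 (field_domain T) (\<lambda>(t, y). E t y $ i)"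
    and b0_pos: "b0 > 0"
    and b_lower: "\<And>t y. (t, y) \<in> field_domain T \<Longrightarrow> b t y > b0"
    and b_regular: "W_inf 2 (field_domain T) (\<lambda>(t, y). b t y)"
begin

abbreviation time_range :: "real set" where "time_range \<equiv> {0..horizon T}"

lemma continuous_E: "continuous_on (time_range \<times> UNIV) (\<lambda>(t, y). E t y $ i)"
  using E_regular[of i] field_domain_props(3)[OF T_pos] by simp

lemma continuous_E_slice: "t \<in> time_range \<Longrightarrow> continuous_on UNIV (E t)"
proof -
  assume t: "t \<in> time_range"
  have "continuous_on UNIV (\<lambda>y. (\<lambda>(t, y). E t y $ i) (t, y))" for i
    by (rule continuous_on_compose2[OF continuous_E]) (use t in \<open>auto intro!: continuous_intros\<close>)
  then have "continuous_on UNIV (\<lambda>y. \<chi> i. E t y $ i)"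
    by (intro continuous_on_vec_lambda) simp
  then show ?thesis by simp
qed

lemma C1_b: "t \<in> time_range \<Longrightarrow> C1 (b t)"
  using W_inf_2_slice[OF T_pos, of 0 b] b_regular by (auto simp: numeral_2_eq_2)

lemma b_ge: assumes "t \<in> time_range" shows "b t y \<ge> b0"
proof -
  have "continuous_on (closure (field_domain T)) (\<lambda>(t, y). b t y)"
    using b_regular by (simp add: numeral_2_eq_2)
  then have "(\<lambda>(t, y). b t y) (t, y) \<ge> b0"
    by (rule continuous_ge_on_closure)
       (use b_lower assms field_domain_props(3)[OF T_pos] in \<open>auto simp: less_imp_le\<close>)
  then show ?thesis by simp
qed

lemma b_pos: "t \<in> time_range \<Longrightarrow> b t y > 0"
  using b_ge[of t y] b0_pos by simp

lemma grad_perp_ln: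
  assumes t: "t \<in> time_range"
  shows "grad_perp (\<lambda>z. ln (b t z)) y = grad_perp (b t) y /\<^sub>R b t y"
proof -
  have pos: "b t z > 0" for z using b_pos[OF t] .
  let ?D = "\<lambda>y h. (\<Sum>i\<in>Basis. (h \<bullet> i) * dpartial i (b t) y) / b t y"
  have D: "((\<lambda>z. ln (b t z)) has_derivative ?D y) (at y)" for y
    using has_derivative_ln[OF pos C1_has_derivative[OF C1_b[OF t]]]
    by (simp add: divide_inverse mult.commute)
  have cD: "continuous_on UNIV (\<lambda>y. ?D y i)" if "i \<in> Basis" for i
    using C1_b[OF t] C1_continuous[OF C1_b[OF t]] pos
    by (auto simp: C1_def less_imp_neq[THEN not_sym] intro!: continuous_intros)
  have "dpartial (axis k 1) (\<lambda>z. ln (b t z)) y = dpartial (axis k 1) (b t) y / b t y" for k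
  proof -
    have "dpartial (axis k 1) (\<lambda>z. ln (b t z)) y = ?D y (axis k 1)" by (rule C1I(2)[OF D cD])
    also have "(\<Sum>i\<in>Basis. (axis k 1 \<bullet> i) * dpartial i (b t) y) = dpartial (axis k 1) (b t) y"
      by (simp add: inner_Basis axis_in_Basis_iff if_distrib if_distribR cong: if_cong)
    finally show ?thesis .
  qed
  then show ?thesis
    by (simp add: grad_perp_def vec_eq_iff forall_3 divide_inverse mult.commute)
qed

text \<open>At interior times the electric field is a continuous gradient. Both integrals depend
  continuously on time, which covers the end times, where no potential is given.\<close>
lemma curl_free:
  assumes t: "t \<in> time_range" and \<psi>: "C1_compact_support UNIV \<psi>"
  shows "(LINT z|lebesgue. E t z $ 1 * dpartial (axis 2 1) \<psi> z) = (LINT z|lebesgue. E t z $ 2 * dpartial (axis 1 1) \<psi> z)"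
proof -
  from \<psi> obtain K where C\<psi>: "C1 \<psi>" and K: "compact K" "\<And>z. z \<notin> K \<Longrightarrow> \<psi> z = 0"
    by (auto simp: C1_compact_support_def C1_def)
  have ax: "axis k 1 \<in> (Basis :: (real^3) set)" for k by (simp add: axis_in_Basis_iff)
  have d\<psi>: "continuous_on UNIV (dpartial (axis k 1) \<psi>)" for k using C\<psi> ax by (simp add: C1_def)
  have d\<psi>0: "dpartial i \<psi> z = 0" if "z \<notin> K" for i z
    by (rule dpartial_0_outside[OF compact_imp_closed[OF K(1)] K(2) that])
  have "bounded K" using K(1) compact_imp_bounded by blast
  then obtain a where a: "K \<subseteq> cbox (-a) a" using bounded_subset_cbox_symmetric by blast
  define I where "I = (\<lambda>t. integral (cbox (-a) a) (\<lambda>z. E t z $ 1 * dpartial (axis 2 1) \<psi> z)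
      - integral (cbox (-a) a) (\<lambda>z. E t z $ 2 * dpartial (axis 1 1) \<psi> z))"
  have eq: "(LINT z|lebesgue. E t z $ l * dpartial (axis k 1) \<psi> z) = integral (cbox (-a) a) (\<lambda>z. E t z $ l * dpartial (axis k 1) \<psi> z)"
    if "t \<in> time_range" for t k l
  proof (rule integral_compact_support(2))
    show "continuous_on UNIV (\<lambda>z. E t z $ l * dpartial (axis k 1) \<psi> z)"
      by (intro continuous_on_mult d\<psi> continuous_on_component continuous_E_slice that)
    show "E t z $ l * dpartial (axis k 1) \<psi> z = 0" if "z \<notin> cbox (-a) a" for z
      using d\<psi>0[of z] that a by auto
  qed
  have cont: "continuous_on time_range (\<lambda>t. integral (cbox (-a) a) (\<lambda>z. E t z $ l * dpartial (axis k 1) \<psi> z))" for k l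
  proof (rule integral_continuous_on_param)
    have "continuous_on (time_range \<times> cbox (-a) a) (\<lambda>p. (\<lambda>(t, y). E t y $ l) p * dpartial (axis k 1) \<psi> (snd p))"
      by (intro continuous_on_mult continuous_on_subset[OF continuous_E] continuous_on_compose2[OF d\<psi>] continuous_intros) auto
    then show "continuous_on (time_range \<times> cbox (-a) a) (\<lambda>(t, z). E t z $ l * dpartial (axis k 1) \<psi> z)"
      by (simp add: case_prod_beta)
  qed
  have 0: "I t = 0" if "t \<in> {0<..<horizon T}" for t
  proof -
    have t: "t \<in> time_range" using that by auto
    have D: "(\<phi> t has_derivative (\<lambda>h. - (E t y \<bullet> h))) (at y)" for y
      by (rule E_gradient) (use that in \<open>auto simp: field_domain_def horizon_def\<close>)
    have cD: "continuous_on UNIV (\<lambda>y. - (E t y \<bullet> i))" for i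
      using continuous_E_slice[OF t] by (intro continuous_intros)
    note * = C1I[OF D cD]
    have dp: "dpartial (axis k 1) (\<phi> t) y = - (E t y $ k)" for k y
      unfolding *(2) by (simp add: inner_axis)
    have "(LINT z|lebesgue. dpartial (axis 1 1) (\<phi> t) z * dpartial (axis 2 1) \<psi> z) = (LINT z|lebesgue. dpartial (axis 2 1) (\<phi> t) z * dpartial (axis 1 1) \<psi> z)"
      by (rule gradient_weak_curl_free[OF *(1) C\<psi> K ax ax])
    then show ?thesis
      unfolding I_def eq[OF t, symmetric] by (simp add: dp)
  qed
  have h: "horizon T > 0" using horizon_gt[OF T_pos] T_pos by simp
  have "I t = 0"
  proof (rule continuous_constant_on_closure[of "{0<..<horizon T}" I 0 t])
    show "continuous_on (closure {0<..<horizon T}) I"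
      unfolding I_def using cont h by (auto intro!: continuous_intros)
  qed (use 0 h t in auto)
  then show ?thesis unfolding eq[OF t] by (simp add: I_def)
qed

lemma divF_eq:
  assumes t: "t \<in> time_range"
  shows "divF E b t y = (E t y $ 2 * dpartial (axis 1 1) (b t) y - E t y $ 1 * dpartial (axis 2 1) (b t) y) / (b t y)\<^sup>2"
  unfolding divF_def Fdrift_def
  by (rule div_perp_rot_drift[OF continuous_E_slice[OF t] C1_b[OF t] b_pos[OF t] curl_free[OF t]])

lemma field_bounds:
  "\<exists>B\<ge>1. \<forall>t\<in>time_range. \<forall>y. norm (E t y) \<le> B \<and> b0 \<le> b t y \<and> b t y \<le> B \<and> norm (grad_perp (b t) y) \<le> B \<and>
     norm (grad_perp (\<lambda>z. ln (b t z)) y) \<le> B \<and> (\<forall>s\<in>time_range. \<forall>z. \<bar>b s z - b t y\<bar> \<le> B * (\<bar>s - t\<bar> + norm (z - y)))"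
proof -
  note dom = field_domain_props[OF T_pos]
  have "\<exists>C. C \<ge> 0 \<and> (\<forall>p\<in>time_range \<times> UNIV. \<bar>(\<lambda>(t, y). E t y $ i) p\<bar> \<le> C)" for i
    using W_inf_Suc_bounded[OF E_regular[of i, unfolded One_nat_def]] dom(3) by simp
  then obtain C where C: "\<And>i t y. t \<in> time_range \<Longrightarrow> \<bar>E t y $ i\<bar> \<le> C i" and C0: "\<And>i. C i \<ge> 0"
    by (metis (mono_tags, lifting) case_prod_conv mem_Sigma_iff UNIV_I)
  define B1 where "B1 = C 1 + C 2 + C 3"
  have B1: "norm (E t y) \<le> B1" if "t \<in> time_range" for t y
    using norm_le_3[of "E t y"] C[OF that, of y 1] C[OF that, of y 2] C[OF that, of y 3] by (simp add: B1_def)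
  have b2: "W_inf (Suc (Suc 0)) (field_domain T) (\<lambda>(t, y). b t y)" using b_regular by (simp add: numeral_2_eq_2)
  obtain B2 where B2: "\<And>t y. t \<in> time_range \<Longrightarrow> \<bar>b t y\<bar> \<le> B2"
    using W_inf_Suc_bounded[OF b2] unfolding dom(3) by (elim exE conjE) force
  obtain L where L0: "L \<ge> 0" and L: "\<forall>p\<in>time_range \<times> UNIV. \<forall>q\<in>time_range \<times> UNIV. \<bar>(\<lambda>(t, y). b t y) q - (\<lambda>(t, y). b t y) p\<bar> \<le> L * norm (q - p)"
    using W_inf_1_lipschitz[OF dom(1,2) b2] unfolding dom(3) by blast
  have L: "\<bar>b s z - b t y\<bar> \<le> L * (\<bar>s - t\<bar> + norm (z - y))" if "t \<in> time_range" "s \<in> time_range" for s t y z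
  proof -
    have "\<bar>b s z - b t y\<bar> \<le> L * norm ((s, z) - (t, y))" using L that by force
    also have "\<dots> \<le> L * (\<bar>s - t\<bar> + norm (z - y))"
      using norm_Pair_le[of "s - t" "z - y"] L0 by (intro mult_left_mono) auto
    finally show ?thesis .
  qed
  obtain g :: "real \<times> (real^3) \<Rightarrow> real \<times> (real^3) \<Rightarrow> real" where
    g: "\<And>i. i \<in> Basis \<Longrightarrow> W_inf (Suc 0) (field_domain T) (g i)"
    and dg: "\<And>t k y. t \<in> time_range \<Longrightarrow> dpartial (axis k 1) (b t) y = g (0, axis k 1) (t, y)"
    using W_inf_2_slice[OF T_pos b2] by blast
  have ax: "(0, axis k 1) \<in> (Basis :: (real \<times> (real^3)) set)" for k
    by (auto simp: Basis_prod_def axis_in_Basis_iff)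
  have "\<exists>C. \<forall>p\<in>time_range \<times> UNIV. \<bar>g (0, axis k 1) p\<bar> \<le> C" for k
    using W_inf_Suc_bounded[OF g[OF ax]] dom(3) by metis
  then obtain G where G: "\<And>k t y. t \<in> time_range \<Longrightarrow> \<bar>dpartial (axis k 1) (b t) y\<bar> \<le> G k"
    unfolding dg by (metis mem_Sigma_iff UNIV_I dg)
  define B3 where "B3 = G 1 + G 2"
  have B3: "norm (grad_perp (b t) y) \<le> B3" if "t \<in> time_range" for t y
    using norm_le_3[of "grad_perp (b t) y"] G[OF that, of 1 y] G[OF that, of 2 y]
    by (simp add: grad_perp_def B3_def)
  have B4: "norm (grad_perp (\<lambda>z. ln (b t z)) y) \<le> B3 / b0" if "t \<in> time_range" for t y
  proof -
    have "norm (grad_perp (b t) y) / b t y \<le> B3 / b0"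
      using B3[OF that, of y] b_ge[OF that, of y] b0_pos by (intro frac_le) (auto intro: order_trans[OF norm_ge_zero])
    then show ?thesis using b_pos[OF that, of y] by (simp add: grad_perp_ln[OF that] divide_inverse mult.commute)
  qed
  define B where "B = max 1 (max (max B1 B2) (max L (max B3 (B3 / b0))))"
  have le: "1 \<le> B" "B1 \<le> B" "B2 \<le> B" "L \<le> B" "B3 \<le> B" "B3 / b0 \<le> B" by (auto simp: B_def)
  have "L * (\<bar>s - t\<bar> + norm (z - y)) \<le> B * (\<bar>s - t\<bar> + norm (z - y))" for s t and z y :: "real^3"
    using le(4) by (intro mult_right_mono) auto
  then have LB: "\<bar>b s z - b t y\<bar> \<le> B * (\<bar>s - t\<bar> + norm (z - y))" if "t \<in> time_range" "s \<in> time_range" for s t y z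
    using L[OF that, of z y] order_trans by blast
  show ?thesis
  proof (intro exI[of _ B] conjI ballI allI)
    show "b t y \<le> B" if "t \<in> time_range" for t y using B2[OF that, of y] le by linarith
  qed (use le order_trans[OF B1 le(2)] order_trans[OF B3 le(5)] order_trans[OF B4 le(6)] b_ge LB in auto)
qed

end

section \<open>The velocity stages of the semi-implicit scheme\<close>

lemma rot_perp_components:
  "perp w $ 1 = w $ 1" "perp w $ 2 = w $ 2" "perp w $ 3 = 0"
  "rot w $ 1 = - (w $ 2)" "rot w $ 2 = w $ 1" "rot w $ 3 = 0"
  by (simp_all add: perp_def rot_def)

lemma vec3_eq_iff: "(v::real^3) = w \<longleftrightarrow> v $ 1 = w $ 1 \<and> v $ 2 = w $ 2 \<and> v $ 3 = w $ 3"
  by (simp add: vec_eq_iff forall_3)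

lemma linear_perp: "linear perp" and linear_rot: "linear rot"
  by (simp_all add: linear_iff vec3_eq_iff rot_perp_components)

lemma norm_rot: "norm (rot w) = norm (perp w)"
  by (simp add: norm_eq_sqrt_inner inner_vec_def sum_3 rot_perp_components add.commute)

lemma norm_perp_square: "(norm (perp w))\<^sup>2 = (w $ 1)\<^sup>2 + (w $ 2)\<^sup>2"
  unfolding power2_norm_eq_inner by (simp add: inner_vec_def sum_3 rot_perp_components power2_eq_square)

lemma norm_perp_le: "norm (perp w) \<le> norm w"
proof (rule power2_le_imp_le)
  show "(norm (perp w))\<^sup>2 \<le> (norm w)\<^sup>2"
    by (simp add: power2_norm_eq_inner inner_vec_def sum_3 rot_perp_components)
qed simp

lemma norm_perp_parallel: "norm w \<le> norm (perp w) + \<bar>w $ 3\<bar>"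
proof -
  have "w = perp w + (w $ 3) *\<^sub>R axis 3 1"
    by (simp add: vec3_eq_iff rot_perp_components axis_def)
  then have "norm w \<le> norm (perp w) + norm ((w $ 3) *\<^sub>R (axis 3 1 :: real^3))"
    by (metis norm_triangle_ineq)
  then show ?thesis by simp
qed

lemma norm_perp_rotated:
  "(norm (perp (w + \<mu> *\<^sub>R rot w)))\<^sup>2 = (1 + \<mu>\<^sup>2) * (norm (perp w))\<^sup>2"
  unfolding norm_perp_square
  by (simp add: rot_perp_components power2_eq_square algebra_simps)

lemma schemeS_stepD:
  assumes "schemeS_step E b chi \<epsilon> \<Delta>t t x v e v1 xh eh vh x' v' e'" and pos: "\<Delta>t > 0"
  obtains F1 F2 where
    "F1 = Hforce E b chi t x (perp v) e - (b t x / \<epsilon>) *\<^sub>R rot v1"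
    "F2 = Hforce E b chi (t + \<Delta>t / (2 * \<gamma>)) xh (perp vh) eh - (b (t + \<Delta>t / (2 * \<gamma>)) xh / \<epsilon>) *\<^sub>R rot v'"
    "v1 = v + (\<Delta>t * \<gamma>) *\<^sub>R F1"
    "xh = x + (\<Delta>t * (1 / (2 * \<gamma>))) *\<^sub>R v1"
    "eh = e + \<Delta>t * (1 / (2 * \<gamma>)) * (perp (E t x) \<bullet> perp v1)"
    "vh = v + (\<Delta>t * (1 / (2 * \<gamma>))) *\<^sub>R F1"
    "v' = v + \<Delta>t *\<^sub>R ((1 - \<gamma>) *\<^sub>R F1 + \<gamma> *\<^sub>R F2)"
    "x' = x + \<Delta>t *\<^sub>R ((1 - \<gamma>) *\<^sub>R v1 + \<gamma> *\<^sub>R v')"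
    "e' = e + \<Delta>t * ((1 - \<gamma>) * (perp (E t x) \<bullet> perp v1) + \<gamma> * (perp (E (t + \<Delta>t / (2 * \<gamma>)) xh) \<bullet> perp v'))"
proof -
  have vec: "a = c + \<Delta>t *\<^sub>R d" if "(a - c) /\<^sub>R \<Delta>t = d" for a c d :: "real^3"
  proof -
    have "a = c + \<Delta>t *\<^sub>R ((a - c) /\<^sub>R \<Delta>t)" using pos by simp
    then show ?thesis unfolding that .
  qed
  have real: "a = c + \<Delta>t * d" if "(a - c) / \<Delta>t = d" for a c d
    using that pos by (simp add: field_simps)
  define F1 where "F1 = Hforce E b chi t x (perp v) e - (b t x / \<epsilon>) *\<^sub>R rot v1"
  define F2 where "F2 = Hforce E b chi (t + \<Delta>t / (2 * \<gamma>)) xh (perp vh) eh - (b (t + \<Delta>t / (2 * \<gamma>)) xh / \<epsilon>) *\<^sub>R rot v'"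
  have S: "(v1 - v) /\<^sub>R \<Delta>t = \<gamma> *\<^sub>R F1" "(xh - x) /\<^sub>R \<Delta>t = (1 / (2 * \<gamma>)) *\<^sub>R v1"
    "(eh - e) / \<Delta>t = (1 / (2 * \<gamma>)) * (perp (E t x) \<bullet> perp v1)" "(vh - v) /\<^sub>R \<Delta>t = (1 / (2 * \<gamma>)) *\<^sub>R F1"
    "(v' - v) /\<^sub>R \<Delta>t = (1 - \<gamma>) *\<^sub>R F1 + \<gamma> *\<^sub>R F2" "(x' - x) /\<^sub>R \<Delta>t = (1 - \<gamma>) *\<^sub>R v1 + \<gamma> *\<^sub>R v'"
    "(e' - e) / \<Delta>t = (1 - \<gamma>) * (perp (E t x) \<bullet> perp v1) + \<gamma> * (perp (E (t + \<Delta>t / (2 * \<gamma>)) xh) \<bullet> perp v')"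
    using assms(1) unfolding schemeS_step_def Let_def F1_def F2_def scaleR_scaleR divide_inverse
    by (simp_all only: scaleR_scaleR)
  show ?thesis
    by (rule that[OF F1_def F2_def])
      (use vec[OF S(1)] vec[OF S(2)] real[OF S(3)] vec[OF S(4)] vec[OF S(5)] vec[OF S(6)] real[OF S(7)]
        in \<open>simp_all only: scaleR_scaleR mult.assoc\<close>)
qed

text \<open>The modulus of the factor by which the velocity across the field is multiplied when the two stages
  see the intensities \<open>b1\<close> and \<open>b2\<close>; the number \<open>c\<close> stands for \<open>\<gamma> * \<Delta>t / \<epsilon>\<close> and is not bounded. The
  square of the modulus exceeds 1 by at most the positive part of \<open>c\<^sup>2 * (b1\<^sup>2 - b2\<^sup>2) - (c\<^sup>2 * b1 * b2)\<^sup>2\<close>.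
  As a function of \<open>c\<^sup>2\<close> this difference is a concave parabola, whose maximum \<open>((b1\<^sup>2 - b2\<^sup>2) / (2 * b1 * b2))\<^sup>2\<close> is quadratic in
  \<open>b1 - b2\<close>.\<close>
lemma amplification_le:
  fixes c b1 b2 b0 B :: real
  assumes "0 < b0" "b0 \<le> b1" "b0 \<le> b2" "b1 \<le> B" "b2 \<le> B"
  defines "\<rho> \<equiv> sqrt ((1 + 2 * (c * b1)\<^sup>2) / ((1 + (c * b1)\<^sup>2) * (1 + (c * b2)\<^sup>2)))"
  shows "\<rho> \<le> 2" "\<rho> \<le> 1 + (B * \<bar>b1 - b2\<bar> / b0\<^sup>2)\<^sup>2"
proof -
  define m1 m2 where "m1 = (c * b1)\<^sup>2" and "m2 = (c * b2)\<^sup>2"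
  have m: "m1 \<ge> 0" "m2 \<ge> 0" by (auto simp: m1_def m2_def)
  have pos: "(1 + m1) * (1 + m2) \<ge> 1" using m by (simp add: algebra_simps)
  have \<rho>: "\<rho> = sqrt ((1 + 2 * m1) / ((1 + m1) * (1 + m2)))" by (simp add: \<rho>_def m1_def m2_def)
  have m12: "m1 * m2 \<ge> 0" using m by simp
  have "1 + 2 * m1 \<le> 4 * ((1 + m1) * (1 + m2))" using m m12 by (simp add: distrib_left distrib_right)
  then have "(1 + 2 * m1) / ((1 + m1) * (1 + m2)) \<le> 4" using pos by (simp add: divide_le_eq)
  then have "\<rho> \<le> sqrt 4" unfolding \<rho> by (rule real_sqrt_le_mono)
  then show "\<rho> \<le> 2" by simp
  define y where "y = (B * \<bar>b1 - b2\<bar> / b0\<^sup>2)\<^sup>2"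
  have y0: "y \<ge> 0" by (simp add: y_def)
  have "m1 - m2 - m1 * m2 \<le> y"
  proof -
    define D where "D = b1\<^sup>2 - b2\<^sup>2"
    have "m1 - m2 - m1 * m2 = c\<^sup>2 * D - (c\<^sup>2 * (b1 * b2))\<^sup>2"
      by (simp add: m1_def m2_def D_def power_mult_distrib algebra_simps power2_eq_square)
    also have "\<dots> \<le> (D / (2 * (b1 * b2)))\<^sup>2"
    proof -
      have bb: "b1 * b2 > 0" using assms by simp
      \<comment> \<open>completing the square in \<open>c\<^sup>2\<close>\<close>
      have "0 \<le> (c\<^sup>2 * (b1 * b2) - D / (2 * (b1 * b2)))\<^sup>2" by simp
      also have "\<dots> = (c\<^sup>2 * (b1 * b2))\<^sup>2 - c\<^sup>2 * D + (D / (2 * (b1 * b2)))\<^sup>2"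
      proof -
        have "(u * p - D / (2 * p))\<^sup>2 = (u * p)\<^sup>2 - u * D + (D / (2 * p))\<^sup>2" if "p > 0" for u p
          using that by (simp add: field_simps power2_eq_square)
        from this[OF bb] show ?thesis by simp
      qed
      finally show ?thesis by simp
    qed
    also have "\<dots> \<le> (B * \<bar>b1 - b2\<bar> / b0\<^sup>2)\<^sup>2"
    proof -
      have "\<bar>D\<bar> = \<bar>b1 - b2\<bar> * (b1 + b2)"
        using assms by (simp add: D_def power2_eq_square square_diff_square_factored abs_mult)
      also have "\<dots> \<le> \<bar>b1 - b2\<bar> * (2 * B)" using assms by (intro mult_left_mono) auto
      finally have 1: "\<bar>D\<bar> \<le> 2 * (B * \<bar>b1 - b2\<bar>)" by (simp add: mult_ac)
      have 2: "b0\<^sup>2 \<le> b1 * b2" using assms by (simp add: power2_eq_square mult_mono)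
      have b02: "b0\<^sup>2 > 0" using assms by simp
      have "\<bar>D / (2 * (b1 * b2))\<bar> = \<bar>D\<bar> / (2 * (b1 * b2))" using assms by (simp add: abs_mult)
      also have "\<dots> \<le> (2 * (B * \<bar>b1 - b2\<bar>)) / (2 * b0\<^sup>2)"
        using 1 2 b02 by (intro frac_le) auto
      finally have "\<bar>D / (2 * (b1 * b2))\<bar> \<le> B * \<bar>b1 - b2\<bar> / b0\<^sup>2" by simp
      then have "\<bar>D / (2 * (b1 * b2))\<bar>\<^sup>2 \<le> (B * \<bar>b1 - b2\<bar> / b0\<^sup>2)\<^sup>2" by (intro power_mono) auto
      then show ?thesis by (simp only: power2_abs)
    qed
    finally show ?thesis by (simp add: y_def)
  qed
  moreover have "y \<le> y * ((1 + m1) * (1 + m2))" using pos y0 mult_left_mono[OF pos y0] by simp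
  ultimately have "1 + 2 * m1 \<le> (1 + y) * ((1 + m1) * (1 + m2))"
    by (simp add: algebra_simps)
  then have "(1 + 2 * m1) / ((1 + m1) * (1 + m2)) \<le> 1 + y" using pos by (simp add: divide_le_eq)
  also have "\<dots> \<le> (1 + y)\<^sup>2" using y0 by (simp add: power2_eq_square algebra_simps)
  finally have "\<rho> \<le> sqrt ((1 + y)\<^sup>2)" unfolding \<rho> by (rule real_sqrt_le_mono)
  then show "\<rho> \<le> 1 + (B * \<bar>b1 - b2\<bar> / b0\<^sup>2)\<^sup>2" using y0 by (simp add: y_def)
qed

text \<open>The operators \<open>w \<mapsto> w + \<mu> *\<^sub>R rot w\<close> multiply the length of the part across the field by
  \<open>sqrt (1 + \<mu>\<^sup>2)\<close>. The second hypothesis is the final velocity equation of the scheme after the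
  initial velocity has been eliminated by means of the first stage; its coefficient \<open>sqrt 2\<close> is
  \<open>(1 - \<gamma>) / \<gamma> - 1\<close>.\<close>
lemma perp_velocity_step:
  assumes P: "v1 + \<mu>1 *\<^sub>R rot v1 = v + h1"
    and Q: "v' + \<mu>2 *\<^sub>R rot v' = v1 - (sqrt 2 * \<mu>1) *\<^sub>R rot v1 + h2"
  shows "norm (perp v1) \<le> norm (perp v) + norm h1"
    and "norm (perp v') \<le> sqrt ((1 + 2 * \<mu>1\<^sup>2) / ((1 + \<mu>1\<^sup>2) * (1 + \<mu>2\<^sup>2))) * (norm (perp v) + norm h1) + norm h2"
proof -
  interpret perp: linear perp by (rule linear_perp)
  have s: "norm (perp (w + \<mu> *\<^sub>R rot w)) = sqrt (1 + \<mu>\<^sup>2) * norm (perp w)" for w \<mu>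
  proof -
    have "norm (perp (w + \<mu> *\<^sub>R rot w)) = sqrt ((norm (perp (w + \<mu> *\<^sub>R rot w)))\<^sup>2)" by simp
    also have "\<dots> = sqrt (1 + \<mu>\<^sup>2) * norm (perp w)" unfolding norm_perp_rotated real_sqrt_mult by simp
    finally show ?thesis .
  qed
  have A: "sqrt (1 + \<mu>1\<^sup>2) * norm (perp v1) \<le> norm (perp v) + norm h1"
    unfolding s[symmetric] P perp.add using norm_triangle_ineq[of "perp v" "perp h1"] norm_perp_le[of h1] by linarith
  have "1 * norm (perp v1) \<le> sqrt (1 + \<mu>1\<^sup>2) * norm (perp v1)" by (intro mult_right_mono) simp_all
  then show "norm (perp v1) \<le> norm (perp v) + norm h1" using A by simp
  have "sqrt (1 + \<mu>2\<^sup>2) * norm (perp v') \<le> norm (perp (v1 + (- (sqrt 2 * \<mu>1)) *\<^sub>R rot v1)) + norm h2"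
    unfolding s[of v' \<mu>2, symmetric] Q perp.add
    using norm_triangle_ineq[of "perp v1 + perp ((- (sqrt 2 * \<mu>1)) *\<^sub>R rot v1)" "perp h2"] norm_perp_le[of h2]
    by (simp add: perp.diff perp.neg)
  also have "norm (perp (v1 + (- (sqrt 2 * \<mu>1)) *\<^sub>R rot v1)) = sqrt (1 + 2 * \<mu>1\<^sup>2) * norm (perp v1)"
    unfolding s by (simp add: power_mult_distrib)
  finally have B: "sqrt (1 + \<mu>2\<^sup>2) * norm (perp v') \<le> sqrt (1 + 2 * \<mu>1\<^sup>2) * norm (perp v1) + norm h2" .
  have p1: "sqrt (1 + \<mu>1\<^sup>2) > 0" and p2: "sqrt (1 + \<mu>2\<^sup>2) \<ge> 1" by (simp_all add: add_pos_nonneg)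
  have "norm (perp v1) \<le> (norm (perp v) + norm h1) / sqrt (1 + \<mu>1\<^sup>2)"
    using A p1 by (simp add: field_simps)
  then have C: "sqrt (1 + 2 * \<mu>1\<^sup>2) * norm (perp v1) \<le> sqrt (1 + 2 * \<mu>1\<^sup>2) * ((norm (perp v) + norm h1) / sqrt (1 + \<mu>1\<^sup>2))"
    by (rule mult_left_mono) simp
  have "norm (perp v') \<le> (sqrt (1 + 2 * \<mu>1\<^sup>2) * norm (perp v1) + norm h2) / sqrt (1 + \<mu>2\<^sup>2)"
    using B less_le_trans[OF zero_less_one p2] by (simp add: pos_le_divide_eq mult.commute)
  also have "\<dots> \<le> (sqrt (1 + 2 * \<mu>1\<^sup>2) * ((norm (perp v) + norm h1) / sqrt (1 + \<mu>1\<^sup>2))) / sqrt (1 + \<mu>2\<^sup>2) + norm h2"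
  proof -
    have "norm h2 / sqrt (1 + \<mu>2\<^sup>2) \<le> norm h2 / 1" using p2 by (intro divide_left_mono) (auto simp: add_pos_nonneg)
    moreover have "(sqrt (1 + 2 * \<mu>1\<^sup>2) * norm (perp v1)) / sqrt (1 + \<mu>2\<^sup>2)
       \<le> (sqrt (1 + 2 * \<mu>1\<^sup>2) * ((norm (perp v) + norm h1) / sqrt (1 + \<mu>1\<^sup>2))) / sqrt (1 + \<mu>2\<^sup>2)"
      using C by (intro divide_right_mono) auto
    ultimately show ?thesis by (simp add: add_divide_distrib)
  qed
  finally show "norm (perp v') \<le> sqrt ((1 + 2 * \<mu>1\<^sup>2) / ((1 + \<mu>1\<^sup>2) * (1 + \<mu>2\<^sup>2))) * (norm (perp v) + norm h1) + norm h2"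
    by (simp add: real_sqrt_divide real_sqrt_mult)
qed

text \<open>The growth rate contains \<open>(\<Delta>t * a n)\<^sup>2\<close>, so the recursion is cubic and Gronwall's inequality does not apply at once. With \<open>M1\<close>
  the bound for the linear recursion of rate \<open>2 * C * \<Delta>t\<close>, this rate dominates as long as
  \<open>\<Delta>t * M1\<^sup>2 \<le> 1\<close>. Otherwise the number of steps is at most \<open>T * M1\<^sup>2\<close>, and the crude factor \<open>K\<close> per step
  suffices.\<close>
lemma discrete_growth_bound:
  fixes C K A0 T :: real
  assumes "C \<ge> 0" "K \<ge> 1" "A0 \<ge> 1" "T > 0"
  shows "\<exists>M. \<forall>\<Delta>t>0. \<forall>N. \<forall>a :: nat \<Rightarrow> real.
     real N * \<Delta>t \<le> T \<longrightarrow> a 0 \<le> A0 \<longrightarrow> (\<forall>n. a n \<ge> 0) \<longrightarrow>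
     (\<forall>n<N. a (Suc n) \<le> (1 + C * \<Delta>t + C * (\<Delta>t * a n)\<^sup>2) * a n \<and> a (Suc n) \<le> K * a n) \<longrightarrow>
     (\<forall>n\<le>N. a n \<le> M)"
proof -
  define M1 where "M1 = A0 * exp (2 * C * T)"
  have M1: "M1 \<ge> 1" using assms by (simp add: M1_def mult_ge1_I)
  define m where "m = nat \<lceil>T * M1\<^sup>2\<rceil>"
  define M where "M = max M1 (A0 * K ^ m)"
  show ?thesis
  proof (intro exI[of _ M] allI impI)
    fix \<Delta>t :: real and N :: nat and a :: "nat \<Rightarrow> real" and n
    assume dt: "\<Delta>t > 0" and N: "real N * \<Delta>t \<le> T" and a0: "a 0 \<le> A0" and nn: "\<forall>n. a n \<ge> 0"
      and step: "\<forall>n<N. a (Suc n) \<le> (1 + C * \<Delta>t + C * (\<Delta>t * a n)\<^sup>2) * a n \<and> a (Suc n) \<le> K * a n"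
      and n: "n \<le> N"
    show "a n \<le> M"
    proof (cases "\<Delta>t * M1\<^sup>2 \<le> 1")
      case True
      have "a k \<le> A0 * (1 + 2 * C * \<Delta>t) ^ k" if "k \<le> N" for k
        using that
      proof (induction k)
        case 0 then show ?case using a0 by simp
      next
        case (Suc k)
        then have IH: "a k \<le> A0 * (1 + 2 * C * \<Delta>t) ^ k" and k: "k < N" by simp_all
        have "A0 * (1 + 2 * C * \<Delta>t) ^ k \<le> A0 * exp (2 * C * \<Delta>t) ^ k"
          using assms dt by (intro mult_left_mono power_mono exp_ge_add_one_self) auto
        also have "\<dots> = A0 * exp (2 * C * (real k * \<Delta>t))" by (simp add: exp_of_nat_mult[symmetric] mult_ac)
        also have "\<dots> \<le> M1"
        proof -
          have "real k * \<Delta>t \<le> real N * \<Delta>t" using k dt by (intro mult_right_mono) auto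
          then have "real k * \<Delta>t \<le> T" using N by simp
          then show ?thesis using assms by (auto simp: M1_def intro!: mult_left_mono)
        qed
        finally have "a k \<le> M1" using IH by simp
        then have "(a k)\<^sup>2 \<le> M1\<^sup>2" using nn by (intro power_mono) auto
        then have "\<Delta>t * (a k)\<^sup>2 \<le> \<Delta>t * M1\<^sup>2" using dt by (intro mult_left_mono) auto
        then have "\<Delta>t * (a k)\<^sup>2 \<le> 1" using True by simp
        then have "\<Delta>t * (\<Delta>t * (a k)\<^sup>2) \<le> \<Delta>t * 1" using dt by (intro mult_left_mono) auto
        then have "(\<Delta>t * a k)\<^sup>2 \<le> \<Delta>t" by (simp add: power2_eq_square mult_ac)
        then have "C * (\<Delta>t * a k)\<^sup>2 \<le> C * \<Delta>t" using assms by (intro mult_left_mono) auto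
        then have "(1 + C * \<Delta>t + C * (\<Delta>t * a k)\<^sup>2) * a k \<le> (1 + 2 * C * \<Delta>t) * a k"
          using nn by (intro mult_right_mono) auto
        also have "\<dots> \<le> (1 + 2 * C * \<Delta>t) * (A0 * (1 + 2 * C * \<Delta>t) ^ k)"
          using IH assms dt by (intro mult_left_mono) auto
        finally show ?case using step k by (fastforce simp: mult_ac)
      qed
      from this[OF n] have "a n \<le> A0 * (1 + 2 * C * \<Delta>t) ^ n" .
      also have "\<dots> \<le> A0 * exp (2 * C * \<Delta>t) ^ n"
        using assms dt by (intro mult_left_mono power_mono exp_ge_add_one_self) auto
      also have "\<dots> = A0 * exp (2 * C * (real n * \<Delta>t))" by (simp add: exp_of_nat_mult[symmetric] mult_ac)
      also have "\<dots> \<le> M1"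
      proof -
        have "real n * \<Delta>t \<le> real N * \<Delta>t" using n dt by (intro mult_right_mono) auto
        then have "real n * \<Delta>t \<le> T" using N by simp
        then show ?thesis using assms by (auto simp: M1_def intro!: mult_left_mono)
      qed
      finally show ?thesis by (simp add: M_def)
    next
      case False
      have "real N \<le> real N * (\<Delta>t * M1\<^sup>2)" using False by (simp add: mult_le_cancel_left1)
      also have "\<dots> \<le> T * M1\<^sup>2" using mult_right_mono[OF N, of "M1\<^sup>2"] by (simp add: mult_ac)
      finally have "N \<le> m" unfolding m_def by linarith
      have "a k \<le> A0 * K ^ k" if "k \<le> N" for k
        using that
      proof (induction k)
        case 0 then show ?case using a0 by simp
      next
        case (Suc k)
        then have "a (Suc k) \<le> K * a k" using step by simp
        also have "\<dots> \<le> K * (A0 * K ^ k)" using Suc assms by (intro mult_left_mono) auto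
        finally show ?case by (simp add: mult_ac)
      qed
      from this[OF n] have "a n \<le> A0 * K ^ n" .
      also have "\<dots> \<le> A0 * K ^ m" using n \<open>N \<le> m\<close> assms by (intro mult_left_mono power_increasing) auto
      finally show ?thesis by (simp add: M_def)
    qed
  qed
qed

section \<open>Growth over one step\<close>

lemma norm_Hforce_le:
  assumes "norm (E t x) \<le> B" "norm (grad_perp (\<lambda>y. ln (b t y)) x) \<le> B" "\<bar>chi e w\<bar> \<le> \<bar>e\<bar>"
  shows "norm (Hforce E b chi t x w e) \<le> B * (1 + \<bar>e\<bar>)"
proof -
  have "norm (Hforce E b chi t x w e) \<le> norm (E t x) + norm (chi e w *\<^sub>R grad_perp (\<lambda>y. ln (b t y)) x)"
    unfolding Hforce_def by (rule norm_triangle_ineq4)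
  also have "\<dots> \<le> B + \<bar>e\<bar> * B"
    unfolding norm_scaleR using assms by (intro add_mono mult_mono) auto
  finally show ?thesis by (simp add: algebra_simps)
qed

lemma Hforce_3: "Hforce E b chi t x w e $ 3 = E t x $ 3"
  by (simp add: Hforce_def grad_perp_def)

text \<open>The components along and across the field are added rather than combined in a Euclidean norm, because
  only the latter is amplified. The summand 1 absorbs inhomogeneous terms, so that all forces
  are bounded by a multiple of this size.\<close>
definition state_size :: "real^3 \<Rightarrow> real \<Rightarrow> real" where
  "state_size v e = 1 + norm (perp v) + \<bar>v $ 3\<bar> + \<bar>e\<bar>"

lemma state_size_ge: "state_size v e \<ge> 1" "norm v \<le> state_size v e" "\<bar>e\<bar> \<le> state_size v e"
  using norm_perp_parallel[of v] by (auto simp: state_size_def)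

context gyro_fields
begin

text \<open>All forces are bounded by a multiple of the size \<open>a\<close> of the state, as \<open>\<chi>\<close> is bounded by the energy. This
  contributes \<open>C * \<Delta>t\<close> to the growth rate. The quadratic contribution is the excess of the amplification
  factor over 1: the intensities at the two stages differ by \<open>O(\<Delta>t * a)\<close>, since the position moves with
  a velocity of size \<open>O(a)\<close>.\<close>
lemma schemeS_step_growth:
  assumes chi: "\<And>s w. \<bar>chi s (perp w)\<bar> \<le> \<bar>s\<bar>"
  shows "\<exists>C\<ge>1. \<forall>\<epsilon> \<Delta>t t x v e v1 xh eh vh x' v' e'.
     \<epsilon> > 0 \<and> 0 < \<Delta>t \<and> \<Delta>t \<le> T \<and> t \<in> time_range \<and> t + \<Delta>t / (2 * \<gamma>) \<in> time_range \<and>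
     schemeS_step E b chi \<epsilon> \<Delta>t t x v e v1 xh eh vh x' v' e' \<longrightarrow>
     norm v1 \<le> C * state_size v e \<and> norm v' \<le> C * state_size v e \<and> \<bar>eh\<bar> \<le> C * state_size v e \<and>
     state_size v' e' \<le> C * state_size v e \<and>
     state_size v' e' \<le> (1 + C * \<Delta>t + C * (\<Delta>t * state_size v e)\<^sup>2) * state_size v e"
proof -
  obtain B where B: "B \<ge> 1" and FB: "\<And>t y. t \<in> time_range \<Longrightarrow> norm (E t y) \<le> B \<and> b0 \<le> b t y \<and> b t y \<le> B \<and>
      norm (grad_perp (\<lambda>z. ln (b t z)) y) \<le> B" and
    bL: "\<And>t y s z. t \<in> time_range \<Longrightarrow> s \<in> time_range \<Longrightarrow> \<bar>b s z - b t y\<bar> \<le> B * (\<bar>s - t\<bar> + norm (z - y))"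
    using field_bounds by (elim exE conjE) blast
  define c1 where "c1 = 1 + 2 * T * B"
  define c2 where "c2 = 1 + 2 * T * B * c1"
  define c4 where "c4 = 4 + c2"
  define c3 where "c3 = 4 + T * B * (2 * c4)"
  define r where "r = (2 * B\<^sup>2 * (1 + c1) / b0\<^sup>2)\<^sup>2"
  define c5 where "c5 = B * c4 + B * c4 + B * (c1 + c3)"
  define C where "C = max (max c1 c3) (max c2 (max (c5 + r) (2 + c5 * T)))"
  have c: "c1 \<ge> 1" "c2 \<ge> 1" "c4 \<ge> 1" "c3 \<ge> 1" "r \<ge> 0" "c5 \<ge> 0"
  proof -
    show 1: "c1 \<ge> 1" using B T_pos by (simp add: c1_def)
    show 2: "c2 \<ge> 1" using B T_pos 1 by (simp add: c2_def)
    show 3: "c4 \<ge> 1" using 2 by (simp add: c4_def)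
    have "T * B * (2 * c4) \<ge> 0" using B T_pos 3 by simp
    then show 4: "c3 \<ge> 1" by (simp add: c3_def)
    show "r \<ge> 0" by (simp add: r_def)
    show "c5 \<ge> 0" using B 1 3 4 by (simp add: c5_def)
  qed
  have Cle: "c1 \<le> C" "c3 \<le> C" "c2 \<le> C" "c5 + r \<le> C" "2 + c5 * T \<le> C" by (auto simp: C_def)
  show ?thesis
  proof (rule exI[of _ C], rule conjI)
    show "C \<ge> 1" using c Cle by simp
  next
    show "\<forall>\<epsilon> \<Delta>t t x v e v1 xh eh vh x' v' e'.
     \<epsilon> > 0 \<and> 0 < \<Delta>t \<and> \<Delta>t \<le> T \<and> t \<in> time_range \<and> t + \<Delta>t / (2 * \<gamma>) \<in> time_range \<and>
     schemeS_step E b chi \<epsilon> \<Delta>t t x v e v1 xh eh vh x' v' e' \<longrightarrow>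
     norm v1 \<le> C * state_size v e \<and> norm v' \<le> C * state_size v e \<and> \<bar>eh\<bar> \<le> C * state_size v e \<and>
     state_size v' e' \<le> C * state_size v e \<and>
     state_size v' e' \<le> (1 + C * \<Delta>t + C * (\<Delta>t * state_size v e)\<^sup>2) * state_size v e"
  proof (intro allI impI, goal_cases)
    case (1 \<epsilon> \<Delta>t t x v e v1 xh eh vh x' v' e')
    then have \<epsilon>: "\<epsilon> > 0" and dt: "0 < \<Delta>t" "\<Delta>t \<le> T" and t: "t \<in> time_range" "t + \<Delta>t / (2 * \<gamma>) \<in> time_range"
      and S: "schemeS_step E b chi \<epsilon> \<Delta>t t x v e v1 xh eh vh x' v' e'" by auto
    define th where "th = t + \<Delta>t / (2 * \<gamma>)"
    define a where "a = state_size v e"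
    have a: "a \<ge> 1" "1 + \<bar>e\<bar> \<le> a" "a = 1 + norm (perp v) + \<bar>v $ 3\<bar> + \<bar>e\<bar>"
      by (auto simp: a_def state_size_def)
    have th: "th \<in> time_range" using t by (simp add: th_def)
    define H1 where "H1 = Hforce E b chi t x (perp v) e"
    define H2 where "H2 = Hforce E b chi th xh (perp vh) eh"
    obtain F1 F2 where F1: "F1 = H1 - (b t x / \<epsilon>) *\<^sub>R rot v1"
      and F2: "F2 = H2 - (b th xh / \<epsilon>) *\<^sub>R rot v'"
      and v1: "v1 = v + (\<Delta>t * \<gamma>) *\<^sub>R F1"
      and xh: "xh = x + (\<Delta>t * (1 / (2 * \<gamma>))) *\<^sub>R v1"
      and eh: "eh = e + \<Delta>t * (1 / (2 * \<gamma>)) * (perp (E t x) \<bullet> perp v1)"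
      and v': "v' = v + \<Delta>t *\<^sub>R ((1 - \<gamma>) *\<^sub>R F1 + \<gamma> *\<^sub>R F2)"
      and e': "e' = e + \<Delta>t * ((1 - \<gamma>) * (perp (E t x) \<bullet> perp v1) + \<gamma> * (perp (E th xh) \<bullet> perp v'))"
      using schemeS_stepD[OF S dt(1)] unfolding H1_def H2_def th_def by metis
    define \<mu>1 where "\<mu>1 = (\<Delta>t * \<gamma> / \<epsilon>) * b t x"
    define \<mu>2 where "\<mu>2 = (\<Delta>t * \<gamma> / \<epsilon>) * b th xh"
    define h1 where "h1 = (\<Delta>t * \<gamma>) *\<^sub>R H1"
    define h2 where "h2 = (\<Delta>t * \<gamma>) *\<^sub>R (sqrt 2 *\<^sub>R H1 + H2)"
    have P: "v1 + \<mu>1 *\<^sub>R rot v1 = v + h1"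
      by (subst v1) (simp add: F1 h1_def \<mu>1_def algebra_simps)
    have g: "\<gamma> > 0" "\<gamma> \<le> 1" using \<gamma>_bounds by auto
    \<comment> \<open>eliminates the initial velocity, using \<open>1 - \<gamma> = (1 + sqrt 2) * \<gamma>\<close>\<close>
    have Q: "v' + \<mu>2 *\<^sub>R rot v' = v1 - (sqrt 2 * \<mu>1) *\<^sub>R rot v1 + h2"
    proof -
      have "v' = v + (\<Delta>t * \<gamma>) *\<^sub>R ((1 + sqrt 2) *\<^sub>R F1 + F2)"
        unfolding v' \<gamma>_ratio by (simp add: algebra_simps)
      also have "\<dots> = v1 + (\<Delta>t * \<gamma>) *\<^sub>R (sqrt 2 *\<^sub>R F1 + F2)"
        by (subst v1) (simp add: algebra_simps)
      finally have "v' = v1 + (\<Delta>t * \<gamma>) *\<^sub>R (sqrt 2 *\<^sub>R F1 + F2)" .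
      then have "v' + \<mu>2 *\<^sub>R rot v' = v1 + (\<Delta>t * \<gamma>) *\<^sub>R (sqrt 2 *\<^sub>R F1 + F2) + \<mu>2 *\<^sub>R rot v'"
        by simp
      then show ?thesis
        by (simp add: F1 F2 h2_def \<mu>1_def \<mu>2_def algebra_simps)
    qed
    have B0: "0 \<le> B" using B by simp
    have nH1: "norm H1 \<le> B * a"
    proof -
      have "norm H1 \<le> B * (1 + \<bar>e\<bar>)" unfolding H1_def by (rule norm_Hforce_le) (use FB[OF t(1)] chi in auto)
      also have "\<dots> \<le> B * a" using a B by (intro mult_left_mono) auto
      finally show ?thesis .
    qed
    have scaled: "norm ((\<Delta>t * \<gamma>) *\<^sub>R w) \<le> \<Delta>t * norm w" for w :: "real^3"
      using g dt mult_right_mono[of "\<Delta>t * \<gamma>" "\<Delta>t" "norm w"] by (simp add: mult_left_le)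
    have nh1: "norm h1 \<le> \<Delta>t * (B * a)"
    proof -
      have "norm h1 \<le> \<Delta>t * norm H1" unfolding h1_def by (rule scaled)
      also have "\<dots> \<le> \<Delta>t * (B * a)" using nH1 dt by (intro mult_left_mono) auto
      finally show ?thesis .
    qed
    have dTBa: "\<Delta>t * (B * a) \<le> T * (B * a)" using dt B a by (intro mult_right_mono) auto
    have nv1: "norm v1 \<le> c1 * a"
    proof -
      have 3: "v1 $ 3 = v $ 3 + h1 $ 3"
        using arg_cong[OF P, of "\<lambda>w. w $ 3"] by (simp add: rot_perp_components)
      have "\<bar>v1 $ 3\<bar> \<le> \<bar>v $ 3\<bar> + norm h1" unfolding 3 using component_le_norm_cart[of h1 3] by linarith
      then have "norm v1 \<le> norm (perp v) + \<bar>v $ 3\<bar> + 2 * norm h1"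
        using norm_perp_parallel[of v1] perp_velocity_step(1)[OF P Q] by linarith
      also have "\<dots> \<le> a + 2 * (T * (B * a))" using nh1 dTBa a by linarith
      finally show ?thesis by (simp add: c1_def algebra_simps)
    qed
    have inner: "\<bar>perp (E s y) \<bullet> perp w\<bar> \<le> B * norm w" if "s \<in> time_range" for s y w
    proof -
      have "\<bar>perp (E s y) \<bullet> perp w\<bar> \<le> norm (perp (E s y)) * norm (perp w)" by (rule Cauchy_Schwarz_ineq2)
      also have "\<dots> \<le> B * norm w"
        using FB[OF that, of y] norm_perp_le[of "E s y"] norm_perp_le[of w] B by (intro mult_mono) auto
      finally show ?thesis .
    qed
    have hg: "1 / (2 * \<gamma>) \<le> 2" "1 / (2 * \<gamma>) > 0" by (rule half_\<gamma>_le)+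
    have hdt: "\<Delta>t * (1 / (2 * \<gamma>)) \<le> \<Delta>t * 2" "\<Delta>t * (1 / (2 * \<gamma>)) \<ge> 0"
      using hg dt by (auto intro!: mult_left_mono simp del: times_divide_eq_right)
    have i1: "\<bar>perp (E t x) \<bullet> perp v1\<bar> \<le> B * (c1 * a)"
      using inner[OF t(1), of x v1] mult_left_mono[OF nv1 B0] by linarith
    have neh: "1 + \<bar>eh\<bar> \<le> c2 * a"
    proof -
      have "\<bar>\<Delta>t * (1 / (2 * \<gamma>)) * (perp (E t x) \<bullet> perp v1)\<bar> \<le> (\<Delta>t * 2) * (B * (c1 * a))"
        unfolding abs_mult[of "\<Delta>t * (1 / (2 * \<gamma>))"] using i1 hdt by (intro mult_mono) auto
      also have "\<dots> \<le> (T * 2) * (B * (c1 * a))" using dt B c a by (intro mult_right_mono) auto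
      finally have "1 + \<bar>eh\<bar> \<le> a + (T * 2) * (B * (c1 * a))" unfolding eh using a(2) by linarith
      then show ?thesis by (simp add: c2_def algebra_simps)
    qed
    have nH2: "norm H2 \<le> B * (c2 * a)"
    proof -
      have "norm H2 \<le> B * (1 + \<bar>eh\<bar>)" unfolding H2_def by (rule norm_Hforce_le) (use FB[OF th] chi in auto)
      also have "\<dots> \<le> B * (c2 * a)" using neh B by (intro mult_left_mono) auto
      finally show ?thesis .
    qed
    have Ba: "B * a \<ge> 0" using B a by simp
    have nh2: "norm h2 \<le> \<Delta>t * (B * ((2 + c2) * a))"
    proof -
      have s2: "sqrt 2 \<le> 2" by (rule real_le_lsqrt) auto
      have "norm (sqrt 2 *\<^sub>R H1 + H2) \<le> sqrt 2 * norm H1 + norm H2"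
        by (rule order_trans[OF norm_triangle_ineq]) simp
      also have "\<dots> \<le> 2 * (B * a) + B * (c2 * a)"
        using nH1 nH2 s2 Ba by (intro add_mono mult_mono) auto
      finally have "norm (sqrt 2 *\<^sub>R H1 + H2) \<le> B * ((2 + c2) * a)" by (simp add: algebra_simps)
      then have "\<Delta>t * norm (sqrt 2 *\<^sub>R H1 + H2) \<le> \<Delta>t * (B * ((2 + c2) * a))" using dt by (intro mult_left_mono) auto
      then show ?thesis unfolding h2_def using scaled[of "sqrt 2 *\<^sub>R H1 + H2"] by linarith
    qed
    define \<rho> where "\<rho> = sqrt ((1 + 2 * \<mu>1\<^sup>2) / ((1 + \<mu>1\<^sup>2) * (1 + \<mu>2\<^sup>2)))"
    have bt: "b0 \<le> b t x" "b t x \<le> B" "b0 \<le> b th xh" "b th xh \<le> B" using FB t(1) th by auto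
    have \<rho>: "\<rho> \<le> 2" "\<rho> \<le> 1 + (B * \<bar>b t x - b th xh\<bar> / b0\<^sup>2)\<^sup>2" "\<rho> \<ge> 0"
      unfolding \<rho>_def \<mu>1_def \<mu>2_def
      using amplification_le[OF b0_pos bt(1,3,2,4), of "\<Delta>t * \<gamma> / \<epsilon>"] by auto
    have bdiff: "\<bar>b t x - b th xh\<bar> \<le> 2 * B * (1 + c1) * (\<Delta>t * a)"
    proof -
      have "\<bar>b t x - b th xh\<bar> \<le> B * (\<bar>t - th\<bar> + norm (x - xh))" by (rule bL) (use t th in auto)
      also have "\<bar>t - th\<bar> = \<Delta>t * (1 / (2 * \<gamma>))" using dt g by (simp add: th_def abs_mult)
      also have "norm (x - xh) = \<Delta>t * (1 / (2 * \<gamma>)) * norm v1"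
        using dt g by (simp add: xh abs_mult)
      also have "\<Delta>t * (1 / (2 * \<gamma>)) + \<Delta>t * (1 / (2 * \<gamma>)) * norm v1 = (\<Delta>t * (1 / (2 * \<gamma>))) * (1 + norm v1)"
        by (simp only: distrib_left mult_1_right)
      also have "B * \<dots> \<le> B * ((\<Delta>t * 2) * (a + c1 * a))"
      proof (rule mult_left_mono[OF _ B0], rule mult_mono)
        show "1 + norm v1 \<le> a + c1 * a" using nv1 a(1) by linarith
      qed (use hdt dt in auto)
      finally show ?thesis by (simp add: algebra_simps)
    qed
    have \<rho>1: "\<rho> \<le> 1 + r * (\<Delta>t * a)\<^sup>2"
    proof -
      have "B * \<bar>b t x - b th xh\<bar> / b0\<^sup>2 \<le> B * (2 * B * (1 + c1) * (\<Delta>t * a)) / b0\<^sup>2"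
        using bdiff B by (intro divide_right_mono mult_left_mono) auto
      also have "\<dots> = (2 * B\<^sup>2 * (1 + c1) / b0\<^sup>2) * (\<Delta>t * a)" by (simp add: power2_eq_square)
      finally have "(B * \<bar>b t x - b th xh\<bar> / b0\<^sup>2)\<^sup>2 \<le> ((2 * B\<^sup>2 * (1 + c1) / b0\<^sup>2) * (\<Delta>t * a))\<^sup>2"
        using B by (intro power_mono) auto
      also have "\<dots> = r * (\<Delta>t * a)\<^sup>2" by (simp only: power_mult_distrib r_def)
      finally show ?thesis using \<rho>(2) by linarith
    qed
    have perp': "norm (perp v') \<le> \<rho> * norm (perp v) + \<Delta>t * (B * (c4 * a))"
    proof -
      have "norm (perp v') \<le> \<rho> * (norm (perp v) + norm h1) + norm h2"
        unfolding \<rho>_def by (rule perp_velocity_step(2)[OF P Q])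
      also have "\<rho> * (norm (perp v) + norm h1) = \<rho> * norm (perp v) + \<rho> * norm h1" by (simp add: algebra_simps)
      finally have "norm (perp v') \<le> \<rho> * norm (perp v) + 2 * (\<Delta>t * (B * a)) + \<Delta>t * (B * ((2 + c2) * a))"
        using nh2 mult_mono[OF \<rho>(1) nh1] norm_ge_zero[of h1] by linarith
      then show ?thesis by (simp add: c4_def algebra_simps)
    qed
    have v'3: "\<bar>v' $ 3\<bar> \<le> \<bar>v $ 3\<bar> + \<Delta>t * (B * (c4 * a))"
    proof -
      have "v' $ 3 = v1 $ 3 + h2 $ 3"
        using arg_cong[OF Q, of "\<lambda>w. w $ 3"] by (simp add: rot_perp_components)
      moreover have "v1 $ 3 = v $ 3 + h1 $ 3"
        using arg_cong[OF P, of "\<lambda>w. w $ 3"] by (simp add: rot_perp_components)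
      ultimately have "\<bar>v' $ 3\<bar> \<le> \<bar>v $ 3\<bar> + norm h1 + norm h2"
        using component_le_norm_cart[of h1 3] component_le_norm_cart[of h2 3] by linarith
      then have "\<bar>v' $ 3\<bar> \<le> \<bar>v $ 3\<bar> + \<Delta>t * (B * a) + \<Delta>t * (B * ((2 + c2) * a)) + \<Delta>t * (B * a)"
        using nh1 nh2 norm_ge_zero[of h1] by linarith
      then show ?thesis by (simp add: c4_def algebra_simps)
    qed
    have nv': "norm v' \<le> c3 * a"
    proof -
      have "\<rho> * norm (perp v) \<le> 2 * norm (perp v)" using \<rho> by (intro mult_right_mono) auto
      moreover have "\<Delta>t * (B * (c4 * a)) \<le> T * (B * (c4 * a))" using dt B c a by (intro mult_right_mono) auto
      ultimately have "norm v' \<le> 4 * a + 2 * (T * (B * (c4 * a)))"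
        using norm_perp_parallel[of v'] perp' v'3 a(3) norm_ge_zero[of "perp v"] abs_ge_zero[of e] by linarith
      then show ?thesis by (simp add: c3_def algebra_simps)
    qed
    have e'_le: "\<bar>e'\<bar> \<le> \<bar>e\<bar> + \<Delta>t * (B * ((c1 + c3) * a))"
    proof -
      have i2: "\<bar>perp (E th xh) \<bullet> perp v'\<bar> \<le> B * (c3 * a)"
        using inner[OF th, of xh v'] mult_left_mono[OF nv' B0] by linarith
      have "\<bar>(1 - \<gamma>) * (perp (E t x) \<bullet> perp v1)\<bar> \<le> 1 * (B * (c1 * a))"
        unfolding abs_mult using g i1 by (intro mult_mono) auto
      moreover have "\<bar>\<gamma> * (perp (E th xh) \<bullet> perp v')\<bar> \<le> 1 * (B * (c3 * a))"
        unfolding abs_mult using g i2 by (intro mult_mono) auto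
      ultimately have "\<bar>(1 - \<gamma>) * (perp (E t x) \<bullet> perp v1) + \<gamma> * (perp (E th xh) \<bullet> perp v')\<bar> \<le> B * ((c1 + c3) * a)"
        by (simp add: algebra_simps)
      then have "\<Delta>t * \<bar>(1 - \<gamma>) * (perp (E t x) \<bullet> perp v1) + \<gamma> * (perp (E th xh) \<bullet> perp v')\<bar> \<le> \<Delta>t * (B * ((c1 + c3) * a))"
        using dt by (intro mult_left_mono) auto
      then have "\<bar>\<Delta>t * ((1 - \<gamma>) * (perp (E t x) \<bullet> perp v1) + \<gamma> * (perp (E th xh) \<bullet> perp v'))\<bar> \<le> \<Delta>t * (B * ((c1 + c3) * a))"
        using dt by (simp add: abs_mult)
      then show ?thesis unfolding e' by linarith
    qed
    have sum: "state_size v' e' \<le> 1 + \<rho> * norm (perp v) + \<bar>v $ 3\<bar> + \<bar>e\<bar> + \<Delta>t * (c5 * a)"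
      using perp' v'3 e'_le by (simp add: state_size_def c5_def algebra_simps)
    have g1: "state_size v' e' \<le> (2 + c5 * T) * a"
    proof -
      have "\<rho> * norm (perp v) \<le> 2 * norm (perp v)" using \<rho> by (intro mult_right_mono) auto
      moreover have "\<Delta>t * (c5 * a) \<le> T * (c5 * a)" using dt c a by (intro mult_right_mono) auto
      ultimately have "state_size v' e' \<le> 2 * a + T * (c5 * a)"
        using sum a(3) abs_ge_zero[of e] abs_ge_zero[of "v $ 3"] by linarith
      then show ?thesis by (simp add: algebra_simps)
    qed
    have g2: "state_size v' e' \<le> (1 + C * \<Delta>t + C * (\<Delta>t * a)\<^sup>2) * a"
    proof -
      have "\<rho> * norm (perp v) \<le> (1 + r * (\<Delta>t * a)\<^sup>2) * norm (perp v)" using \<rho>1 by (intro mult_right_mono) auto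
      also have "\<dots> = norm (perp v) + r * (\<Delta>t * a)\<^sup>2 * norm (perp v)" by (simp add: algebra_simps)
      also have "r * (\<Delta>t * a)\<^sup>2 * norm (perp v) \<le> r * (\<Delta>t * a)\<^sup>2 * a"
        using c a(3) by (intro mult_left_mono) auto
      finally have "state_size v' e' \<le> a + r * (\<Delta>t * a)\<^sup>2 * a + \<Delta>t * (c5 * a)" using sum a(3) by linarith
      also have "\<dots> = (1 + c5 * \<Delta>t + r * (\<Delta>t * a)\<^sup>2) * a" by (simp add: algebra_simps)
      also have "\<dots> \<le> (1 + C * \<Delta>t + C * (\<Delta>t * a)\<^sup>2) * a"
        using Cle c dt a by (intro mult_right_mono add_mono) auto
      finally show ?thesis .
    qed
    have mono: "s * a \<le> C * a" if "s \<le> C" for s using that a by (intro mult_right_mono) auto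
    show ?case
      unfolding a_def[symmetric]
      using order_trans[OF nv1 mono[OF Cle(1)]] order_trans[OF nv' mono[OF Cle(2)]]
        neh mono[OF Cle(3)] order_trans[OF g1 mono[OF Cle(5)]] g2 by simp
  qed
  qed
qed

end

context gyro_fields
begin

section \<open>Slaving of the velocity to the guiding centre velocity\<close>

text \<open>Solving the velocity equation for the stiff term expresses the velocity across the field by the
  forces. If \<open>F\<close> vanished and \<open>\<chi>\<close> returned the energy \<open>e\<close>, the velocity would be exactly the
  guiding centre velocity. The second part uses that the power of the electric field along the guiding
  centre velocity is \<open>\<epsilon> * e * divF E b t x\<close>: the drift along \<open>rot E\<close> does no work, and the remaining
  drift along the rotated gradient of \<open>b\<close> reproduces the explicit divergence.\<close>

lemma slaving_identity:
  assumes t: "t \<in> time_range" and \<epsilon>: "\<epsilon> > 0"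
    and F: "F = Hforce E b chi t x w e - (b t x / \<epsilon>) *\<^sub>R rot V"
  shows "V - Ugc E b \<epsilon> t x e (V $ 3) =
      (\<epsilon> / b t x) *\<^sub>R (rot F + (chi e w - e) *\<^sub>R rot (grad_perp (\<lambda>y. ln (b t y)) x))" (is "?lhs = ?rhs")
    and "perp (E t x) \<bullet> perp V - \<epsilon> * e * divF E b t x = perp (E t x) \<bullet> perp (V - Ugc E b \<epsilon> t x e (V $ 3))"
proof -
  have bp: "b t x > 0" by (rule b_pos[OF t])
  show "?lhs = ?rhs"
    using \<epsilon> bp
    by (simp add: F vec3_eq_iff Ugc_def Hforce_def Fdrift_def grad_perp_ln[OF t] ez_def rot_perp_components grad_perp_def axis_def
        field_simps power2_eq_square)
  have "perp (E t x) \<bullet> perp (Ugc E b \<epsilon> t x e (V $ 3)) = \<epsilon> * e * divF E b t x"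
    using \<epsilon> bp
    by (simp add: divF_eq[OF t] inner_vec_def sum_3 Ugc_def Fdrift_def ez_def rot_perp_components grad_perp_def axis_def
        field_simps power2_eq_square)
  then show "perp (E t x) \<bullet> perp V - \<epsilon> * e * divF E b t x = perp (E t x) \<bullet> perp (V - Ugc E b \<epsilon> t x e (V $ 3))"
    by (simp add: linear_diff[OF linear_perp] inner_diff_right)
qed

lemma fast_velocity_small:
  assumes t: "t \<in> time_range" and \<epsilon>: "\<epsilon> > 0"
    and F: "F = H - (b t x / \<epsilon>) *\<^sub>R rot V"
  shows "norm (perp V) \<le> \<epsilon> * ((norm F + norm H) / b0)"
proof -
  have bp: "b t x > 0" by (rule b_pos[OF t])
  have "rot V = (\<epsilon> / b t x) *\<^sub>R (H - F)"
    using \<epsilon> bp by (simp add: F)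
  then have "norm (perp V) = (\<epsilon> / b t x) * norm (H - F)"
    using \<epsilon> bp by (metis abs_of_pos divide_pos_pos norm_rot norm_scaleR)
  also have "\<dots> \<le> (\<epsilon> / b0) * (norm F + norm H)"
    using \<epsilon> b0_pos b_ge[OF t, of x] norm_triangle_ineq4[of H F] by (intro mult_mono frac_le) auto
  finally show ?thesis by simp
qed

text \<open>Each of the two deviations is \<open>O(\<epsilon>)\<close>, and the factor \<open>\<epsilon> / b\<close> in front supplies the second power.\<close>
lemma slaving_estimate:
  assumes t: "t \<in> time_range" and \<epsilon>: "\<epsilon> > 0"
    and F: "F = Hforce E b chi t x w e - (b t x / \<epsilon>) *\<^sub>R rot V"
    and B: "B \<ge> 1" "norm (E t x) \<le> B" "norm (grad_perp (\<lambda>y. ln (b t y)) x) \<le> B"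
    and small: "norm (perp F) \<le> k * \<epsilon>" "\<bar>chi e w - e\<bar> \<le> l * \<epsilon>"
  shows "norm (V - Ugc E b \<epsilon> t x e (V $ 3)) \<le> (k + l * B) / b0 * \<epsilon>\<^sup>2"
    and "\<bar>perp (E t x) \<bullet> perp V - \<epsilon> * e * divF E b t x\<bar> \<le> B * ((k + l * B) / b0 * \<epsilon>\<^sup>2)"
proof -
  let ?G = "grad_perp (\<lambda>y. ln (b t y)) x"
  have "norm (rot F + (chi e w - e) *\<^sub>R rot ?G) \<le> norm (rot F) + norm ((chi e w - e) *\<^sub>R rot ?G)"
    by (rule norm_triangle_ineq)
  also have "\<dots> \<le> k * \<epsilon> + (l * \<epsilon>) * B"
  proof (rule add_mono)
    show "norm (rot F) \<le> k * \<epsilon>" using small by (simp add: norm_rot)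
    show "norm ((chi e w - e) *\<^sub>R rot ?G) \<le> (l * \<epsilon>) * B"
      unfolding norm_scaleR norm_rot using small(2) B norm_perp_le[of ?G] by (intro mult_mono) auto
  qed
  finally have 1: "norm (rot F + (chi e w - e) *\<^sub>R rot ?G) \<le> (k + l * B) * \<epsilon>" by (simp add: algebra_simps)
  have "norm (V - Ugc E b \<epsilon> t x e (V $ 3)) = (\<epsilon> / b t x) * norm (rot F + (chi e w - e) *\<^sub>R rot ?G)"
    unfolding slaving_identity(1)[OF t \<epsilon> F] using \<epsilon> b_pos[OF t, of x] by simp
  also have "\<dots> \<le> (\<epsilon> / b0) * ((k + l * B) * \<epsilon>)"
    by (rule mult_mono) (use 1 \<epsilon> b_ge[OF t, of x] b0_pos in \<open>auto intro: frac_le\<close>)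
  finally show 2: "norm (V - Ugc E b \<epsilon> t x e (V $ 3)) \<le> (k + l * B) / b0 * \<epsilon>\<^sup>2"
    by (simp add: power2_eq_square mult_ac)
  let ?W = "V - Ugc E b \<epsilon> t x e (V $ 3)"
  have "\<bar>perp (E t x) \<bullet> perp V - \<epsilon> * e * divF E b t x\<bar> \<le> norm (perp (E t x)) * norm (perp ?W)"
    unfolding slaving_identity(2)[OF t \<epsilon> F] by (rule Cauchy_Schwarz_ineq2)
  also have "\<dots> \<le> B * ((k + l * B) / b0 * \<epsilon>\<^sup>2)"
    using B 2 norm_perp_le[of ?W] norm_perp_le[of "E t x"] by (intro mult_mono) auto
  finally show "\<bar>perp (E t x) \<bullet> perp V - \<epsilon> * e * divF E b t x\<bar> \<le> B * ((k + l * B) / b0 * \<epsilon>\<^sup>2)" .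
qed

end

section \<open>Uniform bounds and consistency of the semi-implicit scheme\<close>

locale semi_implicit_run = gyro_fields +
  fixes chi :: "real \<Rightarrow> real^3 \<Rightarrow> real" and x0 v0 :: "real \<Rightarrow> real^3" and e0 :: "real \<Rightarrow> real"
    and x v v1 xh vh :: "real \<Rightarrow> real \<Rightarrow> nat \<Rightarrow> real^3" and e eh :: "real \<Rightarrow> real \<Rightarrow> nat \<Rightarrow> real"
  assumes chi_regular: "W_inf_loc 1 (\<lambda>(s, w). chi s w)"
    and chi_zero: "\<And>s. s \<ge> 0 \<Longrightarrow> chi s 0 = s"
    and chi_bounds: "\<And>s w. s \<ge> 0 \<Longrightarrow> 0 \<le> chi s (perp w) \<and> chi s (perp w) \<le> s"
    and chi_negative: "\<And>s w. s < 0 \<Longrightarrow> \<bar>chi s (perp w)\<bar> \<le> \<bar>s\<bar>"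
    and energy_range: "(\<forall>s<0. chi s 0 = s) \<or> (\<forall>\<epsilon>>0. e0 \<epsilon> \<ge> 0)"
    and initial_bounded: "\<exists>M. \<forall>\<epsilon>>0. norm (x0 \<epsilon>) \<le> M \<and> norm (v0 \<epsilon>) \<le> M \<and> \<bar>e0 \<epsilon>\<bar> \<le> M"
    and initial: "\<And>\<Delta>t \<epsilon>. \<Delta>t > 0 \<Longrightarrow> \<epsilon> > 0 \<Longrightarrow>
          x \<Delta>t \<epsilon> 0 = x0 \<epsilon> \<and> v \<Delta>t \<epsilon> 0 = v0 \<epsilon> \<and> e \<Delta>t \<epsilon> 0 = e0 \<epsilon>"
    and scheme: "\<And>\<Delta>t \<epsilon> n. \<Delta>t > 0 \<Longrightarrow> \<epsilon> > 0 \<Longrightarrow> n < num_steps T \<Delta>t \<Longrightarrow>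
          schemeS_step E b chi \<epsilon> \<Delta>t (real n * \<Delta>t)
            (x \<Delta>t \<epsilon> n) (v \<Delta>t \<epsilon> n) (e \<Delta>t \<epsilon> n)
            (v1 \<Delta>t \<epsilon> n) (xh \<Delta>t \<epsilon> n) (eh \<Delta>t \<epsilon> n) (vh \<Delta>t \<epsilon> n)
            (x \<Delta>t \<epsilon> (Suc n)) (v \<Delta>t \<epsilon> (Suc n)) (e \<Delta>t \<epsilon> (Suc n))"
begin

lemma chi_le: "\<bar>chi s (perp w)\<bar> \<le> \<bar>s\<bar>"
  using chi_bounds[of s w] chi_negative[of s w] by (cases "s \<ge> 0") auto

lemma chi_lipschitz:
  "\<exists>L\<ge>0. \<forall>s w. \<bar>s\<bar> \<le> R \<longrightarrow> norm w \<le> R \<longrightarrow> \<bar>chi s w - chi s 0\<bar> \<le> L * norm w"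
proof (cases "R \<ge> 0")
  case True
  have "W_inf (Suc 0) (ball 0 (2 * R + 1)) (\<lambda>(s, w). chi s w)"
    using chi_regular True by (simp add: W_inf_loc_def)
  from W_inf_1_lipschitz[OF open_ball convex_ball this]
  obtain L where L: "L \<ge> 0" "\<And>p q. p \<in> closure (ball 0 (2 * R + 1)) \<Longrightarrow> q \<in> closure (ball 0 (2 * R + 1)) \<Longrightarrow>
      \<bar>(\<lambda>(s, w). chi s w) q - (\<lambda>(s, w). chi s w) p\<bar> \<le> L * norm (q - p)" by blast
  have "\<bar>chi s w - chi s 0\<bar> \<le> L * norm w" if "\<bar>s\<bar> \<le> R" "norm w \<le> R" for s w
  proof -
    have mem: "(s, u) \<in> closure (ball 0 (2 * R + 1))" if "norm u \<le> R" for u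
    proof -
      have "norm (s, u) \<le> \<bar>s\<bar> + norm u" using norm_Pair_le[of s u] by simp
      then have "(s, u) \<in> ball 0 (2 * R + 1)" using that \<open>\<bar>s\<bar> \<le> R\<close> by simp
      then show ?thesis using closure_subset by blast
    qed
    show ?thesis using L(2)[OF mem[of 0] mem[OF that(2)]] True by (simp add: norm_Pair)
  qed
  then show ?thesis using L(1) by blast
next
  case False
  then show ?thesis by (intro exI[of _ 0]) auto
qed

lemma uniform_bounds:
  "\<exists>C\<ge>0. \<forall>\<Delta>t>0. \<forall>\<epsilon>>0. (\<forall>n\<le>num_steps T \<Delta>t.
        norm (x \<Delta>t \<epsilon> n) \<le> C \<and> norm (v \<Delta>t \<epsilon> n) \<le> C \<and> \<bar>e \<Delta>t \<epsilon> n\<bar> \<le> C) \<and>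
     (\<forall>n<num_steps T \<Delta>t. norm (v1 \<Delta>t \<epsilon> n) \<le> C \<and> \<bar>eh \<Delta>t \<epsilon> n\<bar> \<le> C)"
proof -
  obtain C where C: "C \<ge> 1" and growth: "\<And>\<epsilon> \<Delta>t t x v e v1 xh eh vh x' v' e'.
     \<epsilon> > 0 \<and> 0 < \<Delta>t \<and> \<Delta>t \<le> T \<and> t \<in> time_range \<and> t + \<Delta>t / (2 * \<gamma>) \<in> time_range \<and>
     schemeS_step E b chi \<epsilon> \<Delta>t t x v e v1 xh eh vh x' v' e' \<Longrightarrow>
     norm v1 \<le> C * state_size v e \<and> norm v' \<le> C * state_size v e \<and> \<bar>eh\<bar> \<le> C * state_size v e \<and>
     state_size v' e' \<le> C * state_size v e \<and>
     state_size v' e' \<le> (1 + C * \<Delta>t + C * (\<Delta>t * state_size v e)\<^sup>2) * state_size v e"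
    using schemeS_step_growth[of chi, OF chi_le] by blast
  obtain M0 where M0: "\<And>\<epsilon>. \<epsilon> > 0 \<Longrightarrow> norm (x0 \<epsilon>) \<le> M0 \<and> norm (v0 \<epsilon>) \<le> M0 \<and> \<bar>e0 \<epsilon>\<bar> \<le> M0"
    using initial_bounded by blast
  have M00: "M0 \<ge> 0" using M0[of 1] norm_ge_zero order_trans by (metis zero_less_one)
  define A0 where "A0 = 1 + 3 * M0"
  have A0: "A0 \<ge> 1" using M00 by (simp add: A0_def)
  have init: "state_size (v0 \<epsilon>) (e0 \<epsilon>) \<le> A0" if "\<epsilon> > 0" for \<epsilon>
    using M0[OF that] norm_perp_le[of "v0 \<epsilon>"] component_le_norm_cart[of "v0 \<epsilon>" 3]
    by (simp add: state_size_def A0_def)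
  have C0: "C \<ge> 0" using C by simp
  obtain M where M: "\<forall>\<Delta>t>0. \<forall>N. \<forall>a :: nat \<Rightarrow> real.
     real N * \<Delta>t \<le> T \<longrightarrow> a 0 \<le> A0 \<longrightarrow> (\<forall>n. a n \<ge> 0) \<longrightarrow>
     (\<forall>n<N. a (Suc n) \<le> (1 + C * \<Delta>t + C * (\<Delta>t * a n)\<^sup>2) * a n \<and> a (Suc n) \<le> C * a n) \<longrightarrow>
     (\<forall>n\<le>N. a n \<le> M)"
    using discrete_growth_bound[OF C0 C A0 T_pos] by (elim exE) (rule that)
  have step: "norm (v1 \<Delta>t \<epsilon> n) \<le> C * state_size (v \<Delta>t \<epsilon> n) (e \<Delta>t \<epsilon> n) \<and>
     norm (v \<Delta>t \<epsilon> (Suc n)) \<le> C * state_size (v \<Delta>t \<epsilon> n) (e \<Delta>t \<epsilon> n) \<and>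
     \<bar>eh \<Delta>t \<epsilon> n\<bar> \<le> C * state_size (v \<Delta>t \<epsilon> n) (e \<Delta>t \<epsilon> n) \<and>
     state_size (v \<Delta>t \<epsilon> (Suc n)) (e \<Delta>t \<epsilon> (Suc n)) \<le> C * state_size (v \<Delta>t \<epsilon> n) (e \<Delta>t \<epsilon> n) \<and>
     state_size (v \<Delta>t \<epsilon> (Suc n)) (e \<Delta>t \<epsilon> (Suc n)) \<le>
       (1 + C * \<Delta>t + C * (\<Delta>t * state_size (v \<Delta>t \<epsilon> n) (e \<Delta>t \<epsilon> n))\<^sup>2) * state_size (v \<Delta>t \<epsilon> n) (e \<Delta>t \<epsilon> n)"
    if "\<Delta>t > 0" "\<epsilon> > 0" "n < num_steps T \<Delta>t" for \<Delta>t \<epsilon> n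
    by (rule growth[OF conjI[OF that(2) conjI[OF that(1) conjI[OF num_steps_times(3)[OF T_pos that(1,3)]
          conjI[OF num_steps_times(4)[OF T_pos that(1,3)] conjI[OF num_steps_times(5)[OF T_pos that(1,3)] scheme[OF that]]]]]]])
  have size: "state_size (v \<Delta>t \<epsilon> n) (e \<Delta>t \<epsilon> n) \<le> M"
    if "\<Delta>t > 0" "\<epsilon> > 0" "n \<le> num_steps T \<Delta>t" for \<Delta>t \<epsilon> n
  proof (rule M[rule_format, of \<Delta>t "num_steps T \<Delta>t" "\<lambda>n. state_size (v \<Delta>t \<epsilon> n) (e \<Delta>t \<epsilon> n)"])
    show "real (num_steps T \<Delta>t) * \<Delta>t \<le> T" by (rule num_steps_times(1)[OF T_pos that(1) order_refl])
    show "state_size (v \<Delta>t \<epsilon> 0) (e \<Delta>t \<epsilon> 0) \<le> A0" using initial[OF that(1,2)] init[OF that(2)] by simp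
    show "0 \<le> state_size (v \<Delta>t \<epsilon> n) (e \<Delta>t \<epsilon> n)" for n
      using state_size_ge(1) by (meson order_trans zero_le_one)
  qed (use that step in auto)
  have M1: "M \<ge> 1" using size[of 1 1 0] state_size_ge(1)[of "v 1 1 0" "e 1 1 0"] by simp
  have stage: "norm (v1 \<Delta>t \<epsilon> n) \<le> C * M" "norm (v \<Delta>t \<epsilon> (Suc n)) \<le> C * M" "\<bar>eh \<Delta>t \<epsilon> n\<bar> \<le> C * M"
    if "\<Delta>t > 0" "\<epsilon> > 0" "n < num_steps T \<Delta>t" for \<Delta>t \<epsilon> n
    using step[OF that] mult_left_mono[OF size[OF that(1,2)] C0, of n] that(3) by auto
  have xb: "norm (x \<Delta>t \<epsilon> n) \<le> M0 + (real n * \<Delta>t) * (2 * C * M)"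
    if dt: "\<Delta>t > 0" "\<epsilon> > 0" and n: "n \<le> num_steps T \<Delta>t" for \<Delta>t \<epsilon> n
    using n
  proof (induction n)
    case 0
    then show ?case using initial[OF dt] M0[OF dt(2)] by simp
  next
    case (Suc n)
    then have IH: "norm (x \<Delta>t \<epsilon> n) \<le> M0 + (real n * \<Delta>t) * (2 * C * M)" and n: "n < num_steps T \<Delta>t" by simp_all
    obtain F1 F2 where "x \<Delta>t \<epsilon> (Suc n) = x \<Delta>t \<epsilon> n + \<Delta>t *\<^sub>R ((1 - \<gamma>) *\<^sub>R v1 \<Delta>t \<epsilon> n + \<gamma> *\<^sub>R v \<Delta>t \<epsilon> (Suc n))"
      by (rule schemeS_stepD[OF scheme[OF dt n] dt(1)])
    moreover have "norm ((1 - \<gamma>) *\<^sub>R v1 \<Delta>t \<epsilon> n + \<gamma> *\<^sub>R v \<Delta>t \<epsilon> (Suc n)) \<le> 2 * C * M"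
    proof -
      have g: "0 \<le> \<gamma>" "\<gamma> \<le> 1" using \<gamma>_bounds by auto
      have "norm ((1 - \<gamma>) *\<^sub>R v1 \<Delta>t \<epsilon> n + \<gamma> *\<^sub>R v \<Delta>t \<epsilon> (Suc n)) \<le> (1 - \<gamma>) * norm (v1 \<Delta>t \<epsilon> n) + \<gamma> * norm (v \<Delta>t \<epsilon> (Suc n))"
        using norm_triangle_ineq[of "(1 - \<gamma>) *\<^sub>R v1 \<Delta>t \<epsilon> n" "\<gamma> *\<^sub>R v \<Delta>t \<epsilon> (Suc n)"] g by simp
      also have "\<dots> \<le> (1 - \<gamma>) * (C * M) + \<gamma> * (C * M)"
        using stage[OF dt n] g by (intro add_mono mult_left_mono) auto
      also have "\<dots> \<le> 2 * C * M" using C M1 by (simp add: algebra_simps)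
      finally show ?thesis .
    qed
    then have "norm (\<Delta>t *\<^sub>R ((1 - \<gamma>) *\<^sub>R v1 \<Delta>t \<epsilon> n + \<gamma> *\<^sub>R v \<Delta>t \<epsilon> (Suc n))) \<le> \<Delta>t * (2 * C * M)"
      using dt by simp
    ultimately have "norm (x \<Delta>t \<epsilon> (Suc n)) \<le> M0 + (real n * \<Delta>t) * (2 * C * M) + \<Delta>t * (2 * C * M)"
      using IH norm_triangle_ineq[of "x \<Delta>t \<epsilon> n" "\<Delta>t *\<^sub>R ((1 - \<gamma>) *\<^sub>R v1 \<Delta>t \<epsilon> n + \<gamma> *\<^sub>R v \<Delta>t \<epsilon> (Suc n))"] by simp
    then show ?case by (simp add: algebra_simps)
  qed
  define K where "K = max (C * M) (M0 + T * (2 * C * M))"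
  have CM: "M \<le> C * M" "C * M \<ge> 0" using C M1 by (simp_all add: mult_le_cancel_right1)
  have "norm (x \<Delta>t \<epsilon> n) \<le> K \<and> norm (v \<Delta>t \<epsilon> n) \<le> K \<and> \<bar>e \<Delta>t \<epsilon> n\<bar> \<le> K"
    if dt: "\<Delta>t > 0" "\<epsilon> > 0" and n: "n \<le> num_steps T \<Delta>t" for \<Delta>t \<epsilon> n
  proof (intro conjI)
    have "(real n * \<Delta>t) * (2 * C * M) \<le> T * (2 * C * M)"
      using num_steps_times(1)[OF T_pos dt(1) n] C M1 by (intro mult_right_mono) auto
    then show "norm (x \<Delta>t \<epsilon> n) \<le> K" using xb[OF dt n] by (simp add: K_def)
    show "norm (v \<Delta>t \<epsilon> n) \<le> K" "\<bar>e \<Delta>t \<epsilon> n\<bar> \<le> K"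
      using size[OF dt n] state_size_ge(2)[of "v \<Delta>t \<epsilon> n" "e \<Delta>t \<epsilon> n"]
        state_size_ge(3)[of "e \<Delta>t \<epsilon> n" "v \<Delta>t \<epsilon> n"] CM by (auto simp: K_def)
  qed
  moreover have "norm (v1 \<Delta>t \<epsilon> n) \<le> K \<and> \<bar>eh \<Delta>t \<epsilon> n\<bar> \<le> K"
    if dt: "\<Delta>t > 0" "\<epsilon> > 0" and n: "n < num_steps T \<Delta>t" for \<Delta>t \<epsilon> n
    using stage(1,3)[OF dt n] by (simp add: K_def le_max_iff_disj)
  moreover have "K \<ge> 0" using CM by (simp add: K_def)
  ultimately show ?thesis by blast
qed

text \<open>The constants \<open>k1\<close> to \<open>k4\<close> bound the perpendicular parts of the velocities, of the first force, of the
  predicted velocity and of the second force, all divided by \<open>\<epsilon>\<close>. The initial velocity is not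
  small, in general, hence the restriction to \<open>n \<ge> 1\<close>.

  The scheme (L) contains the energy itself in place of \<open>\<chi>\<close>. At velocity zero the two agree for
  nonnegative energies. If they need not agree for negative ones, then the initial energies are
  nonnegative, and as the electric force does work only \<open>O(\<epsilon>)\<close> per step, energies never fall below
  \<open>- O(\<epsilon>)\<close>; there the bound of \<open>\<chi>\<close> by the modulus of the energy suffices.\<close>
lemma consistent_with_drift_kinetic:
  assumes dt: "\<Delta>t > 0"
  shows "\<exists>C. \<forall>\<epsilon>>0. \<forall>n. 1 \<le> n \<and> n < num_steps T \<Delta>t \<longrightarrow>
        schemeL_step_upto (C * \<epsilon>\<^sup>2) E b \<epsilon> \<Delta>t (real n * \<Delta>t)
          (x \<Delta>t \<epsilon> n) (e \<Delta>t \<epsilon> n) (v \<Delta>t \<epsilon> n $ 3)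
          (v1 \<Delta>t \<epsilon> n $ 3) (xh \<Delta>t \<epsilon> n) (eh \<Delta>t \<epsilon> n)
          (x \<Delta>t \<epsilon> (Suc n)) (e \<Delta>t \<epsilon> (Suc n)) (v \<Delta>t \<epsilon> (Suc n) $ 3)"
proof -
  let ?x = "x \<Delta>t" and ?v = "v \<Delta>t" and ?e = "e \<Delta>t"
  let ?v1 = "v1 \<Delta>t" and ?xh = "xh \<Delta>t" and ?vh = "vh \<Delta>t" and ?eh = "eh \<Delta>t"
  interpret perp: linear perp by (rule linear_perp)
  obtain B where B: "B \<ge> 1" and FB: "\<And>t y. t \<in> time_range \<Longrightarrow> norm (E t y) \<le> B \<and> norm (grad_perp (\<lambda>z. ln (b t z)) y) \<le> B"
    using field_bounds by (elim exE conjE) (rule that, assumption, simp)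
  obtain M where M0: "M \<ge> 0" and M: "\<And>\<epsilon> n. \<epsilon> > 0 \<Longrightarrow> n \<le> num_steps T \<Delta>t \<Longrightarrow> norm (?v \<epsilon> n) \<le> M \<and> \<bar>e \<Delta>t \<epsilon> n\<bar> \<le> M"
    and Ms: "\<And>\<epsilon> n. \<epsilon> > 0 \<Longrightarrow> n < num_steps T \<Delta>t \<Longrightarrow> norm (?v1 \<epsilon> n) \<le> M \<and> \<bar>eh \<Delta>t \<epsilon> n\<bar> \<le> M"
    using uniform_bounds dt by (elim exE conjE) (rule that, assumption, simp_all)
  have g: "\<gamma> > 0" "\<gamma> \<le> 1" "1 / (2 * \<gamma>) \<le> 2" "1 / (2 * \<gamma>) > 0" using \<gamma>_bounds half_\<gamma>_le by auto
  define f where "f = (M + M) / (\<Delta>t * \<gamma>)"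
  define f2 where "f2 = ((M + M) / \<Delta>t + f) / \<gamma>"
  define h where "h = B * (1 + M)"
  define k1 where "k1 = max ((f + h) / b0) ((f2 + h) / b0)"
  define k2 where "k2 = (k1 + k1) / (\<Delta>t * \<gamma>)"
  define k3 where "k3 = k1 + \<Delta>t * 2 * k2"
  define k4 where "k4 = ((k1 + k1) / \<Delta>t + k2) / \<gamma>"
  define d where "d = 2 * B * k1"
  define k5 where "k5 = 2 * (T * d + T * d)"
  define R where "R = M + \<Delta>t * 2 * f"
  have f0: "f \<ge> 0" "f2 \<ge> 0" "h \<ge> 0" using M0 dt g B by (simp_all add: f_def f2_def h_def)
  have k0: "k1 \<ge> 0" "k2 \<ge> 0" "k3 \<ge> 0" "k4 \<ge> 0" "d \<ge> 0"
  proof -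
    show 1: "k1 \<ge> 0" using f0 b0_pos by (simp add: k1_def le_max_iff_disj)
    show 2: "k2 \<ge> 0" using 1 dt g by (simp add: k2_def)
    show "k3 \<ge> 0" "k4 \<ge> 0" "d \<ge> 0" using 1 2 dt g B by (simp_all add: k3_def k4_def d_def)
  qed
  have RM: "M \<le> R" using dt f0 by (simp add: R_def)
  obtain L where L0: "L \<ge> 0" and L: "\<And>s w. \<bar>s\<bar> \<le> R \<Longrightarrow> norm w \<le> R \<Longrightarrow> \<bar>chi s w - chi s 0\<bar> \<le> L * norm w"
    using chi_lipschitz by blast
  define l1 where "l1 = L * k1 + k5"
  define l2 where "l2 = L * k3 + k5"
  define \<kappa>1 where "\<kappa>1 = (k2 + l1 * B) / b0"
  define \<kappa>2 where "\<kappa>2 = (k4 + l2 * B) / b0"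
  define C where "C = 2 * B * max \<kappa>1 \<kappa>2"
  define t where "t = (\<lambda>n. real n * \<Delta>t)"
  define th where "th = (\<lambda>n. t n + \<Delta>t / (2 * \<gamma>))"
  define F1 where "F1 = (\<lambda>\<epsilon> n. Hforce E b chi (t n) (?x \<epsilon> n) (perp (?v \<epsilon> n)) (?e \<epsilon> n) - (b (t n) (?x \<epsilon> n) / \<epsilon>) *\<^sub>R rot (?v1 \<epsilon> n))"
  define F2 where "F2 = (\<lambda>\<epsilon> n. Hforce E b chi (th n) (?xh \<epsilon> n) (perp (?vh \<epsilon> n)) (?eh \<epsilon> n) - (b (th n) (?xh \<epsilon> n) / \<epsilon>) *\<^sub>R rot (?v \<epsilon> (Suc n)))"
  have step: "?v1 \<epsilon> n = ?v \<epsilon> n + (\<Delta>t * \<gamma>) *\<^sub>R F1 \<epsilon> n \<and>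
    ?xh \<epsilon> n = ?x \<epsilon> n + (\<Delta>t * (1 / (2 * \<gamma>))) *\<^sub>R ?v1 \<epsilon> n \<and>
    ?eh \<epsilon> n = ?e \<epsilon> n + \<Delta>t * (1 / (2 * \<gamma>)) * (perp (E (t n) (?x \<epsilon> n)) \<bullet> perp (?v1 \<epsilon> n)) \<and>
    ?vh \<epsilon> n = ?v \<epsilon> n + (\<Delta>t * (1 / (2 * \<gamma>))) *\<^sub>R F1 \<epsilon> n \<and>
    ?v \<epsilon> (Suc n) = ?v \<epsilon> n + \<Delta>t *\<^sub>R ((1 - \<gamma>) *\<^sub>R F1 \<epsilon> n + \<gamma> *\<^sub>R F2 \<epsilon> n) \<and>
    ?x \<epsilon> (Suc n) = ?x \<epsilon> n + \<Delta>t *\<^sub>R ((1 - \<gamma>) *\<^sub>R ?v1 \<epsilon> n + \<gamma> *\<^sub>R ?v \<epsilon> (Suc n)) \<and>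
    ?e \<epsilon> (Suc n) = ?e \<epsilon> n + \<Delta>t * ((1 - \<gamma>) * (perp (E (t n) (?x \<epsilon> n)) \<bullet> perp (?v1 \<epsilon> n))
        + \<gamma> * (perp (E (th n) (?xh \<epsilon> n)) \<bullet> perp (?v \<epsilon> (Suc n))))"
    if "\<epsilon> > 0" "n < num_steps T \<Delta>t" for \<epsilon> n
    by (rule schemeS_stepD[OF scheme[OF dt that] dt])
       (simp only: F1_def F2_def th_def t_def)
  note times = num_steps_times[OF T_pos dt]
  have tn: "t n \<in> time_range" "th n \<in> time_range" if "n < num_steps T \<Delta>t" for n
    using times(4,5)[OF that] by (simp_all add: t_def th_def)
  have F1v: "F1 \<epsilon> n = (?v1 \<epsilon> n - ?v \<epsilon> n) /\<^sub>R (\<Delta>t * \<gamma>)" if "\<epsilon> > 0" "n < num_steps T \<Delta>t" for \<epsilon> n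
  proof -
    have "w = (c *\<^sub>R w) /\<^sub>R c" if "c \<noteq> 0" for c and w :: "real^3" using that by simp
    from this[of "\<Delta>t * \<gamma>" "F1 \<epsilon> n"] show ?thesis using step[OF that] dt g by simp
  qed
  have F2v: "F2 \<epsilon> n = ((?v \<epsilon> (Suc n) - ?v \<epsilon> n) /\<^sub>R \<Delta>t - (1 - \<gamma>) *\<^sub>R F1 \<epsilon> n) /\<^sub>R \<gamma>"
    if "\<epsilon> > 0" "n < num_steps T \<Delta>t" for \<epsilon> n
    using step[OF that] dt g by simp
  have diffq: "norm ((u - w) /\<^sub>R c) \<le> (a + a') / c" if "norm u \<le> a" "norm w \<le> a'" "c > 0" for u w :: "real^3" and a a' c :: real
    using norm_triangle_ineq4[of u w] that by (simp add: divide_inverse mult.commute mult_right_mono)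
  have combo: "norm ((u /\<^sub>R \<Delta>t - (1 - \<gamma>) *\<^sub>R w) /\<^sub>R \<gamma>) \<le> (a + a') / \<gamma>"
    if "norm (u /\<^sub>R \<Delta>t) \<le> a" "norm w \<le> a'" for u w :: "real^3" and a a' :: real
  proof (rule diffq[OF that(1) _ g(1)])
    have "(1 - \<gamma>) * norm w \<le> 1 * norm w" using g by (intro mult_right_mono) auto
    then show "norm ((1 - \<gamma>) *\<^sub>R w) \<le> a'" using that(2) g by simp
  qed
  have F1b: "norm (F1 \<epsilon> n) \<le> f" if "\<epsilon> > 0" "n < num_steps T \<Delta>t" for \<epsilon> n
    unfolding F1v[OF that] f_def by (rule diffq) (use M[OF that(1), of n] Ms[OF that] that dt g in auto)
  have F2b: "norm (F2 \<epsilon> n) \<le> f2" if "\<epsilon> > 0" "n < num_steps T \<Delta>t" for \<epsilon> n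
    unfolding F2v[OF that] f2_def
    by (rule combo[OF diffq F1b]) (use M[OF that(1), of n] M[OF that(1), of "Suc n"] that dt in auto)
  have Hb: "norm (Hforce E b chi s y (perp w) u) \<le> h" if "s \<in> time_range" "\<bar>u\<bar> \<le> M" for s y w u
  proof -
    have "norm (Hforce E b chi s y (perp w) u) \<le> B * (1 + \<bar>u\<bar>)"
      by (rule norm_Hforce_le) (use FB that chi_le in auto)
    also have "\<dots> \<le> h" unfolding h_def using that(2) B by (intro mult_left_mono) auto
    finally show ?thesis .
  qed
  have v1small: "norm (perp (?v1 \<epsilon> n)) \<le> k1 * \<epsilon>" if "\<epsilon> > 0" "n < num_steps T \<Delta>t" for \<epsilon> n
  proof -
    let ?H = "Hforce E b chi (t n) (?x \<epsilon> n) (perp (?v \<epsilon> n)) (?e \<epsilon> n)"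
    have "norm (perp (?v1 \<epsilon> n)) \<le> \<epsilon> * ((norm (F1 \<epsilon> n) + norm ?H) / b0)"
      by (rule fast_velocity_small[OF tn(1)[OF that(2)] that(1)]) (simp only: F1_def)
    also have "\<dots> \<le> \<epsilon> * ((f + h) / b0)"
      using F1b[OF that] Hb[OF tn(1)[OF that(2)]] M[OF that(1), of n] that b0_pos
      by (intro mult_left_mono divide_right_mono add_mono) auto
    also have "\<dots> \<le> \<epsilon> * k1" using that by (intro mult_left_mono) (auto simp: k1_def)
    finally show ?thesis by (simp add: mult.commute)
  qed
  have v'small: "norm (perp (?v \<epsilon> (Suc n))) \<le> k1 * \<epsilon>" if "\<epsilon> > 0" "n < num_steps T \<Delta>t" for \<epsilon> n
  proof -
    let ?H = "Hforce E b chi (th n) (?xh \<epsilon> n) (perp (?vh \<epsilon> n)) (?eh \<epsilon> n)"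
    have "norm (perp (?v \<epsilon> (Suc n))) \<le> \<epsilon> * ((norm (F2 \<epsilon> n) + norm ?H) / b0)"
      by (rule fast_velocity_small[OF tn(2)[OF that(2)] that(1)]) (simp only: F2_def)
    also have "\<dots> \<le> \<epsilon> * ((f2 + h) / b0)"
      using F2b[OF that] Hb[OF tn(2)[OF that(2)]] Ms[OF that] that b0_pos
      by (intro mult_left_mono divide_right_mono add_mono) auto
    also have "\<dots> \<le> \<epsilon> * k1" using that by (intro mult_left_mono) (auto simp: k1_def)
    finally show ?thesis by (simp add: mult.commute)
  qed
  have inner: "\<bar>perp (E s y) \<bullet> perp w\<bar> \<le> B * k1 * \<epsilon>" if "s \<in> time_range" "norm (perp w) \<le> k1 * \<epsilon>" for s y w \<epsilon>
  proof -
    have "\<bar>perp (E s y) \<bullet> perp w\<bar> \<le> norm (perp (E s y)) * norm (perp w)" by (rule Cauchy_Schwarz_ineq2)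
    also have "\<dots> \<le> B * (k1 * \<epsilon>)"
      using FB[OF that(1), of y] norm_perp_le[of "E s y"] that(2) B by (intro mult_mono) auto
    finally show ?thesis by (simp add: mult.assoc)
  qed
  have e_step: "?e \<epsilon> (Suc n) \<ge> ?e \<epsilon> n - \<Delta>t * d * \<epsilon>" and eh_step: "?eh \<epsilon> n \<ge> ?e \<epsilon> n - \<Delta>t * d * \<epsilon>"
    if "\<epsilon> > 0" "n < num_steps T \<Delta>t" for \<epsilon> n
  proof -
    let ?i1 = "perp (E (t n) (?x \<epsilon> n)) \<bullet> perp (?v1 \<epsilon> n)"
    let ?i2 = "perp (E (th n) (?xh \<epsilon> n)) \<bullet> perp (?v \<epsilon> (Suc n))"
    have i: "\<bar>?i1\<bar> \<le> B * k1 * \<epsilon>" "\<bar>?i2\<bar> \<le> B * k1 * \<epsilon>"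
      by (rule inner[OF tn(1)[OF that(2)] v1small[OF that]], rule inner[OF tn(2)[OF that(2)] v'small[OF that]])
    have sc: "\<bar>c * i\<bar> \<le> C * (B * k1 * \<epsilon>)" if "0 \<le> c" "c \<le> C" "\<bar>i\<bar> \<le> B * k1 * \<epsilon>" for c i C :: real
      unfolding abs_mult using that by (intro mult_mono) auto
    have "\<bar>(1 / (2 * \<gamma>)) * ?i1\<bar> \<le> 2 * (B * k1 * \<epsilon>)" by (rule sc[OF _ g(3) i(1)]) (use g in simp)
    then have "(1 / (2 * \<gamma>)) * ?i1 \<ge> - (2 * (B * k1 * \<epsilon>))" by linarith
    then have "(1 / (2 * \<gamma>)) * ?i1 \<ge> - (d * \<epsilon>)" by (simp only: d_def mult.assoc)
    then have "\<Delta>t * ((1 / (2 * \<gamma>)) * ?i1) \<ge> \<Delta>t * - (d * \<epsilon>)" using dt by (intro mult_left_mono) auto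
    then show "?eh \<epsilon> n \<ge> ?e \<epsilon> n - \<Delta>t * d * \<epsilon>" using step[OF that] by (simp add: mult.assoc)
    have "\<bar>(1 - \<gamma>) * ?i1\<bar> \<le> 1 * (B * k1 * \<epsilon>)" "\<bar>\<gamma> * ?i2\<bar> \<le> 1 * (B * k1 * \<epsilon>)"
      by (rule sc[OF _ _ i(1)], use g in simp, use g in simp) (rule sc[OF _ _ i(2)], use g in simp, use g in simp)
    then have "(1 - \<gamma>) * ?i1 + \<gamma> * ?i2 \<ge> - (d * \<epsilon>)" by (simp add: d_def)
    then have "\<Delta>t * ((1 - \<gamma>) * ?i1 + \<gamma> * ?i2) \<ge> \<Delta>t * - (d * \<epsilon>)" using dt by (intro mult_left_mono) auto
    then show "?e \<epsilon> (Suc n) \<ge> ?e \<epsilon> n - \<Delta>t * d * \<epsilon>" using step[OF that] by (simp add: mult.assoc)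
  qed
  have e_low: "?e \<epsilon> n \<ge> e0 \<epsilon> - t n * d * \<epsilon>" if \<epsilon>: "\<epsilon> > 0" and n: "n \<le> num_steps T \<Delta>t" for \<epsilon> n
    using n
  proof (induction n)
    case 0 then show ?case using initial[OF dt \<epsilon>] by (simp add: t_def)
  next
    case (Suc n)
    then have "?e \<epsilon> (Suc n) \<ge> e0 \<epsilon> - t n * d * \<epsilon> - \<Delta>t * d * \<epsilon>" using e_step[OF \<epsilon>, of n] by simp
    then show ?case by (simp add: t_def algebra_simps)
  qed
  have chi0: "\<bar>chi s 0 - s\<bar> \<le> k5 * \<epsilon>" if \<epsilon>: "\<epsilon> > 0" and s: "s \<ge> e0 \<epsilon> - (T * d + T * d) * \<epsilon>" for s \<epsilon>
  proof (cases "s \<ge> 0 \<or> (\<forall>s<0. chi s 0 = s)")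
    case True
    then have "chi s 0 = s" using chi_zero by (cases "s \<ge> 0") auto
    then show ?thesis using \<epsilon> T_pos k0 by (simp add: k5_def)
  next
    case False
    then have "e0 \<epsilon> \<ge> 0" "s < 0" using energy_range \<epsilon> by auto
    moreover have "\<bar>chi s 0\<bar> \<le> \<bar>s\<bar>" using chi_le[of s 0] by (simp add: perp.zero)
    ultimately have "\<bar>chi s 0 - s\<bar> \<le> 2 * ((T * d + T * d) * \<epsilon>)" using s by linarith
    then show ?thesis by (simp add: k5_def mult.assoc)
  qed
  have td: "t n * d * \<epsilon> \<le> T * d * \<epsilon>" if "\<epsilon> > 0" "n \<le> num_steps T \<Delta>t" for \<epsilon> n
    using times(1)[OF that(2)] that k0 by (simp add: t_def mult_right_mono)
  have chi1: "\<bar>chi (?e \<epsilon> n) 0 - ?e \<epsilon> n\<bar> \<le> k5 * \<epsilon>" if "\<epsilon> > 0" "n \<le> num_steps T \<Delta>t" for \<epsilon> n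
  proof (rule chi0[OF that(1)])
    have "0 \<le> T * d * \<epsilon>" using T_pos k0 that by simp
    then show "?e \<epsilon> n \<ge> e0 \<epsilon> - (T * d + T * d) * \<epsilon>" using e_low[OF that] td[OF that] by (simp add: distrib_right)
  qed
  have chi2: "\<bar>chi (?eh \<epsilon> n) 0 - ?eh \<epsilon> n\<bar> \<le> k5 * \<epsilon>" if "\<epsilon> > 0" "n < num_steps T \<Delta>t" for \<epsilon> n
  proof (rule chi0[OF that(1)])
    have "\<Delta>t * d * \<epsilon> \<le> T * d * \<epsilon>" using times(3)[OF that(2)] k0 that by (simp add: mult_right_mono)
    then show "?eh \<epsilon> n \<ge> e0 \<epsilon> - (T * d + T * d) * \<epsilon>"
      using eh_step[OF that] e_low[OF that(1), of n] td[OF that(1), of n] that(2) by (simp add: distrib_right)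
  qed
  show ?thesis
  proof (intro exI[of _ C] allI impI, elim conjE)
    fix \<epsilon> :: real and n assume \<epsilon>: "\<epsilon> > 0" and n1: "1 \<le> n" and n: "n < num_steps T \<Delta>t"
    \<comment> \<open>The velocity at \<open>n\<close> is the result of the preceding step, which exists because \<open>n \<ge> 1\<close>.\<close>
    have vsmall: "norm (perp (?v \<epsilon> n)) \<le> k1 * \<epsilon>"
      using v'small[OF \<epsilon>, of "n - 1"] n n1 by simp
    note s = step[OF \<epsilon> n]
    have pF1: "norm (perp (F1 \<epsilon> n)) \<le> k2 * \<epsilon>"
    proof -
      have "norm ((perp (?v1 \<epsilon> n) - perp (?v \<epsilon> n)) /\<^sub>R (\<Delta>t * \<gamma>)) \<le> (k1 * \<epsilon> + k1 * \<epsilon>) / (\<Delta>t * \<gamma>)"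
        by (rule diffq[OF v1small[OF \<epsilon> n] vsmall]) (use dt g in simp)
      moreover have "perp (F1 \<epsilon> n) = (perp (?v1 \<epsilon> n) - perp (?v \<epsilon> n)) /\<^sub>R (\<Delta>t * \<gamma>)"
        unfolding F1v[OF \<epsilon> n] by (simp only: perp.scaleR perp.diff)
      moreover have "(k1 * \<epsilon> + k1 * \<epsilon>) / (\<Delta>t * \<gamma>) = k2 * \<epsilon>" by (simp add: k2_def)
      ultimately show ?thesis by simp
    qed
    have pF2: "norm (perp (F2 \<epsilon> n)) \<le> k4 * \<epsilon>"
    proof -
      have "norm (((perp (?v \<epsilon> (Suc n)) - perp (?v \<epsilon> n)) /\<^sub>R \<Delta>t - (1 - \<gamma>) *\<^sub>R perp (F1 \<epsilon> n)) /\<^sub>R \<gamma>)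
          \<le> ((k1 * \<epsilon> + k1 * \<epsilon>) / \<Delta>t + k2 * \<epsilon>) / \<gamma>"
        by (rule combo[OF diffq[OF v'small[OF \<epsilon> n] vsmall dt] pF1])
      moreover have "perp (F2 \<epsilon> n) = ((perp (?v \<epsilon> (Suc n)) - perp (?v \<epsilon> n)) /\<^sub>R \<Delta>t - (1 - \<gamma>) *\<^sub>R perp (F1 \<epsilon> n)) /\<^sub>R \<gamma>"
        unfolding F2v[OF \<epsilon> n] by (simp only: perp.scaleR perp.diff)
      moreover have "((k1 * \<epsilon> + k1 * \<epsilon>) / \<Delta>t + k2 * \<epsilon>) / \<gamma> = k4 * \<epsilon>"
        by (simp add: k4_def add_divide_distrib distrib_right)
      ultimately show ?thesis by simp
    qed
    have hdt: "0 \<le> \<Delta>t * (1 / (2 * \<gamma>))" "\<Delta>t * (1 / (2 * \<gamma>)) \<le> \<Delta>t * 2"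
      using g dt by (auto intro!: mult_left_mono simp del: times_divide_eq_right)
    have nhat: "norm (u + (\<Delta>t * (1 / (2 * \<gamma>))) *\<^sub>R w) \<le> a + \<Delta>t * 2 * c" if "norm u \<le> a" "norm w \<le> c" for u w :: "real^3" and a c
    proof -
      have "norm ((\<Delta>t * (1 / (2 * \<gamma>))) *\<^sub>R w) \<le> (\<Delta>t * 2) * c"
        unfolding norm_scaleR abs_of_nonneg[OF hdt(1)] by (rule mult_mono[OF hdt(2) that(2)]) (use dt in auto)
      then show ?thesis using norm_triangle_ineq[of u "(\<Delta>t * (1 / (2 * \<gamma>))) *\<^sub>R w"] that(1) by linarith
    qed
    have vhb: "norm (perp (?vh \<epsilon> n)) \<le> R"
    proof -
      have "norm (?vh \<epsilon> n) \<le> R"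
        using nhat[of "?v \<epsilon> n" M "F1 \<epsilon> n" f] M[OF \<epsilon>, of n] n F1b[OF \<epsilon> n] s by (simp add: R_def)
      then show ?thesis using norm_perp_le order_trans by blast
    qed
    have vhsmall: "norm (perp (?vh \<epsilon> n)) \<le> k3 * \<epsilon>"
    proof -
      have "perp (?vh \<epsilon> n) = perp (?v \<epsilon> n) + (\<Delta>t * (1 / (2 * \<gamma>))) *\<^sub>R perp (F1 \<epsilon> n)"
        using s by (simp only: perp.add perp.scaleR)
      then show ?thesis using nhat[OF vsmall pF1] by (simp add: k3_def algebra_simps)
    qed
    have vb: "norm (perp (?v \<epsilon> n)) \<le> R"
      using M[OF \<epsilon>, of n] n norm_perp_le[of "?v \<epsilon> n"] RM by simp
    have c1: "\<bar>chi (?e \<epsilon> n) (perp (?v \<epsilon> n)) - ?e \<epsilon> n\<bar> \<le> l1 * \<epsilon>"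
    proof -
      have "\<bar>chi (?e \<epsilon> n) (perp (?v \<epsilon> n)) - chi (?e \<epsilon> n) 0\<bar> \<le> L * norm (perp (?v \<epsilon> n))"
        by (rule L[OF _ vb]) (use M[OF \<epsilon>, of n] n RM in simp)
      also have "\<dots> \<le> L * (k1 * \<epsilon>)" using vsmall L0 by (rule mult_left_mono)
      finally show ?thesis using chi1[OF \<epsilon>, of n] n by (simp add: l1_def algebra_simps)
    qed
    have c2: "\<bar>chi (?eh \<epsilon> n) (perp (?vh \<epsilon> n)) - ?eh \<epsilon> n\<bar> \<le> l2 * \<epsilon>"
    proof -
      have "\<bar>chi (?eh \<epsilon> n) (perp (?vh \<epsilon> n)) - chi (?eh \<epsilon> n) 0\<bar> \<le> L * norm (perp (?vh \<epsilon> n))"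
        by (rule L[OF _ vhb]) (use Ms[OF \<epsilon> n] RM in simp)
      also have "\<dots> \<le> L * (k3 * \<epsilon>)" using vhsmall L0 by (rule mult_left_mono)
      finally show ?thesis using chi2[OF \<epsilon> n] by (simp add: l2_def algebra_simps)
    qed
    let ?U1 = "Ugc E b \<epsilon> (t n) (?x \<epsilon> n) (?e \<epsilon> n) (?v1 \<epsilon> n $ 3)"
    let ?U2 = "Ugc E b \<epsilon> (th n) (?xh \<epsilon> n) (?eh \<epsilon> n) (?v \<epsilon> (Suc n) $ 3)"
    let ?i1 = "perp (E (t n) (?x \<epsilon> n)) \<bullet> perp (?v1 \<epsilon> n)"
    let ?i2 = "perp (E (th n) (?xh \<epsilon> n)) \<bullet> perp (?v \<epsilon> (Suc n))"
    let ?D1 = "divF E b (t n) (?x \<epsilon> n)"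
    let ?D2 = "divF E b (th n) (?xh \<epsilon> n)"
    define \<delta> where "\<delta> = max \<kappa>1 \<kappa>2 * \<epsilon>\<^sup>2"
    have \<kappa>\<delta>: "\<kappa>1 * \<epsilon>\<^sup>2 \<le> \<delta>" "\<kappa>2 * \<epsilon>\<^sup>2 \<le> \<delta>" by (auto simp: \<delta>_def intro!: mult_right_mono)
    note FB1 = FB[OF tn(1)[OF n]] and FB2 = FB[OF tn(2)[OF n]]
    note sl1 = slaving_estimate[OF tn(1)[OF n] \<epsilon> F1_def[THEN fun_cong, THEN fun_cong] B FB1[THEN conjunct1] FB1[THEN conjunct2] pF1 c1, folded \<kappa>1_def]
    note sl2 = slaving_estimate[OF tn(2)[OF n] \<epsilon> F2_def[THEN fun_cong, THEN fun_cong] B FB2[THEN conjunct1] FB2[THEN conjunct2] pF2 c2, folded \<kappa>2_def]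
    have U1: "norm (?v1 \<epsilon> n - ?U1) \<le> \<delta>" using sl1(1) \<kappa>\<delta>(1) by linarith
    have U2: "norm (?v \<epsilon> (Suc n) - ?U2) \<le> \<delta>" using sl2(1) \<kappa>\<delta>(2) by linarith
    have B0: "B \<ge> 0" using B by simp
    have I1: "\<bar>?i1 - \<epsilon> * ?e \<epsilon> n * ?D1\<bar> \<le> B * \<delta>" using sl1(2) mult_left_mono[OF \<kappa>\<delta>(1) B0] by linarith
    have I2: "\<bar>?i2 - \<epsilon> * ?eh \<epsilon> n * ?D2\<bar> \<le> B * \<delta>" using sl2(2) mult_left_mono[OF \<kappa>\<delta>(2) B0] by linarith
    have \<delta>0: "\<delta> \<ge> 0" using U1 norm_ge_zero order_trans by blast
    have C\<delta>: "C * \<epsilon>\<^sup>2 = 2 * (B * \<delta>)" by (simp add: C_def \<delta>_def)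
    have B\<delta>: "\<delta> \<le> B * \<delta>" using B \<delta>0 mult_right_mono[of 1 B \<delta>] by simp
    have F13: "F1 \<epsilon> n $ 3 = E (t n) (?x \<epsilon> n) $ 3" and F23: "F2 \<epsilon> n $ 3 = E (th n) (?xh \<epsilon> n) $ 3"
      by (simp_all add: F1_def F2_def Hforce_3 rot_perp_components)
    show "schemeL_step_upto (C * \<epsilon>\<^sup>2) E b \<epsilon> \<Delta>t (real n * \<Delta>t)
          (?x \<epsilon> n) (?e \<epsilon> n) (?v \<epsilon> n $ 3)
          (?v1 \<epsilon> n $ 3) (?xh \<epsilon> n) (?eh \<epsilon> n)
          (?x \<epsilon> (Suc n)) (?e \<epsilon> (Suc n)) (?v \<epsilon> (Suc n) $ 3)"
      unfolding schemeL_step_upto_def Let_def t_def[THEN fun_cong, of n, symmetric] th_def[THEN fun_cong, of n, symmetric] C\<delta>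
    proof (intro conjI)
      have "(?v1 \<epsilon> n $ 3 - ?v \<epsilon> n $ 3) / \<Delta>t = \<gamma> * E (t n) (?x \<epsilon> n) $ 3"
        using s F13 dt by simp
      then show "\<bar>(?v1 \<epsilon> n $ 3 - ?v \<epsilon> n $ 3) / \<Delta>t - \<gamma> * E (t n) (?x \<epsilon> n) $ 3\<bar> \<le> 2 * (B * \<delta>)"
        using B0 \<delta>0 by simp
      have "(?v \<epsilon> (Suc n) $ 3 - ?v \<epsilon> n $ 3) / \<Delta>t = (1 - \<gamma>) * E (t n) (?x \<epsilon> n) $ 3 + \<gamma> * E (th n) (?xh \<epsilon> n) $ 3"
        using s F13 F23 dt by simp
      then show "\<bar>(?v \<epsilon> (Suc n) $ 3 - ?v \<epsilon> n $ 3) / \<Delta>t - ((1 - \<gamma>) * E (t n) (?x \<epsilon> n) $ 3 + \<gamma> * E (th n) (?xh \<epsilon> n) $ 3)\<bar> \<le> 2 * (B * \<delta>)"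
        using B0 \<delta>0 by simp
      have "(?xh \<epsilon> n - ?x \<epsilon> n) /\<^sub>R \<Delta>t - (1 / (2 * \<gamma>)) *\<^sub>R ?U1 = (1 / (2 * \<gamma>)) *\<^sub>R (?v1 \<epsilon> n - ?U1)"
        using s dt by (simp add: scaleR_right_diff_distrib)
      moreover have "norm ((1 / (2 * \<gamma>)) *\<^sub>R (?v1 \<epsilon> n - ?U1)) \<le> 2 * \<delta>"
        unfolding norm_scaleR abs_of_pos[OF g(4)] by (rule mult_mono[OF g(3) U1]) auto
      ultimately show "norm ((?xh \<epsilon> n - ?x \<epsilon> n) /\<^sub>R \<Delta>t - (1 / (2 * \<gamma>)) *\<^sub>R ?U1) \<le> 2 * (B * \<delta>)"
        using B\<delta> by simp
      have "(?eh \<epsilon> n - ?e \<epsilon> n) / \<Delta>t - \<epsilon> / (2 * \<gamma>) * ?e \<epsilon> n * ?D1 = (1 / (2 * \<gamma>)) * (?i1 - \<epsilon> * ?e \<epsilon> n * ?D1)"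
        using s dt g by (simp add: field_simps)
      moreover have "\<bar>(1 / (2 * \<gamma>)) * (?i1 - \<epsilon> * ?e \<epsilon> n * ?D1)\<bar> \<le> 2 * (B * \<delta>)"
        unfolding abs_mult[of "1 / (2 * \<gamma>)"] abs_of_pos[OF g(4)] by (rule mult_mono[OF g(3) I1]) auto
      ultimately show "\<bar>(?eh \<epsilon> n - ?e \<epsilon> n) / \<Delta>t - \<epsilon> / (2 * \<gamma>) * ?e \<epsilon> n * ?D1\<bar> \<le> 2 * (B * \<delta>)"
        by simp
      have "(?x \<epsilon> (Suc n) - ?x \<epsilon> n) /\<^sub>R \<Delta>t - ((1 - \<gamma>) *\<^sub>R ?U1 + \<gamma> *\<^sub>R ?U2)
          = (1 - \<gamma>) *\<^sub>R (?v1 \<epsilon> n - ?U1) + \<gamma> *\<^sub>R (?v \<epsilon> (Suc n) - ?U2)"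
      proof -
        have "?x \<epsilon> (Suc n) - ?x \<epsilon> n = \<Delta>t *\<^sub>R ((1 - \<gamma>) *\<^sub>R ?v1 \<epsilon> n + \<gamma> *\<^sub>R ?v \<epsilon> (Suc n))"
          using s by (metis add_diff_cancel_left')
        then have "(?x \<epsilon> (Suc n) - ?x \<epsilon> n) /\<^sub>R \<Delta>t = (1 - \<gamma>) *\<^sub>R ?v1 \<epsilon> n + \<gamma> *\<^sub>R ?v \<epsilon> (Suc n)"
          using dt by simp
        then show ?thesis by (simp add: scaleR_right_diff_distrib)
      qed
      moreover have "norm \<dots> \<le> 2 * \<delta>"
      proof -
        have "norm ((1 - \<gamma>) *\<^sub>R (?v1 \<epsilon> n - ?U1)) \<le> 1 * \<delta>"
          unfolding norm_scaleR using g U1 by (intro mult_mono) auto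
        moreover have "norm (\<gamma> *\<^sub>R (?v \<epsilon> (Suc n) - ?U2)) \<le> 1 * \<delta>"
          unfolding norm_scaleR using g U2 by (intro mult_mono) auto
        ultimately show ?thesis
          using norm_triangle_ineq[of "(1 - \<gamma>) *\<^sub>R (?v1 \<epsilon> n - ?U1)" "\<gamma> *\<^sub>R (?v \<epsilon> (Suc n) - ?U2)"] by linarith
      qed
      ultimately show "norm ((?x \<epsilon> (Suc n) - ?x \<epsilon> n) /\<^sub>R \<Delta>t - ((1 - \<gamma>) *\<^sub>R ?U1 + \<gamma> *\<^sub>R ?U2)) \<le> 2 * (B * \<delta>)"
        using B\<delta> by simp
      have "(?e \<epsilon> (Suc n) - ?e \<epsilon> n) / \<Delta>t - \<epsilon> * ((1 - \<gamma>) * ?e \<epsilon> n * ?D1 + \<gamma> * ?eh \<epsilon> n * ?D2)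
          = (1 - \<gamma>) * (?i1 - \<epsilon> * ?e \<epsilon> n * ?D1) + \<gamma> * (?i2 - \<epsilon> * ?eh \<epsilon> n * ?D2)"
      proof -
        have "?e \<epsilon> (Suc n) - ?e \<epsilon> n = \<Delta>t * ((1 - \<gamma>) * ?i1 + \<gamma> * ?i2)"
          using s by (metis add_diff_cancel_left')
        then have "(?e \<epsilon> (Suc n) - ?e \<epsilon> n) / \<Delta>t = (1 - \<gamma>) * ?i1 + \<gamma> * ?i2"
          using dt by simp
        then show ?thesis by (simp add: algebra_simps)
      qed
      moreover have "\<bar>\<dots>\<bar> \<le> 2 * (B * \<delta>)"
      proof -
        have "\<bar>(1 - \<gamma>) * (?i1 - \<epsilon> * ?e \<epsilon> n * ?D1)\<bar> \<le> 1 * (B * \<delta>)"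
          unfolding abs_mult[of "1 - \<gamma>"] using g I1 by (intro mult_mono) auto
        moreover have "\<bar>\<gamma> * (?i2 - \<epsilon> * ?eh \<epsilon> n * ?D2)\<bar> \<le> 1 * (B * \<delta>)"
          unfolding abs_mult[of \<gamma>] using g I2 by (intro mult_mono) auto
        ultimately show ?thesis by linarith
      qed
      ultimately show "\<bar>(?e \<epsilon> (Suc n) - ?e \<epsilon> n) / \<Delta>t - \<epsilon> * ((1 - \<gamma>) * ?e \<epsilon> n * ?D1 + \<gamma> * ?eh \<epsilon> n * ?D2)\<bar> \<le> 2 * (B * \<delta>)"
        by simp
    qed
  qed
qed

end

section \<open>Second order convergence by comparison with the midpoint step\<close>

lemma norm_increment_le:
  fixes f :: "real \<Rightarrow> 'z::real_normed_vector"
  assumes "a \<le> c" and f: "\<And>s. s \<in> {a..c} \<Longrightarrow> (f has_vector_derivative f' s) (at s within {a..c})"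
    and B: "\<And>s. s \<in> {a..c} \<Longrightarrow> norm (f' s) \<le> B"
  shows "norm (f c - f a) \<le> B * (c - a)"
proof -
  have "norm (f c - f a) \<le> B * norm (c - a)"
  proof (rule differentiable_bound[where S="{a..c}" and f'="\<lambda>s r. r *\<^sub>R f' s"])
    fix s assume s: "s \<in> {a..c}"
    show "(f has_derivative (\<lambda>r. r *\<^sub>R f' s)) (at s within {a..c})"
      using f[OF s] by (simp add: has_vector_derivative_def)
    show "onorm (\<lambda>r. r *\<^sub>R f' s) \<le> B"
    proof (rule onorm_bound)
      show "B \<ge> 0" using B[OF s] norm_ge_zero order_trans by blast
      show "norm (r *\<^sub>R f' s) \<le> B * norm r" for r
        using mult_left_mono[OF B[OF s], of "\<bar>r\<bar>"] by (simp add: mult.commute)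
    qed
  qed (use \<open>a \<le> c\<close> in auto)
  then show ?thesis using \<open>a \<le> c\<close> by simp
qed

text \<open>Points combine time and state, so that the vector field of the autonomous form is \<open>(1, G)\<close>.\<close>
abbreviation midpoint_of :: "(real \<times> 'z::real_normed_vector \<Rightarrow> 'z) \<Rightarrow> real \<Rightarrow> real \<times> 'z \<Rightarrow> real \<times> 'z" where
  "midpoint_of G h p \<equiv> p + (h / 2) *\<^sub>R (1, G p)"

lemma norm_Pair_1_le: "norm (1::real, y) \<le> 1 + norm y"
  using norm_Pair_le[of "1::real" y] by simp

lemma norm_midpoint: "h \<ge> 0 \<Longrightarrow> norm (midpoint_of G h p - p) = (h / 2) * norm (1::real, G p)"
  by (simp only: add_diff_cancel_left' norm_scaleR)

text \<open>The candidate second order Taylor polynomial of the flow has the second derivative \<open>A P (1, G P)\<close>, where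
  \<open>A P\<close> is the linear part of \<open>G\<close> at the initial point. The derivative of the difference is \<open>O(h\<^sup>2)\<close> by the Taylor
  expansion of \<open>G\<close>, so the difference is \<open>O(h\<^sup>3)\<close>. The midpoint step has the same polynomial.\<close>
lemma exact_flow_midpoint:
  fixes G :: "real \<times> 'z::real_normed_vector \<Rightarrow> 'z"
  assumes G: "C11 D G"
  shows "\<exists>C\<ge>0. \<forall>Z t h. h \<ge> 0 \<longrightarrow> (\<forall>s\<in>{t..t+h}. (Z has_vector_derivative G (s, Z s)) (at s within {t..t+h}) \<and> (s, Z s) \<in> D) \<longrightarrow>
      midpoint_of G h (t, Z t) \<in> D \<longrightarrow>
      norm (Z (t + h) - Z t - h *\<^sub>R G (midpoint_of G h (t, Z t))) \<le> C * h ^ 3"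
proof -
  obtain A K L where K: "K \<ge> 0" and lin: "\<And>p. p \<in> D \<Longrightarrow> linear (A p)" and GK: "\<And>p. p \<in> D \<Longrightarrow> norm (G p) \<le> K"
    and AK: "\<And>p h. p \<in> D \<Longrightarrow> norm (A p h) \<le> K * norm h"
    and tay: "\<And>p q. p \<in> D \<Longrightarrow> q \<in> D \<Longrightarrow> norm (G q - G p - A p (q - p)) \<le> K * (norm (q - p))\<^sup>2"
    and L: "L \<ge> 0" "\<And>p q. p \<in> D \<Longrightarrow> q \<in> D \<Longrightarrow> norm (G q - G p) \<le> L * norm (q - p)"
    by (rule C11_E[OF G]) (rule that)
  define c1 where "c1 = K * (1 + K)\<^sup>2 + K * (L * (1 + K))"
  define C2 where "C2 = K * (1 + K)\<^sup>2"
  have C0: "c1 \<ge> 0" "C2 \<ge> 0" using K L by (simp_all add: c1_def C2_def)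
  show ?thesis
  proof (rule exI[of _ "c1 + C2"], intro conjI allI impI)
    show "c1 + C2 \<ge> 0" using C0 by simp
    fix Z :: "real \<Rightarrow> 'z" and t h :: real
    assume h: "h \<ge> 0" and Z: "\<forall>s\<in>{t..t+h}. (Z has_vector_derivative G (s, Z s)) (at s within {t..t+h}) \<and> (s, Z s) \<in> D"
      and m: "midpoint_of G h (t, Z t) \<in> D"
    define P where "P = (t, Z t)"
    have P: "P \<in> D" using Z h by (auto simp: P_def)
    interpret A: linear "A P" by (rule lin[OF P])
    have sub: "(f has_vector_derivative d) (at r within {t..s})"
      if "(f has_vector_derivative d) (at r within {t..t+h})" "s \<le> t + h" for f :: "real \<Rightarrow> 'z" and d r s
      using that by (auto intro: has_vector_derivative_within_subset)
    have Z1: "norm (Z s - Z t) \<le> K * (s - t)" if s: "s \<in> {t..t+h}" for s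
    proof (rule norm_increment_le[where f'="\<lambda>r. G (r, Z r)"])
      fix r assume r: "r \<in> {t..s}"
      then show "(Z has_vector_derivative G (r, Z r)) (at r within {t..s})" using sub[of Z "G (r, Z r)" r s] Z s r by auto
      show "norm (G (r, Z r)) \<le> K" using Z r s by (intro GK) auto
    qed (use s in simp)
    have dist: "norm ((s, Z s) - P) \<le> (1 + K) * (s - t)" if s: "s \<in> {t..t+h}" for s
      using norm_Pair_le[of "s - t" "Z s - Z t"] Z1[OF s] s by (simp add: P_def algebra_simps)
    have Z2: "norm (Z s - Z t - (s - t) *\<^sub>R G P) \<le> L * (1 + K) * (s - t) * (s - t)" if s: "s \<in> {t..t+h}" for s
    proof -
      have "norm ((\<lambda>r. Z r - (r - t) *\<^sub>R G P) s - (\<lambda>r. Z r - (r - t) *\<^sub>R G P) t) \<le> (L * ((1 + K) * (s - t))) * (s - t)"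
      proof (rule norm_increment_le[where f'="\<lambda>r. G (r, Z r) - G P"])
        fix r assume r: "r \<in> {t..s}"
        then have "(Z has_vector_derivative G (r, Z r)) (at r within {t..s})" using sub[of Z "G (r, Z r)" r s] Z s r by auto
        then show "((\<lambda>r. Z r - (r - t) *\<^sub>R G P) has_vector_derivative G (r, Z r) - G P) (at r within {t..s})"
          by (auto intro!: derivative_eq_intros)
        have "norm (G (r, Z r) - G P) \<le> L * norm ((r, Z r) - P)" using Z r s P by (intro L(2)) auto
        also have "\<dots> \<le> L * ((1 + K) * (s - t))"
        proof (rule mult_left_mono[OF _ L(1)])
          have "norm ((r, Z r) - P) \<le> (1 + K) * (r - t)" by (rule dist) (use r s in auto)
          also have "\<dots> \<le> (1 + K) * (s - t)" using r K by (intro mult_left_mono) auto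
          finally show "norm ((r, Z r) - P) \<le> (1 + K) * (s - t)" .
        qed
        finally show "norm (G (r, Z r) - G P) \<le> L * ((1 + K) * (s - t))" .
      qed (use s in simp)
      then show ?thesis by (simp add: algebra_simps)
    qed
    let ?a = "A P (1, G P)"
    let ?w = "\<lambda>s. Z s - (s - t) *\<^sub>R G P - ((s - t)\<^sup>2 / 2) *\<^sub>R ?a"
    have "norm (?w (t + h) - ?w t) \<le> (c1 * h\<^sup>2) * (t + h - t)"
    proof (rule norm_increment_le[where f'="\<lambda>s. G (s, Z s) - G P - (s - t) *\<^sub>R ?a"])
      fix s assume s: "s \<in> {t..t+h}"
      have dZ: "(Z has_vector_derivative G (s, Z s)) (at s within {t..t+h})" using Z s by auto
      have dq: "((\<lambda>s. (s - t)\<^sup>2 / 2) has_real_derivative (s - t)) (at s within {t..t+h})"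
        by (auto intro!: derivative_eq_intros)
      have dl: "((\<lambda>s. s - t) has_real_derivative 1) (at s within {t..t+h})"
        by (auto intro!: derivative_eq_intros)
      show "(?w has_vector_derivative G (s, Z s) - G P - (s - t) *\<^sub>R ?a) (at s within {t..t+h})"
        using has_vector_derivative_diff[OF has_vector_derivative_diff[OF dZ
             has_vector_derivative_scaleR[OF dl has_vector_derivative_const[of "G P"]]]
             has_vector_derivative_scaleR[OF dq has_vector_derivative_const[of ?a]]]
        by simp
      let ?q = "(s, Z s)"
      have q: "?q \<in> D" using Z s by auto
      have split: "G ?q - G P - (s - t) *\<^sub>R ?a = (G ?q - G P - A P (?q - P)) + A P (0, Z s - Z t - (s - t) *\<^sub>R G P)"
      proof -
        have "(?q - P) - (s - t) *\<^sub>R (1, G P) = (0, Z s - Z t - (s - t) *\<^sub>R G P)" by (simp add: P_def)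
        then have "A P (0, Z s - Z t - (s - t) *\<^sub>R G P) = A P (?q - P) - (s - t) *\<^sub>R ?a"
          by (metis A.diff A.scaleR)
        then show ?thesis by simp
      qed
      have "norm (G ?q - G P - A P (?q - P)) \<le> K * ((1 + K) * h)\<^sup>2"
      proof -
        have "norm (?q - P) \<le> (1 + K) * h"
        proof -
          have "(1 + K) * (s - t) \<le> (1 + K) * h" using s K by (intro mult_left_mono) auto
          then show ?thesis using dist[OF s] by linarith
        qed
        then have "K * (norm (?q - P))\<^sup>2 \<le> K * ((1 + K) * h)\<^sup>2"
          using K by (intro mult_left_mono power_mono) auto
        then show ?thesis using tay[OF P q] by linarith
      qed
      moreover have "norm (A P (0, Z s - Z t - (s - t) *\<^sub>R G P)) \<le> K * (L * (1 + K) * h * h)"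
      proof -
        have "norm (A P (0, Z s - Z t - (s - t) *\<^sub>R G P)) \<le> K * norm (Z s - Z t - (s - t) *\<^sub>R G P)"
          using AK[OF P, of "(0, Z s - Z t - (s - t) *\<^sub>R G P)"] by (simp add: norm_Pair)
        also have "\<dots> \<le> K * (L * (1 + K) * (s - t) * (s - t))" using Z2[OF s] K by (rule mult_left_mono)
        also have "\<dots> \<le> K * (L * (1 + K) * h * h)"
          using s K L(1) by (intro mult_left_mono mult_mono) auto
        finally show ?thesis .
      qed
      ultimately have "norm (G ?q - G P - (s - t) *\<^sub>R ?a) \<le> K * ((1 + K) * h)\<^sup>2 + K * (L * (1 + K) * h * h)"
        unfolding split
        using norm_triangle_ineq[of "G ?q - G P - A P (?q - P)" "A P (0, Z s - Z t - (s - t) *\<^sub>R G P)"] by linarith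
      also have "\<dots> = c1 * h\<^sup>2" by (simp add: c1_def power2_eq_square algebra_simps)
      finally show "norm (G ?q - G P - (s - t) *\<^sub>R ?a) \<le> c1 * h\<^sup>2" .
    qed (use h in simp)
    then have 1: "norm (Z (t + h) - Z t - h *\<^sub>R G P - (h\<^sup>2 / 2) *\<^sub>R ?a) \<le> c1 * h ^ 3"
      by (simp add: power2_eq_square power3_eq_cube algebra_simps)
    let ?m = "midpoint_of G h P"
    have 2: "norm (h *\<^sub>R G ?m - h *\<^sub>R G P - (h\<^sup>2 / 2) *\<^sub>R ?a) \<le> C2 * h ^ 3"
    proof -
      have "norm (G ?m - G P - A P (?m - P)) \<le> K * (norm (?m - P))\<^sup>2"
        by (rule tay[OF P]) (use m in \<open>simp add: P_def\<close>)
      also have "\<dots> \<le> K * ((1 + K) * h)\<^sup>2"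
      proof -
        have "norm (?m - P) = (h / 2) * norm (1::real, G P)" by (rule norm_midpoint[OF h])
        also have "\<dots> \<le> h * (1 + K)"
          using h norm_Pair_1_le[of "G P"] GK[OF P] by (intro mult_mono) auto
        finally show ?thesis using K h by (intro mult_left_mono power_mono) (auto simp: mult.commute)
      qed
      finally have "h * norm (G ?m - G P - A P (?m - P)) \<le> h * (K * ((1 + K) * h)\<^sup>2)"
        using h by (rule mult_left_mono)
      moreover have eq: "h *\<^sub>R G ?m - h *\<^sub>R G P - (h\<^sup>2 / 2) *\<^sub>R ?a = h *\<^sub>R (G ?m - G P - A P (?m - P))"
        using A.scaleR[of "h / 2" "(1, G P)"] by (simp add: scaleR_right_diff_distrib power2_eq_square)
      moreover have "norm (h *\<^sub>R (G ?m - G P - A P (?m - P))) = h * norm (G ?m - G P - A P (?m - P))"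
        using h by (simp only: norm_scaleR abs_of_nonneg)
      moreover have "h * (K * ((1 + K) * h)\<^sup>2) = C2 * h ^ 3"
        by (simp add: C2_def power2_eq_square power3_eq_cube)
      ultimately show ?thesis unfolding eq by linarith
    qed
    have "Z (t + h) - Z t - h *\<^sub>R G ?m = (Z (t + h) - Z t - h *\<^sub>R G P - (h\<^sup>2 / 2) *\<^sub>R ?a) - (h *\<^sub>R G ?m - h *\<^sub>R G P - (h\<^sup>2 / 2) *\<^sub>R ?a)"
      by simp
    also have "norm \<dots> \<le> c1 * h ^ 3 + C2 * h ^ 3"
      using norm_triangle_ineq4[of "Z (t + h) - Z t - h *\<^sub>R G P - (h\<^sup>2 / 2) *\<^sub>R ?a" "h *\<^sub>R G ?m - h *\<^sub>R G P - (h\<^sup>2 / 2) *\<^sub>R ?a"] 1 2 by linarith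
    finally show "norm (Z (t + h) - Z t - h *\<^sub>R G (midpoint_of G h (t, Z t))) \<le> (c1 + C2) * h ^ 3"
      by (simp add: P_def algebra_simps)
  qed
qed

text \<open>Expand all three evaluations of \<open>G\<close> at \<open>p\<close>. The linear parts cancel up to \<open>O(h\<^sup>2)\<close> because the weighted
  mean of the displacements of the stages is nearly that of the midpoint; for a concrete scheme this hypothesis
  contains its order conditions.\<close>
lemma two_stage_midpoint:
  fixes G :: "real \<times> 'z::real_normed_vector \<Rightarrow> 'z"
  assumes G: "C11 D G" and c1: "c1 \<ge> 0" and w: "0 \<le> \<theta>" "\<theta> \<le> 1"
  shows "\<exists>C\<ge>0. \<forall>p q1 q2 h. h \<ge> 0 \<longrightarrow> p \<in> D \<longrightarrow> q1 \<in> D \<longrightarrow> q2 \<in> D \<longrightarrow> midpoint_of G h p \<in> D \<longrightarrow>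
      norm (q1 - p) \<le> c1 * h \<longrightarrow> norm (q2 - p) \<le> c1 * h \<longrightarrow>
      norm ((1 - \<theta>) *\<^sub>R (q1 - p) + \<theta> *\<^sub>R (q2 - p) - (h / 2) *\<^sub>R (1, G p)) \<le> c1 * h\<^sup>2 \<longrightarrow>
      norm ((1 - \<theta>) *\<^sub>R G q1 + \<theta> *\<^sub>R G q2 - G (midpoint_of G h p)) \<le> C * h\<^sup>2"
proof -
  obtain A K where K: "K \<ge> 0" and lin: "\<And>p. p \<in> D \<Longrightarrow> linear (A p)" and GK: "\<And>p. p \<in> D \<Longrightarrow> norm (G p) \<le> K"
    and AK: "\<And>p h. p \<in> D \<Longrightarrow> norm (A p h) \<le> K * norm h"
    and tay: "\<And>p q. p \<in> D \<Longrightarrow> q \<in> D \<Longrightarrow> norm (G q - G p - A p (q - p)) \<le> K * (norm (q - p))\<^sup>2"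
    by (rule C11_E[OF G]) (rule that; assumption)
  define C where "C = K * c1\<^sup>2 + K * c1\<^sup>2 + K * c1 + K * (1 + K)\<^sup>2"
  show ?thesis
  proof (rule exI[of _ C], intro conjI allI impI)
    show "C \<ge> 0" using K c1 by (simp add: C_def)
    fix p q1 q2 :: "real \<times> 'z" and h :: real
    assume h: "h \<ge> 0" and p: "p \<in> D" and q1: "q1 \<in> D" and q2: "q2 \<in> D" and m: "midpoint_of G h p \<in> D"
      and n1: "norm (q1 - p) \<le> c1 * h" and n2: "norm (q2 - p) \<le> c1 * h"
      and r: "norm ((1 - \<theta>) *\<^sub>R (q1 - p) + \<theta> *\<^sub>R (q2 - p) - (h / 2) *\<^sub>R (1, G p)) \<le> c1 * h\<^sup>2"
    let ?m = "midpoint_of G h p"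
    let ?r = "(1 - \<theta>) *\<^sub>R (q1 - p) + \<theta> *\<^sub>R (q2 - p) - (?m - p)"
    interpret A: linear "A p" by (rule lin[OF p])
    define T where "T = (\<lambda>q. G q - G p - A p (q - p))"
    have T: "norm (T q) \<le> K * c1\<^sup>2 * h\<^sup>2" if "q \<in> D" "norm (q - p) \<le> c1 * h" for q
    proof -
      have "K * (norm (q - p))\<^sup>2 \<le> K * (c1 * h)\<^sup>2" using K that by (intro mult_left_mono power_mono) auto
      then show ?thesis unfolding T_def using tay[OF p that(1)] by (simp add: power_mult_distrib mult.assoc)
    qed
    have Tm: "norm (T ?m) \<le> K * (1 + K)\<^sup>2 * h\<^sup>2"
    proof -
      have "norm (?m - p) = (h / 2) * norm (1::real, G p)" by (rule norm_midpoint[OF h])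
      also have "\<dots> \<le> h * (1 + K)" using h norm_Pair_1_le[of "G p"] GK[OF p] by (intro mult_mono) auto
      finally have "K * (norm (?m - p))\<^sup>2 \<le> K * (h * (1 + K))\<^sup>2"
        using K h by (intro mult_left_mono power_mono) auto
      then show ?thesis unfolding T_def using tay[OF p m] by (simp add: power_mult_distrib mult_ac)
    qed
    have eq: "(1 - \<theta>) *\<^sub>R G q1 + \<theta> *\<^sub>R G q2 - G ?m = (1 - \<theta>) *\<^sub>R T q1 + \<theta> *\<^sub>R T q2 + A p ?r - T ?m"
    proof -
      have Ar: "A p ?r = (1 - \<theta>) *\<^sub>R A p (q1 - p) + \<theta> *\<^sub>R A p (q2 - p) - A p (?m - p)"
        by (simp only: A.diff A.add A.scaleR)
      show ?thesis unfolding T_def Ar by (simp add: scaleR_left_diff_distrib scaleR_right_diff_distrib)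
    qed
    have s1: "norm ((1 - \<theta>) *\<^sub>R T q1) \<le> 1 * (K * c1\<^sup>2 * h\<^sup>2)"
      unfolding norm_scaleR using w T[OF q1 n1] by (intro mult_mono) auto
    have s2: "norm (\<theta> *\<^sub>R T q2) \<le> 1 * (K * c1\<^sup>2 * h\<^sup>2)"
      unfolding norm_scaleR using w T[OF q2 n2] by (intro mult_mono) auto
    have s3: "norm (A p ?r) \<le> K * (c1 * h\<^sup>2)"
    proof -
      have "norm (A p ?r) \<le> K * norm ?r" by (rule AK[OF p])
      also have "\<dots> \<le> K * (c1 * h\<^sup>2)" using r K by (intro mult_left_mono) (auto simp del: scaleR_Pair)
      finally show ?thesis .
    qed
    have "norm ((1 - \<theta>) *\<^sub>R T q1 + \<theta> *\<^sub>R T q2 + A p ?r - T ?m) \<le> 1 * (K * c1\<^sup>2 * h\<^sup>2) + 1 * (K * c1\<^sup>2 * h\<^sup>2) + K * (c1 * h\<^sup>2) + K * (1 + K)\<^sup>2 * h\<^sup>2"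
      using norm_triangle_mono[OF norm_triangle_mono[OF s1 s2] s3] Tm
        norm_triangle_ineq4[of "(1 - \<theta>) *\<^sub>R T q1 + \<theta> *\<^sub>R T q2 + A p ?r" "T ?m"] by linarith
    then show "norm ((1 - \<theta>) *\<^sub>R G q1 + \<theta> *\<^sub>R G q2 - G ?m) \<le> C * h\<^sup>2"
      unfolding eq by (simp add: C_def algebra_simps)
  qed
qed

lemma discrete_gronwall:
  fixes a :: "nat \<Rightarrow> real"
  assumes "a 0 = 0" "\<And>n. n < N \<Longrightarrow> a (Suc n) \<le> (1 + h * L) * a n + C * h ^ 3" "h \<ge> 0" "L \<ge> 0" "C \<ge> 0"
    and "n \<le> N"
  shows "a n \<le> C * (real n * h) * exp (L * (real n * h)) * h\<^sup>2"
  using \<open>n \<le> N\<close>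
proof (induction n)
  case 0 then show ?case using assms by simp
next
  case (Suc n)
  let ?X = "exp (L * (real n * h))" and ?Y = "exp (L * (real (Suc n) * h))"
  have Y: "?Y = exp (h * L) * ?X" by (simp add: exp_add[symmetric] algebra_simps)
  have Y1: "?Y \<ge> 1" using assms by simp
  have XY: "(1 + h * L) * ?X \<le> ?Y" unfolding Y using assms by (intro mult_right_mono exp_ge_add_one_self) auto
  have "a (Suc n) \<le> (1 + h * L) * (C * (real n * h) * ?X * h\<^sup>2) + C * h ^ 3"
  proof -
    have "(1 + h * L) * a n \<le> (1 + h * L) * (C * (real n * h) * ?X * h\<^sup>2)"
      using Suc assms by (intro mult_left_mono) auto
    then show ?thesis using assms(2)[of n] Suc.prems by simp
  qed
  also have "\<dots> = (C * (real n * h) * h\<^sup>2) * ((1 + h * L) * ?X) + (C * h * h\<^sup>2) * 1"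
    by (simp add: power2_eq_square power3_eq_cube algebra_simps)
  also have "\<dots> \<le> (C * (real n * h) * h\<^sup>2) * ?Y + (C * h * h\<^sup>2) * ?Y"
    using assms XY Y1 by (intro add_mono mult_left_mono) auto
  finally show ?case by (simp add: algebra_simps)
qed

text \<open>Exact and numerical increments are midpoint increments up to \<open>O(h\<^sup>3)\<close>, and the midpoint increment is
  Lipschitz in the state. The stages \<open>q1\<close>, \<open>q2\<close> enter through estimates and not through the equations that
  determine them, so that implicit stages are covered.\<close>
lemma second_order_convergence:
  fixes G :: "real \<times> 'z::real_normed_vector \<Rightarrow> 'z"
  assumes G: "C11 D G" and c1: "c1 \<ge> 0" and \<theta>: "0 \<le> \<theta>" "\<theta> \<le> 1" and T: "T > 0"
    and Z_deriv: "\<forall>s\<in>{0..T}. (Z has_vector_derivative G (s, Z s)) (at s within {0..T})"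
    and Z_in: "\<forall>s\<in>{0..T}. (s, Z s) \<in> D"
    and Z_mid: "\<forall>s h. 0 \<le> s \<and> 0 \<le> h \<and> s + h \<le> T \<longrightarrow> midpoint_of G h (s, Z s) \<in> D"
  shows "\<exists>C. \<forall>h>0. \<forall>N z q1 q2. real N * h \<le> T \<longrightarrow> z 0 = Z 0 \<longrightarrow>
     (\<forall>n<N. (real n * h, z n) \<in> D \<and> midpoint_of G h (real n * h, z n) \<in> D \<and> q1 n \<in> D \<and> q2 n \<in> D \<and>
        norm (q1 n - (real n * h, z n)) \<le> c1 * h \<and> norm (q2 n - (real n * h, z n)) \<le> c1 * h \<and>
        norm ((1 - \<theta>) *\<^sub>R (q1 n - (real n * h, z n)) + \<theta> *\<^sub>R (q2 n - (real n * h, z n))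
            - (h / 2) *\<^sub>R (1, G (real n * h, z n))) \<le> c1 * h\<^sup>2 \<and>
        z (Suc n) = z n + h *\<^sub>R ((1 - \<theta>) *\<^sub>R G (q1 n) + \<theta> *\<^sub>R G (q2 n))) \<longrightarrow>
     (\<forall>n\<le>N. norm (z n - Z (real n * h)) \<le> C * h\<^sup>2)"
proof -
  note Z = Z_deriv[rule_format] and ZD = Z_in[rule_format]
  have ZM: "midpoint_of G h (s, Z s) \<in> D" if "0 \<le> s" "0 \<le> h" "s + h \<le> T" for s h
    using Z_mid that by blast
  obtain Ce where Ce: "Ce \<ge> 0" "\<forall>Z t h. h \<ge> 0 \<longrightarrow> (\<forall>s\<in>{t..t+h}. (Z has_vector_derivative G (s, Z s)) (at s within {t..t+h}) \<and> (s, Z s) \<in> D) \<longrightarrow>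
      midpoint_of G h (t, Z t) \<in> D \<longrightarrow>
      norm (Z (t + h) - Z t - h *\<^sub>R G (midpoint_of G h (t, Z t))) \<le> Ce * h ^ 3"
    using exact_flow_midpoint[OF G] by (elim exE conjE) (rule that)
  obtain Cs where Cs: "Cs \<ge> 0" "\<forall>p q1 q2 h. h \<ge> 0 \<longrightarrow> p \<in> D \<longrightarrow> q1 \<in> D \<longrightarrow> q2 \<in> D \<longrightarrow> midpoint_of G h p \<in> D \<longrightarrow>
      norm (q1 - p) \<le> c1 * h \<longrightarrow> norm (q2 - p) \<le> c1 * h \<longrightarrow>
      norm ((1 - \<theta>) *\<^sub>R (q1 - p) + \<theta> *\<^sub>R (q2 - p) - (h / 2) *\<^sub>R (1, G p)) \<le> c1 * h\<^sup>2 \<longrightarrow>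
      norm ((1 - \<theta>) *\<^sub>R G q1 + \<theta> *\<^sub>R G q2 - G (midpoint_of G h p)) \<le> Cs * h\<^sup>2"
    using two_stage_midpoint[OF G c1 \<theta>] by (elim exE conjE) (rule that)
  obtain L where L: "L \<ge> 0" "\<And>p q. p \<in> D \<Longrightarrow> q \<in> D \<Longrightarrow> norm (G q - G p) \<le> L * norm (q - p)"
    by (rule C11_E[OF G]) (rule that; assumption)
  define L' where "L' = L * (1 + T * L)"
  have L'0: "L' \<ge> 0" using L T by (simp add: L'_def)
  define C where "C = (Cs + Ce) * T * exp (L' * T)"
  show ?thesis
  proof (intro exI[of _ C] allI impI)
    fix h :: real and N :: nat and z q1 q2 n
    assume h: "h > 0" and N: "real N * h \<le> T" and z0: "z 0 = Z 0" and n: "n \<le> N"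
      and st: "\<forall>n<N. (real n * h, z n) \<in> D \<and> midpoint_of G h (real n * h, z n) \<in> D \<and> q1 n \<in> D \<and> q2 n \<in> D \<and>
        norm (q1 n - (real n * h, z n)) \<le> c1 * h \<and> norm (q2 n - (real n * h, z n)) \<le> c1 * h \<and>
        norm ((1 - \<theta>) *\<^sub>R (q1 n - (real n * h, z n)) + \<theta> *\<^sub>R (q2 n - (real n * h, z n))
            - (h / 2) *\<^sub>R (1, G (real n * h, z n))) \<le> c1 * h\<^sup>2 \<and>
        z (Suc n) = z n + h *\<^sub>R ((1 - \<theta>) *\<^sub>R G (q1 n) + \<theta> *\<^sub>R G (q2 n))"
    define a where "a = (\<lambda>n. norm (z n - Z (real n * h)))"
    have step: "a (Suc n) \<le> (1 + h * L') * a n + (Cs + Ce) * h ^ 3" if n: "n < N" for n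
    proof -
      define t where "t = real n * h"
      have t: "t \<ge> 0" using h by (simp add: t_def)
      have "real (Suc n) * h \<le> real N * h" using n h by (intro mult_right_mono) auto
      then have th: "t + h \<le> T" using N by (simp add: t_def algebra_simps)
      have tS: "real (Suc n) * h = t + h" by (simp add: t_def algebra_simps)
      let ?p = "(t, z n)" and ?P = "(t, Z t)"
      have p: "?p \<in> D" "midpoint_of G h ?p \<in> D" and zS: "z (Suc n) = z n + h *\<^sub>R ((1 - \<theta>) *\<^sub>R G (q1 n) + \<theta> *\<^sub>R G (q2 n))"
        using st n by (auto simp: t_def simp del: scaleR_Pair add_Pair)
      have P: "?P \<in> D" "midpoint_of G h ?P \<in> D" using ZD ZM t th h by (auto simp del: scaleR_Pair add_Pair)
      have num: "norm ((1 - \<theta>) *\<^sub>R G (q1 n) + \<theta> *\<^sub>R G (q2 n) - G (midpoint_of G h ?p)) \<le> Cs * h\<^sup>2"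
        by (rule Cs(2)[rule_format]) (use st n h in \<open>auto simp: t_def simp del: scaleR_Pair add_Pair diff_Pair\<close>)
      have ex: "norm (Z (t + h) - Z t - h *\<^sub>R G (midpoint_of G h ?P)) \<le> Ce * h ^ 3"
      proof (rule Ce(2)[rule_format])
        fix s assume s: "s \<in> {t..t+h}"
        show "(Z has_vector_derivative G (s, Z s)) (at s within {t..t+h}) \<and> (s, Z s) \<in> D"
          using ZD[of s] has_vector_derivative_within_subset[OF Z[of s], of "{t..t+h}"] s t th by auto
      qed (use h P in auto)
      have G0: "norm (G ?p - G ?P) \<le> L * a n"
        using L(2)[OF P(1) p(1)] by (simp add: a_def t_def norm_Pair)
      have G1: "norm (G (midpoint_of G h ?p) - G (midpoint_of G h ?P)) \<le> L' * a n"
      proof -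
        have "norm (midpoint_of G h ?p - midpoint_of G h ?P) = norm ((z n - Z t) + (h / 2) *\<^sub>R (G ?p - G ?P))"
          by (simp add: norm_Pair algebra_simps)
        also have "\<dots> \<le> a n + (h / 2) * norm (G ?p - G ?P)"
          using norm_triangle_ineq[of "z n - Z t" "(h / 2) *\<^sub>R (G ?p - G ?P)"] h by (simp add: a_def t_def)
        also have "(h / 2) * norm (G ?p - G ?P) \<le> T * (L * a n)"
          using G0 th t h T by (intro mult_mono) auto
        finally have "norm (midpoint_of G h ?p - midpoint_of G h ?P) \<le> (1 + T * L) * a n"
          by (simp add: algebra_simps)
        then have "L * norm (midpoint_of G h ?p - midpoint_of G h ?P) \<le> L * ((1 + T * L) * a n)"
          using L(1) by (rule mult_left_mono)
        then show ?thesis using L(2)[OF P(2) p(2)] unfolding L'_def mult.assoc by linarith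
      qed
      have "z (Suc n) - Z (t + h) = (z n - Z t) + h *\<^sub>R ((1 - \<theta>) *\<^sub>R G (q1 n) + \<theta> *\<^sub>R G (q2 n) - G (midpoint_of G h ?p))
          + h *\<^sub>R (G (midpoint_of G h ?p) - G (midpoint_of G h ?P)) - (Z (t + h) - Z t - h *\<^sub>R G (midpoint_of G h ?P))"
        by (simp only: zS scaleR_right_diff_distrib) (simp add: algebra_simps del: scaleR_Pair add_Pair)
      moreover have "norm (h *\<^sub>R ((1 - \<theta>) *\<^sub>R G (q1 n) + \<theta> *\<^sub>R G (q2 n) - G (midpoint_of G h ?p))) \<le> h * (Cs * h\<^sup>2)"
        unfolding norm_scaleR using num h by (intro mult_mono) auto
      moreover have "norm (h *\<^sub>R (G (midpoint_of G h ?p) - G (midpoint_of G h ?P))) \<le> h * (L' * a n)"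
        unfolding norm_scaleR using G1 h by (intro mult_mono) auto
      moreover have "norm (w1 + w2 + w3 - w4) \<le> norm w1 + norm w2 + norm w3 + norm w4" for w1 w2 w3 w4 :: 'z
        using norm_triangle_ineq[of w1 w2] norm_triangle_ineq[of "w1 + w2" w3] norm_triangle_ineq4[of "w1 + w2 + w3" w4] by linarith
      ultimately have "norm (z (Suc n) - Z (t + h)) \<le> norm (z n - Z t) + h * (Cs * h\<^sup>2) + h * (L' * a n) + Ce * h ^ 3"
        using ex by (smt (verit, best))
      then show ?thesis
        unfolding a_def tS by (simp add: t_def power2_eq_square power3_eq_cube algebra_simps)
    qed
    have "a n \<le> (Cs + Ce) * (real n * h) * exp (L' * (real n * h)) * h\<^sup>2"
      by (rule discrete_gronwall[where a=a and N=N]) (use step z0 h L'0 Cs(1) Ce(1) n in \<open>auto simp: a_def\<close>)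
    also have "\<dots> \<le> (Cs + Ce) * T * exp (L' * T) * h\<^sup>2"
    proof -
      have "real n * h \<le> real N * h" using n h by (intro mult_right_mono) auto
      then have nT: "real n * h \<le> T" using N by simp
      then have "exp (L' * (real n * h)) \<le> exp (L' * T)" using L'0 by (simp add: mult_left_mono)
      then show ?thesis
        using nT Cs(1) Ce(1) T h by (intro mult_right_mono mult_mono mult_left_mono) auto
    qed
    finally show "norm (z n - Z (real n * h)) \<le> C * h\<^sup>2" by (simp add: a_def C_def)
  qed
qed

section \<open>The drift-kinetic scheme\<close>

lemma norm_triple_components:
  "norm (fst z) \<le> norm z" "norm (fst (snd z)) \<le> norm z" "norm (snd (snd z)) \<le> norm z"
  by (metis norm_fst_le norm_snd_le order_trans prod.collapse)+

text \<open>The vector field of the characteristics as one function of time and state \<open>(x, e, u)\<close>, with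
  parallel velocity \<open>u\<close>.\<close>
definition drift_rhs ::
  "(real \<Rightarrow> real^3 \<Rightarrow> real^3) \<Rightarrow> (real \<Rightarrow> real^3 \<Rightarrow> real) \<Rightarrow> real \<Rightarrow>
   real \<times> (real^3) \<times> real \<times> real \<Rightarrow> (real^3) \<times> real \<times> real" where
  "drift_rhs E b \<epsilon> = (\<lambda>(t, x, e, u). (Ugc E b \<epsilon> t x e u, \<epsilon> * divF E b t x * e, E t x $ 3))"

locale smooth_gyro_fields = gyro_fields +
  assumes E_regular_2: "\<And>i. W_inf 2 (field_domain T) (\<lambda>(t, y). E t y $ i)"
    and b_regular_3: "W_inf 3 (field_domain T) (\<lambda>(t, y). b t y)"
begin

text \<open>Energy and parallel velocity are confined because the vector field is unbounded in them.\<close>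
definition phase_box :: "real \<Rightarrow> (real \<times> (real^3) \<times> real \<times> real) set" where
  "phase_box R = time_range \<times> UNIV \<times> {-R..R} \<times> {-R..R}"

lemma C11_fields:
  shows "C11 (time_range \<times> UNIV) (\<lambda>(t, y). E t y $ i)"
    and "C11 (time_range \<times> UNIV) (\<lambda>(t, y). b t y)"
    and "C11 (time_range \<times> UNIV) (\<lambda>(t, y). dpartial (axis k 1) (b t) y)"
proof -
  note dom = field_domain_props[OF T_pos]
  show "C11 (time_range \<times> UNIV) (\<lambda>(t, y). E t y $ i)"
    using W_inf_2_C11[OF dom(1,2) E_regular_2[unfolded numeral_2_eq_2]] unfolding dom(3) .
  show "C11 (time_range \<times> UNIV) (\<lambda>(t, y). b t y)"
    using W_inf_2_C11[OF dom(1,2) b_regular_3[unfolded numeral_3_eq_3]] unfolding dom(3) .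
  obtain g :: "real \<times> (real^3) \<Rightarrow> real \<times> (real^3) \<Rightarrow> real" where
    g: "\<And>i. i \<in> Basis \<Longrightarrow> W_inf (Suc (Suc 0)) (field_domain T) (g i)"
    and dg: "\<And>t k y. t \<in> time_range \<Longrightarrow> dpartial (axis k 1) (b t) y = g (0, axis k 1) (t, y)"
    using W_inf_2_slice[OF T_pos b_regular_3[unfolded numeral_3_eq_3]] by blast
  have ax: "(0, axis k 1) \<in> (Basis :: (real \<times> (real^3)) set)"
    by (auto simp: Basis_prod_def axis_in_Basis_iff)
  have "C11 (time_range \<times> UNIV) (g (0, axis k 1))"
    using W_inf_2_C11[OF dom(1,2) g[OF ax]] unfolding dom(3) .
  then show "C11 (time_range \<times> UNIV) (\<lambda>(t, y). dpartial (axis k 1) (b t) y)"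
    by (rule C11_cong) (auto simp: dg)
qed

lemma C11_drift_rhs: "C11 (phase_box R) (drift_rhs E b \<epsilon>)"
proof -
  let ?D = "phase_box R"
  have lift: "C11 ?D (\<lambda>p. f (fst p, fst (snd p)))" if "C11 (time_range \<times> UNIV) f" for f :: "real \<times> (real^3) \<Rightarrow> real"
    by (rule C11_compose_linear[OF that])
      (auto simp: phase_box_def intro!: bounded_linear_Pair bounded_linear_fst bounded_linear_compose[OF bounded_linear_fst bounded_linear_snd])
  have E: "C11 ?D (\<lambda>p. E (fst p) (fst (snd p)) $ i)" for i
    using lift[OF C11_fields(1)] by simp
  have b: "C11 ?D (\<lambda>p. inverse (b (fst p) (fst (snd p))))"
  proof (rule C11_inverse[OF _ b0_pos])
    show "C11 ?D (\<lambda>p. b (fst p) (fst (snd p)))" using lift[OF C11_fields(2)] by simp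
    show "b0 \<le> b (fst p) (fst (snd p))" if "p \<in> ?D" for p
      using that by (intro b_ge) (auto simp: phase_box_def)
  qed
  have db: "C11 ?D (\<lambda>p. dpartial (axis k 1) (b (fst p)) (fst (snd p)))" for k
    using lift[OF C11_fields(3)] by simp
  have e: "C11 ?D (\<lambda>p. fst (snd (snd p)))"
    by (rule C11_bounded_linear[where R="\<bar>R\<bar>"])
      (auto simp: phase_box_def intro!: bounded_linear_compose[OF bounded_linear_fst] bounded_linear_compose[OF bounded_linear_snd] bounded_linear_snd)
  have u: "C11 ?D (\<lambda>p. snd (snd (snd p)))"
    by (rule C11_bounded_linear[where R="\<bar>R\<bar>"])
      (auto simp: phase_box_def intro!: bounded_linear_compose[OF bounded_linear_snd] bounded_linear_snd)
  let ?b = "\<lambda>p. b (fst p) (fst (snd p))"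
  let ?db = "\<lambda>k p. dpartial (axis k 1) (b (fst p)) (fst (snd p))"
  let ?E = "\<lambda>i p. E (fst p) (fst (snd p)) $ i"
  let ?e = "\<lambda>p. fst (snd (snd p))"
  define drift :: "3 \<Rightarrow> real \<times> (real^3) \<times> real \<times> real \<Rightarrow> real" where "drift = (\<lambda>k p. ?E k p * inverse (?b p) - ?e p * (inverse (?b p) * inverse (?b p)) * ?db k p)"
  have dr: "C11 ?D (drift k)" for k
    unfolding drift_def by (intro C11_diff C11_mult E b e db)
  have U: "C11 ?D (\<lambda>p. snd (snd (snd p)) *\<^sub>R (axis 3 1 :: real^3)
      + ((\<epsilon> * drift 2 p) *\<^sub>R axis 1 1 + (- (\<epsilon> * drift 1 p)) *\<^sub>R axis 2 1))"
    by (intro C11_add C11_scaleR C11_minus C11_mult C11_const u dr)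
  have P: "C11 ?D (\<lambda>p. \<epsilon> * ((?E 2 p * ?db 1 p - ?E 1 p * ?db 2 p) * (inverse (?b p) * inverse (?b p))) * ?e p)"
    by (intro C11_mult C11_diff C11_const E b e db)
  show ?thesis
  proof (rule C11_cong[OF C11_Pair[OF U C11_Pair[OF P E[of 3]]]])
    fix p assume p: "p \<in> ?D"
    obtain t x e u where [simp]: "p = (t, x, e, u)" by (cases p)
    have t: "t \<in> time_range" using p by (simp add: phase_box_def)
    show "(snd (snd (snd p)) *\<^sub>R (axis 3 1 :: real^3) + ((\<epsilon> * drift 2 p) *\<^sub>R axis 1 1 + (- (\<epsilon> * drift 1 p)) *\<^sub>R axis 2 1),
        \<epsilon> * ((?E 2 p * ?db 1 p - ?E 1 p * ?db 2 p) * (inverse (?b p) * inverse (?b p))) * ?e p, ?E 3 p) = drift_rhs E b \<epsilon> p"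
      by (simp add: drift_rhs_def divF_eq[OF t] drift_def vec3_eq_iff Ugc_def Fdrift_def ez_def rot_perp_components
          grad_perp_def axis_def divide_inverse power2_eq_square algebra_simps)
  qed
qed

lemma divF_bounded: "\<exists>K\<ge>0. \<forall>t\<in>time_range. \<forall>y. \<bar>divF E b t y\<bar> \<le> K"
proof -
  obtain K where K: "K \<ge> 0" "\<And>p. p \<in> phase_box 1 \<Longrightarrow> norm (drift_rhs E b 1 p) \<le> K"
    using C11_bounded_lipschitz(1)[OF C11_drift_rhs[of 1 1]] by blast
  have "\<bar>divF E b t y\<bar> \<le> K" if "t \<in> time_range" for t y
  proof -
    have "norm (drift_rhs E b 1 (t, y, 1, 0)) \<le> K" by (rule K(2)) (use that in \<open>simp add: phase_box_def\<close>)
    moreover have "norm (fst (snd (drift_rhs E b 1 (t, y, 1, 0)))) \<le> norm (drift_rhs E b 1 (t, y, 1, 0))"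
      by (rule norm_triple_components)
    ultimately show ?thesis by (simp add: drift_rhs_def)
  qed
  then show ?thesis using K(1) by blast
qed

text \<open>Exact and numerical energies and parallel velocities remain bounded independently of the time step, since
  the energy equation is linear and the parallel force bounded; \<open>R1\<close> bounds them at grid points and \<open>R\<close> at
  stages and midpoints. The scheme is a two-stage method whose stage points are \<open>q1\<close> and \<open>q2\<close>.
  Relative to the current point they are displaced in the parallel velocity by \<open>\<gamma> * \<Delta>t * Q1\<close> and by the full
  increment \<open>\<Delta>t * ((1 - \<gamma>) * Q1 + \<gamma> * Q2)\<close>. The weighted mean of the displacements is \<open>\<Delta>t * (2 * \<gamma> - \<gamma>\<^sup>2) * Q1\<close> up to
  \<open>O(\<Delta>t\<^sup>2)\<close>, that is \<open>\<Delta>t / 2 * Q1\<close> by the choice of \<open>\<gamma>\<close>. In the other components it is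
  \<open>\<gamma> * \<Delta>t / (2 * \<gamma>)\<close> times the rate.\<close>
lemma second_order_in_time:
  assumes \<epsilon>: "\<epsilon> > 0" and curve: "characteristic_curve E b \<epsilon> T X En Vpar"
  shows "\<exists>C. \<forall>\<Delta>t>0. \<forall>y s u u1 yh sh.
           y 0 = X 0 \<and> s 0 = En 0 \<and> u 0 = Vpar 0 \<and>
           (\<forall>n<num_steps T \<Delta>t.
              schemeL_step_upto 0 E b \<epsilon> \<Delta>t (real n * \<Delta>t)
                (y n) (s n) (u n) (u1 n) (yh n) (sh n) (y (Suc n)) (s (Suc n)) (u (Suc n))) \<longrightarrow>
           (\<forall>n\<le>num_steps T \<Delta>t.
              norm (y n - X (real n * \<Delta>t)) \<le> C * \<Delta>t\<^sup>2 \<and>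
              \<bar>s n - En (real n * \<Delta>t)\<bar> \<le> C * \<Delta>t\<^sup>2 \<and>
              \<bar>u n - Vpar (real n * \<Delta>t)\<bar> \<le> C * \<Delta>t\<^sup>2)"
proof -
  have g: "\<gamma> > 0" "\<gamma> \<le> 1" "1 / (2 * \<gamma>) \<le> 2" "1 / (2 * \<gamma>) > 0" using \<gamma>_bounds half_\<gamma>_le by auto
  have cX: "(X has_vector_derivative Ugc E b \<epsilon> t (X t) (En t) (Vpar t)) (at t within {0..T})"
    and cE: "(En has_real_derivative \<epsilon> * divF E b t (X t) * En t) (at t within {0..T})"
    and cV: "(Vpar has_real_derivative E t (X t) $ 3) (at t within {0..T})" if "t \<in> {0..T}" for t
    using curve that by (auto simp: characteristic_curve_def)
  have tT: "t \<in> time_range" if "t \<in> {0..T}" for t using that horizon_gt[OF T_pos] by auto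
  obtain B where B: "B \<ge> 1" "\<And>t y. t \<in> time_range \<Longrightarrow> norm (E t y) \<le> B"
    using field_bounds by (elim exE conjE) (rule that, assumption, simp)
  have weighted: "\<bar>\<theta> * q\<bar> \<le> 1 * B" if "0 \<le> \<theta>" "\<theta> \<le> 1" "\<bar>q\<bar> \<le> B" for \<theta> q :: real
    unfolding abs_mult by (rule mult_mono) (use that in auto)
  have E3: "\<bar>E t y $ 3\<bar> \<le> B" if "t \<in> time_range" for t y
    using component_le_norm_cart[of "E t y" 3] B(2)[OF that, of y] by linarith
  obtain Kd where Kd: "Kd \<ge> 0" "\<And>t y. t \<in> time_range \<Longrightarrow> \<bar>divF E b t y\<bar> \<le> Kd" using divF_bounded by blast
  have compact: "\<exists>M. \<forall>t\<in>{0..T}. \<bar>f t\<bar> \<le> M" if "\<And>t. t \<in> {0..T} \<Longrightarrow> (f has_real_derivative f' t) (at t within {0..T})" for f f' :: "real \<Rightarrow> real"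
  proof -
    have "continuous_on {0..T} f"
      using that by (meson DERIV_isCont continuous_on_eq_continuous_within has_field_derivative_imp_has_derivative has_derivative_continuous)
    then have "bounded (f ` {0..T})" by (intro compact_imp_bounded compact_continuous_image) auto
    then show ?thesis by (auto simp: bounded_iff)
  qed
  obtain M1 where M1: "\<And>t. t \<in> {0..T} \<Longrightarrow> \<bar>En t\<bar> \<le> M1" using compact[OF cE] by blast
  obtain M2 where M2: "\<And>t. t \<in> {0..T} \<Longrightarrow> \<bar>Vpar t\<bar> \<le> M2" using compact[OF cV] by blast
  have M0: "M1 \<ge> 0" "M2 \<ge> 0" using M1[of 0] M2[of 0] T_pos by auto
  define c where "c = \<epsilon> * Kd"
  have c0: "c \<ge> 0" using \<epsilon> Kd by (simp add: c_def)
  define c' where "c' = c * (1 + (1 + 2 * c * T))"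
  have c'0: "c' \<ge> 0" using c0 T_pos by (simp add: c'_def)
  define R1 where "R1 = M1 * exp (c' * T) + (M2 + T * (2 * B))"
  define R where "R = (1 + 2 * c * T) * R1 + T * B"
  have M1e: "M1 \<le> M1 * exp (c' * T)" using M0 c'0 T_pos by (simp add: mult_le_cancel_left1)
  have R1: "M1 * exp (c' * T) \<le> R1" "M2 + T * (2 * B) \<le> R1" "M1 \<le> R1" "M2 \<le> R1" "R1 \<ge> 0"
    using M0 M1e T_pos B by (auto simp: R1_def add_nonneg_nonneg intro: add_increasing2 add_increasing)
  have ct: "0 \<le> 2 * c * T" using c0 T_pos by simp
  have RR: "R1 + T * B \<le> R" "(1 + 2 * c * T) * R1 \<le> R" "R1 \<le> R"
  proof -
    have "R1 \<le> (1 + 2 * c * T) * R1" using ct R1(5) by (simp add: distrib_right)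
    moreover have "0 \<le> T * B" using T_pos B by simp
    ultimately show "R1 + T * B \<le> R" "(1 + 2 * c * T) * R1 \<le> R" "R1 \<le> R" by (auto simp: R_def)
  qed
  define D where "D = phase_box R"
  define G where "G = drift_rhs E b \<epsilon>"
  have G: "C11 D G" unfolding D_def G_def by (rule C11_drift_rhs)
  obtain K where K: "K \<ge> 0" "\<And>p. p \<in> D \<Longrightarrow> norm (G p) \<le> K"
    using C11_bounded_lipschitz(1)[OF G] by blast
  obtain L where L: "L \<ge> 0" "\<And>p q. p \<in> D \<Longrightarrow> q \<in> D \<Longrightarrow> norm (G q - G p) \<le> L * norm (q - p)"
    using C11_bounded_lipschitz(2)[OF G] by blast
  have Gp: "G (t, x, e, u) = (Ugc E b \<epsilon> t x e u, \<epsilon> * divF E b t x * e, E t x $ 3)" for t x e u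
    by (simp add: G_def drift_rhs_def)
  have D: "(t, x, e, u) \<in> D \<longleftrightarrow> t \<in> time_range \<and> \<bar>e\<bar> \<le> R \<and> \<bar>u\<bar> \<le> R" for t x e u
    by (auto simp: D_def phase_box_def)
  have energy_factor: "\<bar>a * (\<epsilon> * divF E b t y * e)\<bar> \<le> (a * c) * \<bar>e\<bar>" if "t \<in> time_range" "a \<ge> 0" for a t y e
  proof -
    have "\<bar>\<epsilon> * divF E b t y\<bar> \<le> c" using Kd(2)[OF that(1), of y] \<epsilon> by (simp add: c_def abs_mult mult_left_mono)
    then have "a * \<bar>\<epsilon> * divF E b t y\<bar> * \<bar>e\<bar> \<le> a * c * \<bar>e\<bar>" using that(2) by (intro mult_right_mono mult_left_mono) auto
    then show ?thesis using that(2) by (simp add: abs_mult mult.assoc)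
  qed
  have mid_D: "midpoint_of G h (t, x, e, u) \<in> D"
    if t: "t \<in> {0..T}" and h: "0 \<le> h" "t + h \<le> T" and e: "\<bar>e\<bar> \<le> R1" and u: "\<bar>u\<bar> \<le> R1" for t h x e u
  proof -
    have "\<bar>(h / 2) * (\<epsilon> * divF E b t x * e)\<bar> \<le> (h / 2 * c) * \<bar>e\<bar>" by (rule energy_factor[OF tT[OF t]]) (use h in simp)
    also have "\<dots> \<le> (2 * T * c) * R1" using h t e c0 T_pos by (intro mult_mono) auto
    finally have "\<bar>e + (h / 2) * (\<epsilon> * divF E b t x * e)\<bar> \<le> R1 + (2 * T * c) * R1" using e by linarith
    also have "\<dots> \<le> R" using RR(2) by (simp add: algebra_simps)
    finally have 1: "\<bar>e + (h / 2) * (\<epsilon> * divF E b t x * e)\<bar> \<le> R" .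
    have "\<bar>(h / 2) * E t x $ 3\<bar> \<le> T * B"
      unfolding abs_mult using h t E3[OF tT[OF t], of x] B by (intro mult_mono) auto
    then have 2: "\<bar>u + (h / 2) * E t x $ 3\<bar> \<le> R" using u RR(1) by linarith
    have "t + h / 2 \<in> time_range" using h t by (intro tT) auto
    then show ?thesis using 1 2 by (simp add: Gp D)
  qed
  define Z where "Z = (\<lambda>t. (X t, En t, Vpar t))"
  have Z: "(Z has_vector_derivative G (t, Z t)) (at t within {0..T})" if "t \<in> {0..T}" for t
    unfolding Z_def Gp
    by (intro has_vector_derivative_Pair cX[OF that] cE[OF that, unfolded has_real_derivative_iff_has_vector_derivative]
        cV[OF that, unfolded has_real_derivative_iff_has_vector_derivative])
  have ZD: "(t, Z t) \<in> D" if "t \<in> {0..T}" for t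
    using M1[OF that] M2[OF that] tT[OF that] R1 RR by (simp add: Z_def D)
  have ZM: "midpoint_of G h (t, Z t) \<in> D" if "0 \<le> t" "0 \<le> h" "t + h \<le> T" for t h
    unfolding Z_def by (rule mid_D) (use that M1[of t] M2[of t] R1 in auto)
  define w where "w = 1 + 2 * K + B"
  have w: "w \<ge> 0" using K B by (simp add: w_def)
  define c1 where "c1 = max (2 * w) (4 * L * w)"
  have c1: "c1 \<ge> 0" using w by (simp add: c1_def le_max_iff_disj)
  have \<gamma>1: "0 \<le> \<gamma>" using g by simp
  have Z_all: "\<forall>t\<in>{0..T}. (Z has_vector_derivative G (t, Z t)) (at t within {0..T})"
    and ZD_all: "\<forall>t\<in>{0..T}. (t, Z t) \<in> D"
    and ZM_all: "\<forall>t h. 0 \<le> t \<and> 0 \<le> h \<and> t + h \<le> T \<longrightarrow> midpoint_of G h (t, Z t) \<in> D"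
    using Z ZD ZM by blast+
  obtain C where C: "\<forall>h>0. \<forall>N z q1 q2. real N * h \<le> T \<longrightarrow> z 0 = Z 0 \<longrightarrow>
     (\<forall>n<N. (real n * h, z n) \<in> D \<and> midpoint_of G h (real n * h, z n) \<in> D \<and> q1 n \<in> D \<and> q2 n \<in> D \<and>
        norm (q1 n - (real n * h, z n)) \<le> c1 * h \<and> norm (q2 n - (real n * h, z n)) \<le> c1 * h \<and>
        norm ((1 - \<gamma>) *\<^sub>R (q1 n - (real n * h, z n)) + \<gamma> *\<^sub>R (q2 n - (real n * h, z n))
            - (h / 2) *\<^sub>R (1, G (real n * h, z n))) \<le> c1 * h\<^sup>2 \<and>
        z (Suc n) = z n + h *\<^sub>R ((1 - \<gamma>) *\<^sub>R G (q1 n) + \<gamma> *\<^sub>R G (q2 n))) \<longrightarrow>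
     (\<forall>n\<le>N. norm (z n - Z (real n * h)) \<le> C * h\<^sup>2)"
    using second_order_convergence[OF G c1 \<gamma>1 g(2) T_pos Z_all ZD_all ZM_all] by (elim exE) (rule that)
  show ?thesis
  proof (rule exI[of _ C], intro allI impI, elim conjE)
    fix \<Delta>t y s u u1 yh sh n
    assume dt: "(0::real) < \<Delta>t" and init: "y 0 = X 0" "s 0 = En 0" "u 0 = Vpar 0"
      and steps: "\<forall>n<num_steps T \<Delta>t.
              schemeL_step_upto 0 E b \<epsilon> \<Delta>t (real n * \<Delta>t)
                (y n) (s n) (u n) (u1 n) (yh n) (sh n) (y (Suc n)) (s (Suc n)) (u (Suc n))"
      and n: "n \<le> num_steps T \<Delta>t"
    define N where "N = num_steps T \<Delta>t"
    define t where "t = (\<lambda>n. real n * \<Delta>t)"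
    define th where "th = (\<lambda>n. t n + \<Delta>t / (2 * \<gamma>))"
    define z where "z = (\<lambda>n. (y n, s n, u n))"
    define q1 where "q1 = (\<lambda>n. (t n, y n, s n, u1 n))"
    define q2 where "q2 = (\<lambda>n. (th n, yh n, sh n, u (Suc n)))"
    define d1 where "d1 = (\<lambda>n. divF E b (t n) (y n))"
    define d2 where "d2 = (\<lambda>n. divF E b (th n) (yh n))"
    define Q1 where "Q1 = (\<lambda>n. E (t n) (y n) $ 3)"
    define Q2 where "Q2 = (\<lambda>n. E (th n) (yh n) $ 3)"
    define U1 where "U1 = (\<lambda>n. Ugc E b \<epsilon> (t n) (y n) (s n) (u1 n))"
    define U2 where "U2 = (\<lambda>n. Ugc E b \<epsilon> (th n) (yh n) (sh n) (u (Suc n)))"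
    note times = num_steps_times[OF T_pos dt, folded N_def]
    have Gq1: "G (q1 n) = (U1 n, \<epsilon> * d1 n * s n, Q1 n)" and Gq2: "G (q2 n) = (U2 n, \<epsilon> * d2 n * sh n, Q2 n)" for n
      by (simp_all add: q1_def q2_def Gp U1_def U2_def d1_def d2_def Q1_def Q2_def)
    have tn: "t n \<in> time_range" "th n \<in> time_range" "t n \<in> {0..T}" "t n + \<Delta>t \<le> T" "\<Delta>t \<le> T" if "n < N" for n
      using times(1)[of n] times(2)[of n] times(3)[of n] times(4)[of n] times(5)[of n] that dt by (auto simp: t_def th_def)
    have vec: "a = a' + \<Delta>t *\<^sub>R d" if "norm ((a - a') /\<^sub>R \<Delta>t - d) \<le> 0" for a a' d :: "real^3"
    proof -
      have "a - a' = \<Delta>t *\<^sub>R ((a - a') /\<^sub>R \<Delta>t)" using dt by simp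
      moreover have "(a - a') /\<^sub>R \<Delta>t = d" using that by simp
      ultimately show ?thesis by (metis add.commute diff_add_cancel)
    qed
    have real: "a = a' + \<Delta>t * d" if "\<bar>(a - a') / \<Delta>t - d\<bar> \<le> 0" for a a' d :: real
      using that dt by (simp add: field_simps)
    have st: "u1 n = u n + \<Delta>t * (\<gamma> * Q1 n)"
      "yh n = y n + \<Delta>t *\<^sub>R ((1 / (2 * \<gamma>)) *\<^sub>R U1 n)"
      "sh n = s n + \<Delta>t * (\<epsilon> / (2 * \<gamma>) * s n * d1 n)"
      "u (Suc n) = u n + \<Delta>t * ((1 - \<gamma>) * Q1 n + \<gamma> * Q2 n)"
      "y (Suc n) = y n + \<Delta>t *\<^sub>R ((1 - \<gamma>) *\<^sub>R U1 n + \<gamma> *\<^sub>R U2 n)"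
      "s (Suc n) = s n + \<Delta>t * (\<epsilon> * ((1 - \<gamma>) * s n * d1 n + \<gamma> * sh n * d2 n))" if "n < N" for n
    proof -
      have S: "schemeL_step_upto 0 E b \<epsilon> \<Delta>t (t n) (y n) (s n) (u n) (u1 n) (yh n) (sh n) (y (Suc n)) (s (Suc n)) (u (Suc n))"
        using steps that by (simp add: N_def t_def)
      show "u1 n = u n + \<Delta>t * (\<gamma> * Q1 n)"
        by (rule real) (use S in \<open>simp add: schemeL_step_upto_def Let_def Q1_def\<close>)
      show "yh n = y n + \<Delta>t *\<^sub>R ((1 / (2 * \<gamma>)) *\<^sub>R U1 n)"
        by (rule vec) (use S in \<open>simp add: schemeL_step_upto_def Let_def U1_def\<close>)
      show "sh n = s n + \<Delta>t * (\<epsilon> / (2 * \<gamma>) * s n * d1 n)"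
        by (rule real) (use S in \<open>simp add: schemeL_step_upto_def Let_def d1_def\<close>)
      show "u (Suc n) = u n + \<Delta>t * ((1 - \<gamma>) * Q1 n + \<gamma> * Q2 n)"
        by (rule real) (use S in \<open>simp add: schemeL_step_upto_def Let_def Q1_def Q2_def th_def\<close>)
      show "y (Suc n) = y n + \<Delta>t *\<^sub>R ((1 - \<gamma>) *\<^sub>R U1 n + \<gamma> *\<^sub>R U2 n)"
        by (rule vec) (use S in \<open>simp add: schemeL_step_upto_def Let_def U1_def U2_def th_def\<close>)
      show "s (Suc n) = s n + \<Delta>t * (\<epsilon> * ((1 - \<gamma>) * s n * d1 n + \<gamma> * sh n * d2 n))"
        by (rule real) (use S in \<open>simp add: schemeL_step_upto_def Let_def d1_def d2_def th_def\<close>)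
    qed
    have Qb: "\<bar>Q1 n\<bar> \<le> B" "\<bar>Q2 n\<bar> \<le> B" if "n < N" for n
      using E3 tn[OF that] by (auto simp: Q1_def Q2_def)
    have incr: "\<bar>\<Delta>t * ((1 - \<gamma>) * Q1 n + \<gamma> * Q2 n)\<bar> \<le> \<Delta>t * (2 * B)" if n: "n < N" for n
    proof -
      have "\<bar>(1 - \<gamma>) * Q1 n\<bar> \<le> 1 * B" by (rule weighted[OF _ _ Qb(1)[OF n]]) (use g in auto)
      moreover have "\<bar>\<gamma> * Q2 n\<bar> \<le> 1 * B" by (rule weighted[OF \<gamma>1 g(2) Qb(2)[OF n]])
      ultimately have "\<bar>(1 - \<gamma>) * Q1 n + \<gamma> * Q2 n\<bar> \<le> 2 * B" by linarith
      then show ?thesis using dt by (simp add: abs_mult)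
    qed
    have shb: "\<bar>sh n\<bar> \<le> (1 + 2 * c * T) * \<bar>s n\<bar>" if n: "n < N" for n
    proof -
      have "\<bar>(\<Delta>t * (1 / (2 * \<gamma>))) * (\<epsilon> * divF E b (t n) (y n) * s n)\<bar> \<le> (\<Delta>t * (1 / (2 * \<gamma>)) * c) * \<bar>s n\<bar>"
        by (rule energy_factor[OF tn(1)[OF n]]) (use dt g in simp)
      also have "\<dots> \<le> (T * 2 * c) * \<bar>s n\<bar>"
      proof -
        have "\<Delta>t * (1 / (2 * \<gamma>)) \<le> T * 2" by (rule mult_mono[OF tn(5)[OF n] g(3)]) (use T_pos g in auto)
        then show ?thesis using c0 by (intro mult_right_mono) auto
      qed
      finally have "\<bar>\<Delta>t * (\<epsilon> / (2 * \<gamma>) * s n * d1 n)\<bar> \<le> (T * 2 * c) * \<bar>s n\<bar>" by (simp add: d1_def mult_ac)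
      then have "\<bar>sh n\<bar> \<le> \<bar>s n\<bar> + (T * 2 * c) * \<bar>s n\<bar>" unfolding st(3)[OF n] by linarith
      then show ?thesis by (simp add: algebra_simps)
    qed
    have sstep: "\<bar>s (Suc n)\<bar> \<le> (1 + c' * \<Delta>t) * \<bar>s n\<bar>" if n: "n < N" for n
    proof -
      have 1: "\<bar>(1 - \<gamma>) * (\<epsilon> * divF E b (t n) (y n) * s n)\<bar> \<le> (1 - \<gamma>) * c * \<bar>s n\<bar>"
        by (rule energy_factor[OF tn(1)[OF n]]) (use g in simp)
      have "(1 - \<gamma>) * c * \<bar>s n\<bar> \<le> 1 * c * \<bar>s n\<bar>" using g c0 by (intro mult_right_mono) auto
      have 2: "\<bar>\<gamma> * (\<epsilon> * divF E b (th n) (yh n) * sh n)\<bar> \<le> \<gamma> * c * \<bar>sh n\<bar>"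
        by (rule energy_factor[OF tn(2)[OF n] \<gamma>1])
      have "\<gamma> * c * \<bar>sh n\<bar> \<le> 1 * c * ((1 + 2 * c * T) * \<bar>s n\<bar>)"
        using g c0 shb[OF n] by (intro mult_mono) auto
      have "\<bar>(1 - \<gamma>) * (\<epsilon> * divF E b (t n) (y n) * s n) + \<gamma> * (\<epsilon> * divF E b (th n) (yh n) * sh n)\<bar> \<le> c' * \<bar>s n\<bar>"
      proof -
        have "c' * \<bar>s n\<bar> = 1 * c * \<bar>s n\<bar> + 1 * c * ((1 + 2 * c * T) * \<bar>s n\<bar>)" by (simp add: c'_def algebra_simps)
        moreover have "\<bar>w1 + w2\<bar> \<le> \<bar>w1\<bar> + \<bar>w2\<bar>" for w1 w2 :: real by (rule abs_triangle_ineq)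
        ultimately show ?thesis
          using 1 2 \<open>(1 - \<gamma>) * c * \<bar>s n\<bar> \<le> 1 * c * \<bar>s n\<bar>\<close>
            \<open>\<gamma> * c * \<bar>sh n\<bar> \<le> 1 * c * ((1 + 2 * c * T) * \<bar>s n\<bar>)\<close> by linarith
      qed
      then have "\<bar>\<Delta>t * ((1 - \<gamma>) * (\<epsilon> * divF E b (t n) (y n) * s n) + \<gamma> * (\<epsilon> * divF E b (th n) (yh n) * sh n))\<bar> \<le> \<Delta>t * (c' * \<bar>s n\<bar>)"
        using dt by (simp add: abs_mult mult_left_mono)
      moreover have "s (Suc n) = s n + \<Delta>t * ((1 - \<gamma>) * (\<epsilon> * divF E b (t n) (y n) * s n) + \<gamma> * (\<epsilon> * divF E b (th n) (yh n) * sh n))"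
        unfolding st(6)[OF n] by (simp add: d1_def d2_def algebra_simps)
      ultimately have "\<bar>s (Suc n)\<bar> \<le> \<bar>s n\<bar> + \<Delta>t * (c' * \<bar>s n\<bar>)" by linarith
      then show ?thesis by (simp add: algebra_simps)
    qed
    have sb: "\<bar>s n\<bar> \<le> R1" if n: "n \<le> N" for n
    proof -
      have "\<bar>s n\<bar> \<le> M1 * exp (c' * \<Delta>t) ^ n"
        using n
      proof (induction n)
        case 0 then show ?case using init M1[of 0] T_pos by simp
      next
        case (Suc n)
        then have "\<bar>s (Suc n)\<bar> \<le> (1 + c' * \<Delta>t) * \<bar>s n\<bar>" by (intro sstep) simp
        also have "\<dots> \<le> exp (c' * \<Delta>t) * (M1 * exp (c' * \<Delta>t) ^ n)"
          using Suc c'0 dt by (intro mult_mono exp_ge_add_one_self) auto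
        finally show ?case by (simp add: mult_ac)
      qed
      also have "\<dots> = M1 * exp (c' * (real n * \<Delta>t))" by (simp add: exp_of_nat_mult[symmetric] mult_ac)
      also have "\<dots> \<le> M1 * exp (c' * T)"
        using times(1)[OF n] M0 c'0 by (auto intro!: mult_left_mono)
      finally show ?thesis using R1(1) by linarith
    qed
    have ub: "\<bar>u n\<bar> \<le> R1" if n: "n \<le> N" for n
    proof -
      have "\<bar>u n\<bar> \<le> M2 + (real n * \<Delta>t) * (2 * B)"
        using n
      proof (induction n)
        case 0 then show ?case using init M2[of 0] T_pos by simp
      next
        case (Suc n)
        then have n: "n < N" by simp
        then have "\<bar>u (Suc n)\<bar> \<le> \<bar>u n\<bar> + \<Delta>t * (2 * B)" using incr[OF n] unfolding st(4)[OF n] by linarith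
        then show ?case using Suc by (simp add: algebra_simps)
      qed
      also have "\<dots> \<le> M2 + T * (2 * B)" using times(1)[OF n] B by (intro add_left_mono mult_right_mono) auto
      finally show ?thesis using R1(2) by linarith
    qed
    have zn: "norm (z n - Z (real n * \<Delta>t)) \<le> C * \<Delta>t\<^sup>2"
    proof (rule C[rule_format, of \<Delta>t N z q1 q2], goal_cases)
      case 1 show ?case by (rule dt)
    next
      case 2 show ?case using times(1)[of N] by simp
    next
      case 3 show ?case by (simp add: z_def Z_def init)
    next
      case (4 n)
      then have n: "n < N" .
      let ?p = "(real n * \<Delta>t, z n)"
      have p: "?p = (t n, y n, s n, u n)" by (simp add: z_def t_def)
      have Gpn: "G ?p = (Ugc E b \<epsilon> (t n) (y n) (s n) (u n), \<epsilon> * d1 n * s n, Q1 n)"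
        unfolding p Gp d1_def Q1_def ..
      have pD: "?p \<in> D" unfolding p D using tn[OF n] sb[of n] ub[of n] n RR by simp
      have mD: "midpoint_of G \<Delta>t ?p \<in> D"
        unfolding p by (rule mid_D) (use tn[OF n] sb[of n] ub[of n] n dt in auto)
      have gQ: "\<bar>\<Delta>t * (\<gamma> * Q1 n)\<bar> \<le> \<Delta>t * (1 * B)"
        using weighted[OF \<gamma>1 g(2) Qb(1)[OF n]] dt by (simp add: abs_mult)
      have q1D: "q1 n \<in> D"
      proof -
        have "\<Delta>t * (1 * B) \<le> T * B" using tn(5)[OF n] B by (simp add: mult_right_mono)
        then have "\<bar>u1 n\<bar> \<le> R" unfolding st(1)[OF n] using gQ ub[of n] n RR(1) by simp
        then show ?thesis unfolding q1_def D using tn[OF n] sb[of n] n RR by simp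
      qed
      have q2D: "q2 n \<in> D"
      proof -
        have "(1 + 2 * c * T) * \<bar>s n\<bar> \<le> (1 + 2 * c * T) * R1" using sb[of n] n ct by (intro mult_left_mono) auto
        then have "\<bar>sh n\<bar> \<le> R" using shb[OF n] RR(2) by linarith
        then show ?thesis unfolding q2_def D using tn[OF n] ub[of "Suc n"] n RR by simp
      qed
      have nU: "norm (U1 n) \<le> K" "\<bar>\<epsilon> * d1 n * s n\<bar> \<le> K"
      proof -
        have "norm (fst (G (q1 n))) \<le> K" by (rule order_trans[OF norm_triple_components(1) K(2)[OF q1D]])
        then show "norm (U1 n) \<le> K" by (simp add: Gq1)
        have "norm (fst (snd (G (q1 n)))) \<le> K" by (rule order_trans[OF norm_triple_components(2) K(2)[OF q1D]])
        then show "\<bar>\<epsilon> * d1 n * s n\<bar> \<le> K" by (simp add: Gq1)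
      qed
      have hg: "\<Delta>t * (1 / (2 * \<gamma>)) \<le> \<Delta>t * 2" using g dt by (intro mult_left_mono) auto
      have hg0: "0 \<le> \<Delta>t * (1 / (2 * \<gamma>))" using g dt by simp
      have diff1: "q1 n - ?p = (0, 0, 0, \<Delta>t * (\<gamma> * Q1 n))"
        unfolding p q1_def st(1)[OF n] by simp
      have diff2: "q2 n - ?p = (\<Delta>t * (1 / (2 * \<gamma>)), (\<Delta>t * (1 / (2 * \<gamma>))) *\<^sub>R U1 n, (\<Delta>t * (1 / (2 * \<gamma>))) * (\<epsilon> * d1 n * s n),
          \<Delta>t * ((1 - \<gamma>) * Q1 n + \<gamma> * Q2 n))"
        unfolding p q2_def st(2)[OF n] st(3)[OF n] st(4)[OF n] by (simp add: th_def)
      have n1: "norm (q1 n - ?p) \<le> (2 * w) * \<Delta>t"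
      proof -
        have "norm (q1 n - ?p) = \<bar>\<Delta>t * (\<gamma> * Q1 n)\<bar>" unfolding diff1 by (simp add: norm_Pair)
        also have "\<dots> \<le> \<Delta>t * (2 * w)"
        proof -
          have "1 * B \<le> 2 * w" using K(1) B(1) by (simp add: w_def)
          then have "\<Delta>t * (1 * B) \<le> \<Delta>t * (2 * w)" using dt by (intro mult_left_mono) auto
          then show ?thesis using gQ by linarith
        qed
        finally show ?thesis by (simp add: mult.commute)
      qed
      have n2: "norm (q2 n - ?p) \<le> (2 * w) * \<Delta>t"
      proof -
        have a1: "norm ((\<Delta>t * (1 / (2 * \<gamma>))) *\<^sub>R U1 n) \<le> (\<Delta>t * 2) * K"
          unfolding norm_scaleR abs_of_nonneg[OF hg0] by (rule mult_mono[OF hg nU(1)]) (use dt in auto)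
        have a2: "\<bar>(\<Delta>t * (1 / (2 * \<gamma>))) * (\<epsilon> * d1 n * s n)\<bar> \<le> (\<Delta>t * 2) * K"
          unfolding abs_mult[of "\<Delta>t * (1 / (2 * \<gamma>))"] abs_of_nonneg[OF hg0] by (rule mult_mono[OF hg nU(2)]) (use dt in auto)
        note a3 = incr[OF n]
        have pair: "norm (a, v, a', a'') \<le> \<bar>a\<bar> + norm v + \<bar>a'\<bar> + \<bar>a''\<bar>" for a a' a'' :: real and v :: "real^3"
          using norm_Pair_le[of a "(v, a', a'')"] norm_Pair_le[of v "(a', a'')"] norm_Pair_le[of a' a''] by simp
        have "norm (q2 n - ?p) \<le> \<Delta>t * 2 + (\<Delta>t * 2) * K + (\<Delta>t * 2) * K + \<Delta>t * (2 * B)"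
          unfolding diff2 using pair[of "\<Delta>t * (1 / (2 * \<gamma>))"] a1 a2 a3 hg hg0
          by (smt (verit, best))
        then show ?thesis by (simp add: w_def algebra_simps)
      qed
      have L1: "norm (U1 n - Ugc E b \<epsilon> (t n) (y n) (s n) (u n)) \<le> L * ((2 * w) * \<Delta>t)"
      proof -
        have "norm (fst (G (q1 n) - G ?p)) \<le> L * norm (q1 n - ?p)" by (rule order_trans[OF norm_triple_components(1) L(2)[OF pD q1D]])
        then show ?thesis using mult_left_mono[OF n1 L(1)] by (simp add: Gq1 Gpn)
      qed
      have L2: "\<bar>Q2 n - Q1 n\<bar> \<le> L * ((2 * w) * \<Delta>t)"
      proof -
        have "norm (snd (snd (G (q2 n) - G ?p))) \<le> L * norm (q2 n - ?p)" by (rule order_trans[OF norm_triple_components(3) L(2)[OF pD q2D]])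
        then show ?thesis using mult_left_mono[OF n2 L(1)] by (simp add: Gq2 Gpn)
      qed
      have rest: "(1 - \<gamma>) *\<^sub>R (q1 n - ?p) + \<gamma> *\<^sub>R (q2 n - ?p) - (\<Delta>t / 2) *\<^sub>R (1, G ?p)
         = (0, (\<Delta>t / 2) *\<^sub>R (U1 n - Ugc E b \<epsilon> (t n) (y n) (s n) (u n)), 0, \<Delta>t * \<gamma>\<^sup>2 * (Q2 n - Q1 n))"
      proof -
        have h1: "\<gamma> * (\<Delta>t * (1 / (2 * \<gamma>))) = \<Delta>t / 2" using g by simp
        have h2: "\<gamma> *\<^sub>R ((\<Delta>t * (1 / (2 * \<gamma>))) *\<^sub>R U1 n) = (\<Delta>t / 2) *\<^sub>R U1 n" using h1 by simp
        have h3: "\<gamma> * ((\<Delta>t * (1 / (2 * \<gamma>))) * (\<epsilon> * d1 n * s n)) = (\<Delta>t / 2) * (\<epsilon> * d1 n * s n)" using h1 by (metis mult.assoc)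
        have sq: "\<gamma>\<^sup>2 = 2 * \<gamma> - 1/2" using \<gamma>_root by simp
        have "(1 - \<gamma>) * (\<Delta>t * (\<gamma> * Q1 n)) + \<gamma> * (\<Delta>t * ((1 - \<gamma>) * Q1 n + \<gamma> * Q2 n)) - (\<Delta>t / 2) * Q1 n
            = \<Delta>t * (2 * \<gamma> - 2 * \<gamma>\<^sup>2 - 1/2) * Q1 n + \<Delta>t * \<gamma>\<^sup>2 * Q2 n"
          by (simp add: power2_eq_square algebra_simps)
        also have "2 * \<gamma> - 2 * \<gamma>\<^sup>2 - 1/2 = - \<gamma>\<^sup>2" using sq by linarith
        also have "\<Delta>t * - \<gamma>\<^sup>2 * Q1 n + \<Delta>t * \<gamma>\<^sup>2 * Q2 n = \<Delta>t * \<gamma>\<^sup>2 * (Q2 n - Q1 n)" by (simp add: algebra_simps)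
        finally have h4: "(1 - \<gamma>) * (\<Delta>t * (\<gamma> * Q1 n)) + \<gamma> * (\<Delta>t * ((1 - \<gamma>) * Q1 n + \<gamma> * Q2 n)) - (\<Delta>t / 2) * Q1 n
            = \<Delta>t * \<gamma>\<^sup>2 * (Q2 n - Q1 n)" .
        show ?thesis unfolding diff1 diff2 Gpn
          by (simp only: scaleR_Pair add_Pair diff_Pair real_scaleR_def h1 h2 h3 h4) (simp add: scaleR_right_diff_distrib)
      qed
      have n3: "norm ((1 - \<gamma>) *\<^sub>R (q1 n - ?p) + \<gamma> *\<^sub>R (q2 n - ?p) - (\<Delta>t / 2) *\<^sub>R (1, G ?p)) \<le> (4 * L * w) * \<Delta>t\<^sup>2"
      proof -
        have "norm ((\<Delta>t / 2) *\<^sub>R (U1 n - Ugc E b \<epsilon> (t n) (y n) (s n) (u n))) \<le> \<Delta>t * (L * ((2 * w) * \<Delta>t))"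
          unfolding norm_scaleR using L1 dt by (intro mult_mono) auto
        moreover have "\<bar>\<Delta>t * \<gamma>\<^sup>2 * (Q2 n - Q1 n)\<bar> \<le> (\<Delta>t * 1) * (L * ((2 * w) * \<Delta>t))"
          unfolding abs_mult[of "\<Delta>t * \<gamma>\<^sup>2"]
        proof (rule mult_mono[OF _ L2])
          have "\<gamma>\<^sup>2 \<le> 1" using g by (simp add: power_le_one)
          then show "\<bar>\<Delta>t * \<gamma>\<^sup>2\<bar> \<le> \<Delta>t * 1" using dt by (simp add: abs_mult mult_left_le)
        qed (use dt in auto)
        moreover have "norm (0::real, v, 0::real, a) \<le> norm v + \<bar>a\<bar>" for v :: "real^3" and a :: real
          using norm_Pair_le[of v "(0::real, a)"] by (simp add: norm_Pair)
        ultimately have "norm ((1 - \<gamma>) *\<^sub>R (q1 n - ?p) + \<gamma> *\<^sub>R (q2 n - ?p) - (\<Delta>t / 2) *\<^sub>R (1, G ?p)) \<le> \<Delta>t * (L * ((2 * w) * \<Delta>t)) + (\<Delta>t * 1) * (L * ((2 * w) * \<Delta>t))"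
          unfolding rest by (smt (verit, best))
        then show ?thesis by (simp add: power2_eq_square algebra_simps)
      qed
      have zS: "z (Suc n) = z n + \<Delta>t *\<^sub>R ((1 - \<gamma>) *\<^sub>R G (q1 n) + \<gamma> *\<^sub>R G (q2 n))"
        unfolding Gq1 Gq2 z_def st(4)[OF n] st(5)[OF n] st(6)[OF n] by (simp add: algebra_simps)
      have up: "a * \<Delta>t ^ k \<le> c1 * \<Delta>t ^ k" if "a \<le> c1" for a k using that dt by (intro mult_right_mono) auto
      have c1le: "2 * w \<le> c1" "4 * L * w \<le> c1" by (auto simp: c1_def)
      show ?case
        using pD mD q1D q2D zS order_trans[OF n1 up[OF c1le(1), of 1, simplified]] order_trans[OF n2 up[OF c1le(1), of 1, simplified]]
          order_trans[OF n3 up[OF c1le(2), of 2]] by blast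
    next
      case 5 show ?case using n by (simp add: N_def)
    qed
    have "norm (fst (z n - Z (real n * \<Delta>t))) \<le> C * \<Delta>t\<^sup>2" by (rule order_trans[OF norm_triple_components(1) zn])
    moreover have "norm (fst (snd (z n - Z (real n * \<Delta>t)))) \<le> C * \<Delta>t\<^sup>2" by (rule order_trans[OF norm_triple_components(2) zn])
    moreover have "norm (snd (snd (z n - Z (real n * \<Delta>t)))) \<le> C * \<Delta>t\<^sup>2" by (rule order_trans[OF norm_triple_components(3) zn])
    ultimately show "norm (y n - X (real n * \<Delta>t)) \<le> C * \<Delta>t\<^sup>2 \<and>
              \<bar>s n - En (real n * \<Delta>t)\<bar> \<le> C * \<Delta>t\<^sup>2 \<and>
              \<bar>u n - Vpar (real n * \<Delta>t)\<bar> \<le> C * \<Delta>t\<^sup>2"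
      by (simp add: z_def Z_def)
  qed
qed

end

section \<open>Boundedness, consistency and second order\<close>

theorem proposition3p3:
  fixes E :: "real \<Rightarrow> real^3 \<Rightarrow> real^3"
    and \<phi> :: "real \<Rightarrow> real^3 \<Rightarrow> real"
    and b :: "real \<Rightarrow> real^3 \<Rightarrow> real"
    and chi :: "real \<Rightarrow> real^3 \<Rightarrow> real"
    and b0 T :: real
    and x0 v0 :: "real \<Rightarrow> real^3" and e0 :: "real \<Rightarrow> real"
    and x v v1 xh vh :: "real \<Rightarrow> real \<Rightarrow> nat \<Rightarrow> real^3"
    and e eh :: "real \<Rightarrow> real \<Rightarrow> nat \<Rightarrow> real"
  assumes T_pos: "T > 0"
    and E_gradient: "\<And>t y. (t, y) \<in> field_domain T \<Longrightarrow>
          (\<phi> t has_derivative (\<lambda>h. - (E t y \<bullet> h))) (at y)"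
    and E_regular: "\<And>i. W_inf 1 (field_domain T) (\<lambda>(t, y). E t y $ i)"
    and b0_pos: "b0 > 0"
    and b_lower: "\<And>t y. (t, y) \<in> field_domain T \<Longrightarrow> b t y > b0"
    and b_perp: "\<And>t y. b t y = b t (perp y)"
    and b_regular: "W_inf 2 (field_domain T) (\<lambda>(t, y). b t y)"
    and chi_regular: "W_inf_loc 1 (\<lambda>(s, w). chi s w)"
    and chi_diag: "\<And>w. chi ((norm (perp w))\<^sup>2 / 2) (perp w) = 0"
    and chi_zero: "\<And>s. s \<ge> 0 \<Longrightarrow> chi s 0 = s"
    and chi_bounds: "\<And>s w. s \<ge> 0 \<Longrightarrow> 0 \<le> chi s (perp w) \<and> chi s (perp w) \<le> s"
    and chi_negative: "\<And>s w. s < 0 \<Longrightarrow> \<bar>chi s (perp w)\<bar> \<le> \<bar>s\<bar>"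
    and energy_range: "(\<forall>s<0. chi s 0 = s) \<or> (\<forall>\<epsilon>>0. e0 \<epsilon> \<ge> 0)"
    and initial_bounded: "\<exists>M. \<forall>\<epsilon>>0. norm (x0 \<epsilon>) \<le> M \<and> norm (v0 \<epsilon>) \<le> M \<and> \<bar>e0 \<epsilon>\<bar> \<le> M"
    and initial: "\<And>\<Delta>t \<epsilon>. \<Delta>t > 0 \<Longrightarrow> \<epsilon> > 0 \<Longrightarrow>
          x \<Delta>t \<epsilon> 0 = x0 \<epsilon> \<and> v \<Delta>t \<epsilon> 0 = v0 \<epsilon> \<and> e \<Delta>t \<epsilon> 0 = e0 \<epsilon>"
    and scheme: "\<And>\<Delta>t \<epsilon> n. \<Delta>t > 0 \<Longrightarrow> \<epsilon> > 0 \<Longrightarrow> n < num_steps T \<Delta>t \<Longrightarrow>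
          schemeS_step E b chi \<epsilon> \<Delta>t (real n * \<Delta>t)
            (x \<Delta>t \<epsilon> n) (v \<Delta>t \<epsilon> n) (e \<Delta>t \<epsilon> n)
            (v1 \<Delta>t \<epsilon> n) (xh \<Delta>t \<epsilon> n) (eh \<Delta>t \<epsilon> n) (vh \<Delta>t \<epsilon> n)
            (x \<Delta>t \<epsilon> (Suc n)) (v \<Delta>t \<epsilon> (Suc n)) (e \<Delta>t \<epsilon> (Suc n))"
  shows
    "(\<exists>C. \<forall>\<Delta>t>0. \<forall>\<epsilon>>0. \<forall>n\<le>num_steps T \<Delta>t.
        norm (x \<Delta>t \<epsilon> n) \<le> C \<and> norm (v \<Delta>t \<epsilon> n) \<le> C \<and> \<bar>e \<Delta>t \<epsilon> n\<bar> \<le> C) \<and>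
     (\<forall>\<Delta>t>0. \<exists>C. \<forall>\<epsilon>>0. \<forall>n. 1 \<le> n \<and> n < num_steps T \<Delta>t \<longrightarrow>
        schemeL_step_upto (C * \<epsilon>\<^sup>2) E b \<epsilon> \<Delta>t (real n * \<Delta>t)
          (x \<Delta>t \<epsilon> n) (e \<Delta>t \<epsilon> n) (v \<Delta>t \<epsilon> n $ 3)
          (v1 \<Delta>t \<epsilon> n $ 3) (xh \<Delta>t \<epsilon> n) (eh \<Delta>t \<epsilon> n)
          (x \<Delta>t \<epsilon> (Suc n)) (e \<Delta>t \<epsilon> (Suc n)) (v \<Delta>t \<epsilon> (Suc n) $ 3)) \<and>
     ((\<forall>i. W_inf 2 (field_domain T) (\<lambda>(t, y). E t y $ i)) \<and>
      W_inf 3 (field_domain T) (\<lambda>(t, y). b t y) \<longrightarrow>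
      (\<forall>\<epsilon>>0. \<forall>X En Vpar. characteristic_curve E b \<epsilon> T X En Vpar \<longrightarrow>
        (\<exists>C. \<forall>\<Delta>t>0. \<forall>y s u u1 yh sh.
           y 0 = X 0 \<and> s 0 = En 0 \<and> u 0 = Vpar 0 \<and>
           (\<forall>n<num_steps T \<Delta>t.
              schemeL_step_upto 0 E b \<epsilon> \<Delta>t (real n * \<Delta>t)
                (y n) (s n) (u n) (u1 n) (yh n) (sh n) (y (Suc n)) (s (Suc n)) (u (Suc n))) \<longrightarrow>
           (\<forall>n\<le>num_steps T \<Delta>t.
              norm (y n - X (real n * \<Delta>t)) \<le> C * \<Delta>t\<^sup>2 \<and>
              \<bar>s n - En (real n * \<Delta>t)\<bar> \<le> C * \<Delta>t\<^sup>2 \<and>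
              \<bar>u n - Vpar (real n * \<Delta>t)\<bar> \<le> C * \<Delta>t\<^sup>2))))"
proof -
  interpret semi_implicit_run E \<phi> b b0 T chi x0 v0 e0 x v v1 xh vh e eh
    by unfold_locales
      (fact T_pos E_gradient E_regular b0_pos b_lower b_regular chi_regular chi_zero chi_bounds chi_negative
        energy_range initial_bounded initial scheme)+
  have "\<exists>C. \<forall>\<Delta>t>0. \<forall>\<epsilon>>0. \<forall>n\<le>num_steps T \<Delta>t.
        norm (x \<Delta>t \<epsilon> n) \<le> C \<and> norm (v \<Delta>t \<epsilon> n) \<le> C \<and> \<bar>e \<Delta>t \<epsilon> n\<bar> \<le> C"
  proof -
    obtain C where "\<forall>\<Delta>t>0. \<forall>\<epsilon>>0. (\<forall>n\<le>num_steps T \<Delta>t.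
        norm (x \<Delta>t \<epsilon> n) \<le> C \<and> norm (v \<Delta>t \<epsilon> n) \<le> C \<and> \<bar>e \<Delta>t \<epsilon> n\<bar> \<le> C) \<and>
        (\<forall>n<num_steps T \<Delta>t. norm (v1 \<Delta>t \<epsilon> n) \<le> C \<and> \<bar>eh \<Delta>t \<epsilon> n\<bar> \<le> C)"
      using uniform_bounds by (elim exE conjE) (rule that)
    then show ?thesis by (intro exI[of _ C]) simp
  qed
  moreover have "\<forall>\<epsilon>>0. \<forall>X En Vpar. characteristic_curve E b \<epsilon> T X En Vpar \<longrightarrow>
        (\<exists>C. \<forall>\<Delta>t>0. \<forall>y s u u1 yh sh.
           y 0 = X 0 \<and> s 0 = En 0 \<and> u 0 = Vpar 0 \<and>
           (\<forall>n<num_steps T \<Delta>t.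
              schemeL_step_upto 0 E b \<epsilon> \<Delta>t (real n * \<Delta>t)
                (y n) (s n) (u n) (u1 n) (yh n) (sh n) (y (Suc n)) (s (Suc n)) (u (Suc n))) \<longrightarrow>
           (\<forall>n\<le>num_steps T \<Delta>t.
              norm (y n - X (real n * \<Delta>t)) \<le> C * \<Delta>t\<^sup>2 \<and>
              \<bar>s n - En (real n * \<Delta>t)\<bar> \<le> C * \<Delta>t\<^sup>2 \<and>
              \<bar>u n - Vpar (real n * \<Delta>t)\<bar> \<le> C * \<Delta>t\<^sup>2))"
    if "(\<forall>i. W_inf 2 (field_domain T) (\<lambda>(t, y). E t y $ i)) \<and> W_inf 3 (field_domain T) (\<lambda>(t, y). b t y)"
  proof -
    interpret smooth_gyro_fields E \<phi> b b0 T
      by unfold_locales (use that in blast)+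
    show ?thesis using second_order_in_time by blast
  qed
  ultimately show ?thesis
    using consistent_with_drift_kinetic by blast
qed

end
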